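(* Let $X \subset \mathcal{A}^G$ be a subshift (over a finite alphabet $\mathcal{A}$) over a countable amenable group $G$, let $\phi \in SV(X)$ be a potential with summable variation, and let $\mu_\phi$ be an equilibrium state for $\phi$. Then $\mu_\phi$ is $(\mathfrak{T}_X^0, \psi_\phi)$-conformal.
   Context: $\mathcal{A}$ is a finite set with the discrete topology and $\mathcal{A}^G$ has the product topology. For $g \in G$ and $x \in \mathcal{A}^G$, $\sigma_g(x)_h = x_{gh}$ for all $h \in G$. A subshift is a closed set $X \subset \mathcal{A}^G$ with $\sigma_g(X) \subset X$ for all $g \in G$. For $H\subset G$, $x_H$ is the restriction of $x$ to $H$, and $F^c = G \setminus F$. A potential is a continuous function $\phi : X \to \mathbb{R}$. For $E \subset G$, $Var_E(\phi) = \sup\{\phi(x) - \phi(y) : x,y \in X,\ x_E = y_E\}$. An exhaustive sequence is a sequence of finite sets $E_1 \subset E_2 \subset \cdots$ with $\bigcup_n E_n = G$. A potential $\phi$ has summable variation, written $\phi \in SV(X)$, if there is an exhaustive sequence $\{E_n\}$ with $\sum_{n \in \mathbb{N}} |E_{n+1}^{-1} \setminus E_n^{-1}| \cdot Var_{E_n}(\phi) < \infty$. $\mathcal{M}_\sigma(X)$ is the set of Borel probability measures on $X$ invariant under all $\sigma_g$; $h(\mu)$ is the Kolmogorov–Sinai entropy with respect to the $G$-action. An equilibrium state for $\phi$ is a $\mu \in \mathcal{M}_\sigma(X)$ maximizing $h(\mu) + \int \phi \, d\mu$ over $\mathcal{M}_\sigma(X)$. The homoclinic relation is $\mathfrak{T}_X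 = \{(x,y) \in X \times X : x_{F^c} = y_{F^c} \text{ for some finite } F \subset G\}$. Let $\mathcal{F}(X)$ be the group of homeomorphisms $f : X \to X$ for which there is a finite $F \subset G$ with $f(x)_{F^c} = x_{F^c}$ for all $x \in X$, and let $\mathfrak{T}_X^0 = \{(x, f(x)) : x \in X, f \in \mathcal{F}(X)\} \subset \mathfrak{T}_X$. For $(x,y) \in \mathfrak{T}_X$, the cocycle $\psi_\phi$ is $\psi_\phi(x,y) = \sum_{g \in G} \big(\phi(\sigma_g(y)) - \phi(\sigma_g(x))\big)$ (absolutely convergent for $\phi \in SV(X)$). A Borel probability measure $\mu$ on $X$ is $(\mathfrak{T}_X^0, \psi_\phi)$-conformal if: (i) $\mu$ is $\mathfrak{T}_X^0$-nonsingular, i.e. for every $\mu$-null set $A \subset X$, the set $\{y \in X : (x,y) \in \mathfrak{T}_X^0 \text{ for some } x \in A\}$ is $\mu$-null; and (ii) for every Borel isomorphism $f : X \to X$ with $(x, f(x)) \in \mathfrak{T}_X^0$ for all $x \in X$, $\frac{d(\mu \circ f)}{d\mu}(x) = \exp(\psi_\phi(x, f(x)))$ for $\mu$-almost every $x$, where $(\mu \circ f)(A) = \mu(f(A))$. *)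

theory Defs
  imports "HOL-Probability.Probability" "HOL-Algebra.Coset"
begin

section \<open>Subshifts\<close>

definition full_shift_topology :: "('g, 'm) monoid_scheme \<Rightarrow> 'a set \<Rightarrow> ('g \<Rightarrow> 'a) topology" where
  "full_shift_topology G A = product_topology (\<lambda>_. discrete_topology A) (carrier G)"

text \<open>
  Configurations are extensional functions on \<^term>\<open>carrier G\<close>. With this formula
  \<open>shift G g \<circ> shift G h = shift G (h \<otimes> g)\<close>, that is, the shifts form a right action.
\<close>

definition shift :: "('g, 'm) monoid_scheme \<Rightarrow> 'g \<Rightarrow> ('g \<Rightarrow> 'a) \<Rightarrow> 'g \<Rightarrow> 'a" where
  "shift G g x = (\<lambda>h\<in>carrier G. x (g \<otimes>\<^bsub>G\<^esub> h))"

definition subshift :: "('g, 'm) monoid_scheme \<Rightarrow> 'a set \<Rightarrow> ('g \<Rightarrow> 'a) set \<Rightarrow> bool" where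
  "subshift G A X \<longleftrightarrow>
     closedin (full_shift_topology G A) X \<and> (\<forall>g\<in>carrier G. shift G g ` X \<subseteq> X)"

definition subshift_topology ::
    "('g, 'm) monoid_scheme \<Rightarrow> 'a set \<Rightarrow> ('g \<Rightarrow> 'a) set \<Rightarrow> ('g \<Rightarrow> 'a) topology" where
  "subshift_topology G A X = subtopology (full_shift_topology G A) X"

definition borel_of :: "'x topology \<Rightarrow> 'x measure" where
  "borel_of T = sigma (topspace T) {U. openin T U}"

section \<open>Potentials\<close>

definition potential ::
    "('g, 'm) monoid_scheme \<Rightarrow> 'a set \<Rightarrow> ('g \<Rightarrow> 'a) set \<Rightarrow> (('g \<Rightarrow> 'a) \<Rightarrow> real) \<Rightarrow> bool" where
  "potential G A X \<phi> \<longleftrightarrow> continuous_map (subshift_topology G A X) euclideanreal \<phi>"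

definition variation :: "('g \<Rightarrow> 'a) set \<Rightarrow> 'g set \<Rightarrow> (('g \<Rightarrow> 'a) \<Rightarrow> real) \<Rightarrow> real" where
  "variation X E \<phi> = Sup {\<phi> x - \<phi> y | x y. x \<in> X \<and> y \<in> X \<and> restrict x E = restrict y E}"

definition exhaustive_sequence :: "('g, 'm) monoid_scheme \<Rightarrow> (nat \<Rightarrow> 'g set) \<Rightarrow> bool" where
  "exhaustive_sequence G E \<longleftrightarrow>
     (\<forall>n. finite (E n)) \<and> (\<forall>n. E n \<subseteq> E (Suc n)) \<and> (\<Union>n. E n) = carrier G"

definition summable_variation ::
    "('g, 'm) monoid_scheme \<Rightarrow> 'a set \<Rightarrow> ('g \<Rightarrow> 'a) set \<Rightarrow> (('g \<Rightarrow> 'a) \<Rightarrow> real) \<Rightarrow> bool" where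
  "summable_variation G A X \<phi> \<longleftrightarrow>
     potential G A X \<phi> \<and>
     (\<exists>E. exhaustive_sequence G E \<and>
          summable (\<lambda>n. real (card (set_inv\<^bsub>G\<^esub> E (Suc n) - set_inv\<^bsub>G\<^esub> E n)) * variation X (E n) \<phi>))"

section \<open>Amenability and entropy\<close>

text \<open>
  Translates are taken on the right because the shifts form a right action. The inverses of the
  sets of such a sequence are asymptotically invariant under left translation, and conversely.
\<close>

definition folner_sequence :: "('g, 'm) monoid_scheme \<Rightarrow> (nat \<Rightarrow> 'g set) \<Rightarrow> bool" where
  "folner_sequence G F \<longleftrightarrow>
     (\<forall>n. finite (F n) \<and> F n \<noteq> {} \<and> F n \<subseteq> carrier G) \<and>
     (\<forall>g\<in>carrier G.
        (\<lambda>n. real (card (sym_diff (F n #>\<^bsub>G\<^esub> g) (F n))) / real (card (F n))) \<longlonglongrightarrow> 0)"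

definition amenable :: "('g, 'm) monoid_scheme \<Rightarrow> bool" where
  "amenable G \<longleftrightarrow> (\<exists>F. folner_sequence G F)"

definition finite_measurable_partition :: "'x measure \<Rightarrow> 'x set set \<Rightarrow> bool" where
  "finite_measurable_partition M P \<longleftrightarrow> finite P \<and> partition_on (space M) P \<and> P \<subseteq> sets M"

definition partition_entropy :: "'x measure \<Rightarrow> 'x set set \<Rightarrow> real" where
  "partition_entropy M P = - (\<Sum>C\<in>P. measure M C * ln (measure M C))"

definition shift_preimage ::
    "('g, 'm) monoid_scheme \<Rightarrow> ('g \<Rightarrow> 'a) measure \<Rightarrow> 'g \<Rightarrow> ('g \<Rightarrow> 'a) set set \<Rightarrow> ('g \<Rightarrow> 'a) set set" where
  "shift_preimage G M g P = (\<lambda>C. shift G g -` C \<inter> space M) ` P"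

text \<open>
  The entropy of a partition is the common value of the limit along all Folner sequences; it exists
  for an invariant probability measure and an amenable group by the Ornstein--Weiss lemma.
\<close>

definition partition_ks_entropy ::
    "('g, 'm) monoid_scheme \<Rightarrow> ('g \<Rightarrow> 'a) measure \<Rightarrow> ('g \<Rightarrow> 'a) set set \<Rightarrow> real" where
  "partition_ks_entropy G M P =
     (THE h. \<forall>F. folner_sequence G F \<longrightarrow>
        (\<lambda>n. partition_entropy M (common_refinement ((\<lambda>g. shift_preimage G M g P) ` F n))
               / real (card (F n))) \<longlonglongrightarrow> h)"

definition ks_entropy :: "('g, 'm) monoid_scheme \<Rightarrow> ('g \<Rightarrow> 'a) measure \<Rightarrow> ereal" where
  "ks_entropy G M = (SUP P \<in> {P. finite_measurable_partition M P}. ereal (partition_ks_entropy G M P))"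

section \<open>Equilibrium states\<close>

definition borel_prob_measures ::
    "('g, 'm) monoid_scheme \<Rightarrow> 'a set \<Rightarrow> ('g \<Rightarrow> 'a) set \<Rightarrow> ('g \<Rightarrow> 'a) measure set" where
  "borel_prob_measures G A X =
     {\<mu>. prob_space \<mu> \<and> space \<mu> = X \<and> sets \<mu> = sets (borel_of (subshift_topology G A X))}"

definition invariant_measures ::
    "('g, 'm) monoid_scheme \<Rightarrow> 'a set \<Rightarrow> ('g \<Rightarrow> 'a) set \<Rightarrow> ('g \<Rightarrow> 'a) measure set" where
  "invariant_measures G A X =
     {\<mu> \<in> borel_prob_measures G A X.
        \<forall>g\<in>carrier G. shift G g \<in> measurable \<mu> \<mu> \<and> distr \<mu> \<mu> (shift G g) = \<mu>}"

definition equilibrium_state ::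
    "('g, 'm) monoid_scheme \<Rightarrow> 'a set \<Rightarrow> ('g \<Rightarrow> 'a) set \<Rightarrow> (('g \<Rightarrow> 'a) \<Rightarrow> real)
      \<Rightarrow> ('g \<Rightarrow> 'a) measure \<Rightarrow> bool" where
  "equilibrium_state G A X \<phi> \<mu> \<longleftrightarrow>
     \<mu> \<in> invariant_measures G A X \<and>
     (\<forall>\<nu>\<in>invariant_measures G A X.
        ks_entropy G \<nu> + ereal (integral\<^sup>L \<nu> \<phi>) \<le> ks_entropy G \<mu> + ereal (integral\<^sup>L \<mu> \<phi>))"

section \<open>Homoclinic relations and conformal measures\<close>

definition homoclinic_relation ::
    "('g, 'm) monoid_scheme \<Rightarrow> ('g \<Rightarrow> 'a) set \<Rightarrow> (('g \<Rightarrow> 'a) \<times> ('g \<Rightarrow> 'a)) set" where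
  "homoclinic_relation G X =
     {(x, y). x \<in> X \<and> y \<in> X \<and>
        (\<exists>F. finite F \<and> F \<subseteq> carrier G \<and> restrict x (carrier G - F) = restrict y (carrier G - F))}"

definition local_homeomorphisms ::
    "('g, 'm) monoid_scheme \<Rightarrow> 'a set \<Rightarrow> ('g \<Rightarrow> 'a) set \<Rightarrow> (('g \<Rightarrow> 'a) \<Rightarrow> ('g \<Rightarrow> 'a)) set" where
  "local_homeomorphisms G A X =
     {f. homeomorphic_map (subshift_topology G A X) (subshift_topology G A X) f \<and>
         (\<exists>F. finite F \<and> F \<subseteq> carrier G \<and>
            (\<forall>x\<in>X. restrict (f x) (carrier G - F) = restrict x (carrier G - F)))}"

definition homoclinic_relation0 ::
    "('g, 'm) monoid_scheme \<Rightarrow> 'a set \<Rightarrow> ('g \<Rightarrow> 'a) set \<Rightarrow> (('g \<Rightarrow> 'a) \<times> ('g \<Rightarrow> 'a)) set" where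
  "homoclinic_relation0 G A X = {(x, f x) | x f. x \<in> X \<and> f \<in> local_homeomorphisms G A X}"

lemma homoclinic_relation0_subset:
  assumes "subshift G A X"
  shows "homoclinic_relation0 G A X \<subseteq> homoclinic_relation G X"
proof -
  have "topspace (subshift_topology G A X) = X"
    using assms closedin_subset[of "full_shift_topology G A" X]
    by (auto simp: subshift_def subshift_topology_def)
  then have im: "f ` X = X" if "f \<in> local_homeomorphisms G A X" for f
    using that homeomorphic_imp_surjective_map[of "subshift_topology G A X" "subshift_topology G A X" f]
    by (simp add: local_homeomorphisms_def)
  show ?thesis
  proof
    fix p assume "p \<in> homoclinic_relation0 G A X"
    then obtain x f where p: "p = (x, f x)" "x \<in> X" and f: "f \<in> local_homeomorphisms G A X"
      by (auto simp: homoclinic_relation0_def)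
    have "f x \<in> X"
      using im[OF f] p(2) by blast
    moreover obtain F where "finite F" "F \<subseteq> carrier G"
      "restrict (f x) (carrier G - F) = restrict x (carrier G - F)"
      using f p(2) unfolding local_homeomorphisms_def by blast
    ultimately show "p \<in> homoclinic_relation G X"
      unfolding homoclinic_relation_def p(1) using p(2) by (simp, metis)
  qed
qed

definition potential_cocycle ::
    "('g, 'm) monoid_scheme \<Rightarrow> (('g \<Rightarrow> 'a) \<Rightarrow> real) \<Rightarrow> ('g \<Rightarrow> 'a) \<Rightarrow> ('g \<Rightarrow> 'a) \<Rightarrow> real" where
  "potential_cocycle G \<phi> x y = (\<Sum>\<^sub>\<infinity>g\<in>carrier G. \<phi> (shift G g y) - \<phi> (shift G g x))"

text \<open>
  The null sets of the completion are all subsets of measurable null sets, so that no measurability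
  of the set or of its saturation is presupposed.
\<close>

definition nonsingular :: "'x measure \<Rightarrow> ('x \<times> 'x) set \<Rightarrow> bool" where
  "nonsingular M R \<longleftrightarrow>
     (\<forall>N \<in> null_sets (completion M).
        {y \<in> space M. \<exists>x\<in>N. (x, y) \<in> R} \<in> null_sets (completion M))"

definition measurable_isomorphism :: "'x measure \<Rightarrow> ('x \<Rightarrow> 'x) \<Rightarrow> bool" where
  "measurable_isomorphism M f \<longleftrightarrow>
     bij_betw f (space M) (space M) \<and> f \<in> measurable M M \<and> inv_into (space M) f \<in> measurable M M"

definition image_measure :: "'x measure \<Rightarrow> ('x \<Rightarrow> 'x) \<Rightarrow> 'x measure" where
  "image_measure M f = measure_of (space M) (sets M) (\<lambda>C. emeasure M (f ` C))"

definition conformal :: "'x measure \<Rightarrow> ('x \<times> 'x) set \<Rightarrow> ('x \<Rightarrow> 'x \<Rightarrow> real) \<Rightarrow> bool" where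
  "conformal M R \<psi> \<longleftrightarrow>
     nonsingular M R \<and>
     (\<forall>f. measurable_isomorphism M f \<and> (\<forall>x\<in>space M. (x, f x) \<in> R) \<longrightarrow>
        (AE x in M. RN_deriv M (image_measure M f) x = ennreal (exp (\<psi> x (f x)))))"

end

theory Submission
  imports Defs
begin

text \<open>The equilibrium state \<open>\<mu>\<close> is tested against the invariant measures obtained from it by resampling. Let
  \<open>w\<close> and \<open>w'\<close> be interchangeable patterns on a finite window \<open>W\<close>, and suppose that
  \<open>\<psi> x (patch W w' x)\<close> is within \<open>\<eta>\<close> of \<open>t\<close> on the cylinder of \<open>w\<close>. Choose a random invariant set of sites
  whose mutual differences avoid a large finite set \<open>D\<close>. At each chosen site that shows one of the two patterns,
  show \<open>w\<close> with the Gibbs probability \<open>q = 1 / (1 + e\<^sup>t)\<close> and \<open>w'\<close> otherwise, independently. Per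
  site, the gain in entropy plus the gain in energy is a relative entropy up to a multiple of \<open>\<eta>\<close>:
  summable variation makes the interaction between distant sites negligible. The variational principle forces this
  gain to be at most \<open>0\<close>, so \<open>\<mu> (cyl W w') \<approx> e\<^sup>t \<mu> (cyl W w)\<close>. Refining the cylinders makes \<open>\<psi>\<close> nearly
  constant on each of them, and the approximate identity becomes the change of variables formula for the swap of
  \<open>w\<close> and \<open>w'\<close>; every element of the group of local homeomorphisms agrees on countably many
  pieces with such swaps. Entropies are computed as Foelner limits of the
  Shannon entropies of windows, by Shearer's inequality and a generator argument.\<close>

section \<open>Entropy of finite-valued functions\<close>

text \<open>The set \<open>D\<close> must contain the differences of a finite set outside which the
  influence of a change is below \<eta>. It may grow as \<eta> shrinks, and the density
  \<open>site_prob\<close> of resampled sites may then tend to 0. The argument survives because gain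
  and error are both proportional to this density, which cancels: entropy is gained site by site,
  and the energy error counts only sites that are really updated. For a similar reason each error
  carries the factor \<open>measure \<mu> (cyl W w) + measure \<mu> (cyl W w')\<close>: the number
  of cylinders in a refinement is unbounded, but these factors have a bounded sum. Sites come from
  thinning independent marks, since the competing measure must be invariant and a general amenable
  group offers no periodic set of sites. The subshift need not be of finite type, so one pattern may
  replace another only if both exchanges stay in \<open>X\<close>; a homeomorphism of finite support
  provides such pairs because it and its inverse are determined by finite windows.\<close>

definition rv_entropy :: "'x measure \<Rightarrow> ('x \<Rightarrow> 'b) \<Rightarrow> real" where
  "rv_entropy M V =
     - (\<Sum>y\<in>V ` space M. measure M (V -` {y} \<inter> space M) * ln (measure M (V -` {y} \<inter> space M)))"

lemma rv_entropy_cong: "(\<And>x. x \<in> space M \<Longrightarrow> U x = V x) \<Longrightarrow> rv_entropy M U = rv_entropy M V"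
proof -
  assume *: "\<And>x. x \<in> space M \<Longrightarrow> U x = V x"
  have "U ` space M = V ` space M" "U -` {y} \<inter> space M = V -` {y} \<inter> space M" for y
    using * by auto
  then show ?thesis by (simp add: rv_entropy_def)
qed

context prob_space
begin

text \<open>Base \<open>exp 1\<close> turns \<open>log\<close> into \<open>ln\<close>, the logarithm
  of \<open>partition_entropy\<close>.\<close>

lemma information_space_exp: "information_space M (exp 1)"
  by unfold_locales simp

lemma rv_entropy_eq:
  assumes "simple_function M V"
  shows "rv_entropy M V = entropy (exp 1) (count_space (V ` space M)) V"
proof -
  interpret information_space M "exp 1" by (rule information_space_exp)
  have "simple_distributed M V (\<lambda>y. measure M (V -` {y} \<inter> space M))"
    using assms by (intro simple_distributedI) auto
  from entropy_simple_distributed[OF this] show ?thesis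
    by (simp add: rv_entropy_def log_def)
qed

lemma rv_entropy_comp_le:
  assumes "simple_function M V"
  shows "rv_entropy M (f \<circ> V) \<le> rv_entropy M V"
proof -
  interpret information_space M "exp 1" by (rule information_space_exp)
  show ?thesis
    using entropy_data_processing[OF assms, of f] assms
    by (simp add: rv_entropy_eq simple_function_compose1 comp_def)
qed

text \<open>Entropy depends on a function only through the partition into its fibres, and a coarser
  partition has less of it. Most comparisons of entropies below are of this kind, with values
  recoded at will as tuples or restrictions.\<close>

lemma rv_entropy_factor_le:
  assumes "simple_function M V" "\<And>x y. x \<in> space M \<Longrightarrow> y \<in> space M \<Longrightarrow> V x = V y \<Longrightarrow> U x = U y"
  shows "rv_entropy M U \<le> rv_entropy M V"
proof -
  define f where "f v = U (SOME x. x \<in> space M \<and> V x = v)" for v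
  have "U x = (f \<circ> V) x" if x: "x \<in> space M" for x
  proof -
    have "(SOME y. y \<in> space M \<and> V y = V x) \<in> space M \<and> V (SOME y. y \<in> space M \<and> V y = V x) = V x"
      by (rule someI[of _ x]) (simp add: x)
    then show ?thesis
      using assms(2)[OF _ x] unfolding f_def comp_def by metis
  qed
  then have "rv_entropy M U = rv_entropy M (f \<circ> V)" by (rule rv_entropy_cong)
  then show ?thesis using rv_entropy_comp_le[OF assms(1)] by simp
qed

lemma rv_entropy_eqI:
  assumes "simple_function M V" "simple_function M U"
    "\<And>x y. x \<in> space M \<Longrightarrow> y \<in> space M \<Longrightarrow> V x = V y \<longleftrightarrow> U x = U y"
  shows "rv_entropy M U = rv_entropy M V"
  by (rule antisym; rule rv_entropy_factor_le) (use assms in simp_all)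

text \<open>Spreads a marginal entropy over the joint values, so that the four entropies in
  submodularity become one sum over the same index set and can be compared term by term.\<close>

lemma rv_entropy_eq_sum_factor:
  assumes V: "simple_function M V" and U: "\<And>x. x \<in> space M \<Longrightarrow> U x = f (V x)"
  shows "rv_entropy M U = - (\<Sum>v\<in>V ` space M. prob (V -` {v} \<inter> space M) * ln (prob (U -` {f v} \<inter> space M)))"
proof -
  have fin: "finite (V ` space M)" and meas: "\<And>v. V -` {v} \<inter> space M \<in> events"
    using simple_functionD[OF V] by simp_all
  have img: "U ` space M = f ` V ` space M"
    using U by force
  have "(\<Sum>v\<in>V ` space M. prob (V -` {v} \<inter> space M) * ln (prob (U -` {f v} \<inter> space M)))
      = (\<Sum>u\<in>f ` V ` space M. \<Sum>v\<in>{v\<in>V ` space M. f v = u}. prob (V -` {v} \<inter> space M) * ln (prob (U -` {f v} \<inter> space M)))"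
    by (rule sum.image_gen) (rule fin)
  also have "\<dots> = (\<Sum>u\<in>f ` V ` space M. prob (U -` {u} \<inter> space M) * ln (prob (U -` {u} \<inter> space M)))"
  proof (rule sum.cong)
    fix u assume "u \<in> f ` V ` space M"
    have *: "U -` {u} \<inter> space M = (\<Union>v\<in>{v\<in>V ` space M. f v = u}. V -` {v} \<inter> space M)"
      using U by auto
    have "prob (U -` {u} \<inter> space M) = (\<Sum>v\<in>{v\<in>V ` space M. f v = u}. prob (V -` {v} \<inter> space M))"
      unfolding * using fin meas
      by (intro finite_measure_finite_Union) (auto simp: disjoint_family_on_def)
    then show "(\<Sum>v\<in>{v\<in>V ` space M. f v = u}. prob (V -` {v} \<inter> space M) * ln (prob (U -` {f v} \<inter> space M)))
      = prob (U -` {u} \<inter> space M) * ln (prob (U -` {u} \<inter> space M))"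
      by (simp add: sum_distrib_right)
  qed simp
  finally show ?thesis by (simp add: rv_entropy_def img)
qed

text \<open>The difference of the two sides is the conditional mutual information of
  \<open>U\<close> and \<open>V\<close> given \<open>W\<close>, which is nonnegative.\<close>

lemma rv_entropy_submodular:
  assumes U: "simple_function M U" and V: "simple_function M V" and W: "simple_function M W"
  shows "rv_entropy M (\<lambda>x. (U x, V x, W x)) + rv_entropy M W
    \<le> rv_entropy M (\<lambda>x. (U x, W x)) + rv_entropy M (\<lambda>x. (V x, W x))"
proof -
  interpret information_space M "exp 1" by (rule information_space_exp)
  let ?T = "\<lambda>x. (U x, V x, W x)"
  have T: "simple_function M ?T" and UW: "simple_function M (\<lambda>x. (U x, W x))"
    and VW: "simple_function M (\<lambda>x. (V x, W x))"
    by (intro simple_function_Pair U V W)+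
  define p where "p v = prob (?T -` {v} \<inter> space M)" for v
  define pu where "pu v = prob ((\<lambda>x. (U x, W x)) -` {v} \<inter> space M)" for v
  define pv where "pv v = prob ((\<lambda>x. (V x, W x)) -` {v} \<inter> space M)" for v
  define pw where "pw v = prob (W -` {v} \<inter> space M)" for v
  have sets: "\<And>v. (\<lambda>x. (U x, W x)) -` {v} \<inter> space M \<in> events"
    "\<And>v. (\<lambda>x. (V x, W x)) -` {v} \<inter> space M \<in> events" "\<And>v. W -` {v} \<inter> space M \<in> events"
    by (rule simple_functionD(2), fact)+
  have "0 \<le> conditional_mutual_information (exp 1) (count_space (U ` space M))
      (count_space (V ` space M)) (count_space (W ` space M)) U V W"
    by (rule conditional_mutual_information_nonneg) fact+
  also have "\<dots> = (\<Sum>(a, b, c)\<in>?T ` space M. p (a, b, c) * log (exp 1) (p (a, b, c) / (pu (a, c) * (pv (b, c) / pw c))))"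
    by (rule conditional_mutual_information_eq; unfold p_def pu_def pv_def pw_def;
        rule simple_distributedI[OF _ measure_nonneg refl]; fact)
  also have "\<dots> = (\<Sum>v\<in>?T ` space M. p v * ln (p v) + p v * ln (pw (snd (snd v)))
      - p v * ln (pu (fst v, snd (snd v))) - p v * ln (pv (snd v)))"
  proof (rule sum.cong, rule refl, clarify)
    fix x assume "x \<in> space M"
    let ?a = "U x" and ?b = "V x" and ?c = "W x"
    \<comment> \<open>An atom of positive joint mass has positive marginal masses, so the logarithm
      of the quotient splits; an atom of mass 0 contributes 0 on both sides.\<close>
    have le: "p (?a, ?b, ?c) \<le> pw ?c" "p (?a, ?b, ?c) \<le> pu (?a, ?c)" "p (?a, ?b, ?c) \<le> pv (?b, ?c)"
      unfolding p_def pw_def pu_def pv_def by (rule finite_measure_mono; use sets in auto)+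
    show "p (?a, ?b, ?c) * log (exp 1) (p (?a, ?b, ?c) / (pu (?a, ?c) * (pv (?b, ?c) / pw ?c)))
      = p (?a, ?b, ?c) * ln (p (?a, ?b, ?c)) + p (?a, ?b, ?c) * ln (pw (snd (snd (?a, ?b, ?c))))
      - p (?a, ?b, ?c) * ln (pu (fst (?a, ?b, ?c), snd (snd (?a, ?b, ?c)))) - p (?a, ?b, ?c) * ln (pv (snd (?a, ?b, ?c)))"
    proof (cases "p (?a, ?b, ?c) = 0")
      case False
      then have "p (?a, ?b, ?c) > 0" by (simp add: p_def zero_less_measure_iff)
      then have "0 < p (?a, ?b, ?c)" "0 < pw ?c" "0 < pu (?a, ?c)" "0 < pv (?b, ?c)"
        using le by auto
      then show ?thesis by (simp add: log_def ln_div ln_mult algebra_simps)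
    qed simp
  qed
  also have "\<dots> = - rv_entropy M ?T - rv_entropy M W + rv_entropy M (\<lambda>x. (U x, W x)) + rv_entropy M (\<lambda>x. (V x, W x))"
    using rv_entropy_eq_sum_factor[OF T, of ?T "\<lambda>v. v"] rv_entropy_eq_sum_factor[OF T, of W "\<lambda>v. snd (snd v)"]
      rv_entropy_eq_sum_factor[OF T, of "\<lambda>x. (U x, W x)" "\<lambda>v. (fst v, snd (snd v))"]
      rv_entropy_eq_sum_factor[OF T, of "\<lambda>x. (V x, W x)" snd]
    by (simp add: sum.distrib sum_subtractf p_def pu_def pv_def pw_def)
  finally show ?thesis by linarith
qed

lemma rv_entropy_const: 
  assumes "\<And>x. x \<in> space M \<Longrightarrow> U x = c" shows "rv_entropy M U = 0"
proof -
  have "U ` space M = {c}" "U -` {c} \<inter> space M = space M" using assms not_empty by auto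
  then show ?thesis by (simp add: rv_entropy_def prob_space)
qed

text \<open>Submodularity with the trivial condition \<open>()\<close>, whose entropy is 0.\<close>

lemma rv_entropy_pair_le:
  assumes U: "simple_function M U" and V: "simple_function M V"
  shows "rv_entropy M (\<lambda>x. (U x, V x)) \<le> rv_entropy M U + rv_entropy M V"
proof -
  have c: "simple_function M (\<lambda>_. ())" by simp
  have "rv_entropy M (\<lambda>x. (U x, V x)) = rv_entropy M (\<lambda>x. (U x, V x, ()))"
    "rv_entropy M (\<lambda>x. (U x, ())) = rv_entropy M U" "rv_entropy M (\<lambda>x. (V x, ())) = rv_entropy M V"
    by (rule rv_entropy_eqI; (intro simple_function_Pair U V c)?; auto)+
  then show ?thesis
    using rv_entropy_submodular[OF U V c] rv_entropy_const[of "\<lambda>_. ()"] by simp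
qed

lemma rv_entropy_le_ln_card:
  assumes "simple_function M V" "V ` space M \<subseteq> S" "finite S"
  shows "rv_entropy M V \<le> ln (card S)"
proof -
  interpret information_space M "exp 1" by (rule information_space_exp)
  have "rv_entropy M V \<le> log (exp 1) (card (V ` space M))"
    using entropy_le_card[OF simple_distributedI[OF assms(1) measure_nonneg refl]]
    by (simp add: rv_entropy_eq[OF assms(1)])
  also have "\<dots> \<le> ln (card S)"
  proof -
    have "0 < card (V ` space M)"
      using not_empty finite_subset[OF assms(2,3)] by (simp add: card_gt_0_iff)
    then show ?thesis
      using card_mono[OF assms(3,2)] by (simp add: log_def)
  qed
  finally show ?thesis .
qed

lemma rv_entropy_distr:
  assumes T: "T \<in> measurable M N" and V: "simple_function N V"
  shows "rv_entropy (distr M N T) V = rv_entropy M (\<lambda>x. V (T x))"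
proof -
  have m: "measure (distr M N T) (V -` {y} \<inter> space N) = prob ((\<lambda>x. V (T x)) -` {y} \<inter> space M)" for y
    using measurable_space[OF T]
    by (subst measure_distr[OF T simple_functionD(2)[OF V]]) (auto intro!: arg_cong[where f=prob])
  have sub: "(\<lambda>x. V (T x)) ` space M \<subseteq> V ` space N"
    using measurable_space[OF T] by auto
  have z: "prob ((\<lambda>x. V (T x)) -` {y} \<inter> space M) = 0" if "y \<notin> (\<lambda>x. V (T x)) ` space M" for y
  proof -
    have "(\<lambda>x. V (T x)) -` {y} \<inter> space M = {}" using that by auto
    then show ?thesis by simp
  qed
  have "finite (V ` space N)" using V by (rule simple_functionD(1))
  then show ?thesis
    unfolding rv_entropy_def space_distr m
    by (subst sum.mono_neutral_right[OF _ sub]) (use z in auto)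
qed

end

section \<open>Entropy averages along Foelner sequences\<close>

text \<open>Induction on \<open>L\<close>, one point \<open>h\<close> at a time. By submodularity
  the increment from \<open>L\<close> to \<open>insert h L\<close> is at most the increment seen
  inside each \<open>E i\<close> that contains \<open>h\<close>, and at least \<open>k\<close> of
  these sets do.\<close>

lemma shearer_inequality:
  fixes H :: "'b set \<Rightarrow> real"
  assumes empty: "H {} = 0"
    and mono: "\<And>S T. S \<subseteq> T \<Longrightarrow> finite T \<Longrightarrow> T \<subseteq> U \<Longrightarrow> H S \<le> H T"
    and submod: "\<And>S T. finite S \<Longrightarrow> finite T \<Longrightarrow> S \<subseteq> U \<Longrightarrow> T \<subseteq> U \<Longrightarrow> H (S \<union> T) + H (S \<inter> T) \<le> H S + H T"
    and I: "finite I"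
  shows "finite L \<Longrightarrow> L \<subseteq> U \<Longrightarrow> (\<And>h. h \<in> L \<Longrightarrow> k \<le> card {i\<in>I. h \<in> E i}) \<Longrightarrow> real k * H L \<le> (\<Sum>i\<in>I. H (E i \<inter> L))"
proof (induction L rule: finite_induct)
  case empty
  then show ?case using assms(1) by simp
next
  case (insert h L)
  have up: "H L \<le> H (insert h L)" using insert by (intro mono) auto
  have "real k * H (insert h L) = real k * H L + real k * (H (insert h L) - H L)"
    by (simp add: algebra_simps)
  also have "real k * H L \<le> (\<Sum>i\<in>I. H (E i \<inter> L))" using insert by auto
  also have "real k * (H (insert h L) - H L) \<le> real (card {i\<in>I. h \<in> E i}) * (H (insert h L) - H L)"
    using insert.prems(2)[of h] up by (intro mult_right_mono) auto
  also have "\<dots> = (\<Sum>i\<in>I. if h \<in> E i then H (insert h L) - H L else 0)"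
    using I by (simp add: sum.If_cases Int_def)
  also have "(\<Sum>i\<in>I. H (E i \<inter> L)) + \<dots> \<le> (\<Sum>i\<in>I. H (E i \<inter> insert h L))"
    unfolding sum.distrib[symmetric]
  proof (rule sum_mono)
    fix i assume "i \<in> I"
    show "H (E i \<inter> L) + (if h \<in> E i then H (insert h L) - H L else 0) \<le> H (E i \<inter> insert h L)"
    proof (cases "h \<in> E i")
      case True
      have "(E i \<inter> insert h L) \<union> L = insert h L" "(E i \<inter> insert h L) \<inter> L = E i \<inter> L"
        using True insert.hyps by auto
      moreover have "E i \<inter> insert h L \<subseteq> U" using insert.prems by auto
      ultimately show ?thesis using submod[of "E i \<inter> insert h L" L] insert True by auto
    next
      case False
      then show ?thesis by simp
    qed
  qed
  finally show ?case by simp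
qed

section \<open>Foelner sets and their right interiors\<close>

context group
begin

text \<open>Right translates, as in \<open>folner_sequence\<close>. Later \<open>M\<close> is a
  pattern window, or the set of its differences, and the points left out form a boundary of density
  0.\<close>

definition inner_points :: "'a set \<Rightarrow> 'a set \<Rightarrow> 'a set" where
  "inner_points M S = {h\<in>S. \<forall>m\<in>M. h \<otimes> m \<in> S}"

text \<open>A point that fails to be inner is moved out of \<open>F n\<close> by some
  \<open>m\<close> in \<open>M\<close>, and \<open>h \<mapsto> h \<otimes> m\<close> injects the
  points moved out by \<open>m\<close> into the symmetric difference of \<open>F n\<close> and its
  translate.\<close>

lemma folner_inner_points:
  assumes F: "folner_sequence G F" and M: "finite M" "M \<subseteq> carrier G"
  shows "(\<lambda>n. real (card (F n - inner_points M (F n))) / real (card (F n))) \<longlonglongrightarrow> 0"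
proof (rule tendsto_sandwich[OF _ _ tendsto_const])
  let ?d = "\<lambda>n m. real (card (sym_diff (F n #> m) (F n))) / real (card (F n))"
  have fin: "finite (F n)" "F n \<noteq> {}" "F n \<subseteq> carrier G" for n
    using F by (auto simp: folner_sequence_def)
  have "(\<lambda>n. \<Sum>m\<in>M. ?d n m) \<longlonglongrightarrow> (\<Sum>m\<in>M. 0)"
    using F M by (intro tendsto_sum) (auto simp: folner_sequence_def)
  then show "(\<lambda>n. \<Sum>m\<in>M. ?d n m) \<longlonglongrightarrow> 0" by simp
  show "\<forall>\<^sub>F n in sequentially. real (card (F n - inner_points M (F n))) / real (card (F n)) \<le> (\<Sum>m\<in>M. ?d n m)"
  proof (rule always_eventually, rule allI)
    fix n
    have finr: "finite (F n #> m)" for m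
      using fin by (auto simp: r_coset_def)
    have sub: "F n - inner_points M (F n) \<subseteq> (\<Union>m\<in>M. {h\<in>F n. h \<otimes> m \<notin> F n})"
      by (auto simp: inner_points_def)
    have "card (F n - inner_points M (F n)) \<le> card (\<Union>m\<in>M. {h\<in>F n. h \<otimes> m \<notin> F n})"
      using fin M sub by (intro card_mono) auto
    also have "\<dots> \<le> (\<Sum>m\<in>M. card {h\<in>F n. h \<otimes> m \<notin> F n})"
      using M(1) by (rule card_UN_le)
    also have "\<dots> \<le> (\<Sum>m\<in>M. card (sym_diff (F n #> m) (F n)))"
    proof (rule sum_mono)
      fix m assume m: "m \<in> M"
      show "card {h\<in>F n. h \<otimes> m \<notin> F n} \<le> card (sym_diff (F n #> m) (F n))"
      proof (rule card_inj_on_le[of "\<lambda>h. h \<otimes> m"])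
        show "inj_on (\<lambda>h. h \<otimes> m) {h \<in> F n. h \<otimes> m \<notin> F n}"
          using fin(3)[of n] m M by (intro inj_onI) (auto simp: subset_iff)
      qed (use finr fin in \<open>auto simp: r_coset_def\<close>)
    qed
    finally have "real (card (F n - inner_points M (F n))) \<le> (\<Sum>m\<in>M. real (card (sym_diff (F n #> m) (F n))))"
      by (metis of_nat_le_iff of_nat_sum)
    then show "real (card (F n - inner_points M (F n))) / real (card (F n)) \<le> (\<Sum>m\<in>M. ?d n m)"
      by (simp add: sum_divide_distrib[symmetric] divide_right_mono)
  qed
qed auto

lemma inner_points_ratio:
  assumes F: "folner_sequence G F" and M: "finite M" "M \<subseteq> carrier G"
  shows "(\<lambda>n. real (card (inner_points M (F n))) / real (card (F n))) \<longlonglongrightarrow> 1"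
proof -
  have "real (card (inner_points M (F n))) / real (card (F n))
    = 1 - real (card (F n - inner_points M (F n))) / real (card (F n))" for n
  proof -
    have fin: "finite (F n)" "F n \<noteq> {}" and sub: "inner_points M (F n) \<subseteq> F n"
      using F by (auto simp: folner_sequence_def inner_points_def)
    then have "real (card (F n - inner_points M (F n))) = real (card (F n)) - real (card (inner_points M (F n)))"
      by (simp add: card_Diff_subset finite_subset of_nat_diff card_mono)
    then show ?thesis using fin by (simp add: field_simps card_gt_0_iff)
  qed
  then show ?thesis
    using tendsto_diff[OF tendsto_const folner_inner_points[OF assms], of 1] by simp
qed

end

text \<open>Shared by the label entropies of all finite partitions, so that one limit theorem serves
  the partitions in \<open>ks_entropy\<close> as well as the windows. Invariance concerns left
  translates, Foelner sets are nearly invariant on the right; the two fit together because the left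
  translates of \<open>D\<close> inside \<open>S\<close> are indexed by the right interior
  \<open>inner_points D S\<close>.\<close>

locale invariant_submodular = group G for G (structure) +
  fixes H :: "'a set \<Rightarrow> real"
  assumes H_empty: "H {} = 0"
    and H_mono: "\<And>S T. S \<subseteq> T \<Longrightarrow> finite T \<Longrightarrow> T \<subseteq> carrier G \<Longrightarrow> H S \<le> H T"
    and H_submod: "\<And>S T. finite S \<Longrightarrow> finite T \<Longrightarrow> S \<subseteq> carrier G \<Longrightarrow> T \<subseteq> carrier G
      \<Longrightarrow> H (S \<union> T) + H (S \<inter> T) \<le> H S + H T"
    and H_translate: "\<And>g S. g \<in> carrier G \<Longrightarrow> finite S \<Longrightarrow> S \<subseteq> carrier G \<Longrightarrow> H ((\<lambda>h. g \<otimes> h) ` S) = H S"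
begin

lemma H_nonneg: "finite S \<Longrightarrow> S \<subseteq> carrier G \<Longrightarrow> 0 \<le> H S"
  using H_mono[of "{}" S] H_empty by simp

lemma H_Un_le:
  assumes "finite S" "finite T" "S \<subseteq> carrier G" "T \<subseteq> carrier G"
  shows "H (S \<union> T) \<le> H S + H T"
  using H_submod[OF assms] H_nonneg[of "S \<inter> T"] assms by (simp add: le_infI1)

lemma H_le_card: "finite S \<Longrightarrow> S \<subseteq> carrier G \<Longrightarrow> H S \<le> real (card S) * H {\<one>}"
proof (induction S rule: finite_induct)
  case (insert h S)
  have "H (insert h S) \<le> H {h} + H S" using H_Un_le[of "{h}" S] insert by auto
  also have "H {h} = H {\<one>}" using H_translate[of h "{\<one>}"] insert by simp
  finally show ?case using insert by (simp add: algebra_simps)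
qed (simp add: H_empty)

lemma H_Diff_le:
  assumes "finite S" "S \<subseteq> carrier G" "T \<subseteq> S"
  shows "H S \<le> H T + real (card (S - T)) * H {\<one>}"
proof -
  have "T \<union> (S - T) = S" using assms by auto
  then have "H S \<le> H T + H (S - T)"
    using H_Un_le[of T "S - T"] assms finite_subset[OF assms(3)] by auto
  then show ?thesis using H_le_card[of "S - T"] assms by fastforce
qed

text \<open>Averaging over all translates of \<open>D\<close> inside \<open>S\<close> takes the
  place of a tiling. An inner point \<open>h\<close> is covered by
  \<open>(h \<otimes> inv d) D\<close> for every \<open>d\<close> in \<open>D\<close>, hence
  \<open>card D\<close> times; \<open>M\<close> collects the elements that must keep
  \<open>h\<close> inside \<open>S\<close> for these translates to lie in \<open>S\<close>.
  Shearer's inequality treats the inner points, and each remaining point costs at most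
  \<open>H {\<one>}\<close>.\<close>

lemma H_tiling_bound:
  assumes D: "finite D" "D \<subseteq> carrier G" "D \<noteq> {}"
  defines "M \<equiv> (\<lambda>d. inv d) ` D \<union> (\<lambda>(d, d'). inv d \<otimes> d') ` (D \<times> D)"
  assumes S: "finite S" "S \<subseteq> carrier G"
  shows "H S \<le> real (card S) * (H D / real (card D)) + real (card (S - inner_points M S)) * H {\<one>}"
proof -
  let ?L = "inner_points M S" and ?I = "inner_points D S" and ?E = "\<lambda>g. (\<lambda>h. g \<otimes> h) ` D"
  have L: "finite ?L" "?L \<subseteq> carrier G" "?L \<subseteq> S" and I: "finite ?I" "?I \<subseteq> S"
    using S by (auto simp: inner_points_def)
  have "real (card D) * H ?L \<le> (\<Sum>g\<in>?I. H (?E g \<inter> ?L))"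
  proof (rule shearer_inequality[where U = "carrier G"])
    fix h assume h: "h \<in> ?L"
    show "card D \<le> card {g \<in> ?I. h \<in> ?E g}"
    proof (rule card_inj_on_le[of "\<lambda>d. h \<otimes> inv d"])
      have hc: "h \<in> carrier G" using h L by auto
      then show "inj_on (\<lambda>d. h \<otimes> inv d) D"
        using D by (intro inj_onI) (metis Units_eq Units_l_cancel inv_closed inv_inv subsetD)
      show "(\<lambda>d. h \<otimes> inv d) ` D \<subseteq> {g \<in> ?I. h \<in> ?E g}"
      proof clarify
        fix d assume d: "d \<in> D"
        then have dc: "d \<in> carrier G" using D by auto
        have "h \<otimes> inv d \<in> S" using h d by (auto simp: inner_points_def M_def)
        moreover have "h \<otimes> inv d \<otimes> d' \<in> S" if d': "d' \<in> D" for d'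
        proof -
          have "h \<otimes> (inv d \<otimes> d') \<in> S" using h d d' by (force simp: inner_points_def M_def)
          then show ?thesis using hc dc d' D by (simp add: m_assoc subset_iff)
        qed
        moreover have "h = h \<otimes> inv d \<otimes> d" using hc dc by (simp add: m_assoc)
        ultimately show "h \<otimes> inv d \<in> ?I \<and> h \<in> ?E (h \<otimes> inv d)"
          using d by (auto simp: inner_points_def)
      qed
      show "finite {g \<in> ?I. h \<in> ?E g}" using I by simp
    qed
  qed (use H_empty H_mono H_submod L I in auto)
  also have "\<dots> \<le> (\<Sum>g\<in>?I. H D)"
  proof (rule sum_mono)
    fix g assume "g \<in> ?I"
    then have g: "g \<in> carrier G" using I S by auto
    then have "H (?E g \<inter> ?L) \<le> H (?E g)" using D by (intro H_mono) auto
    then show "H (?E g \<inter> ?L) \<le> H D" using H_translate[OF g D(1,2)] by simp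
  qed
  also have "\<dots> \<le> real (card S) * H D"
    using card_mono[OF S(1) I(2)] H_nonneg[OF D(1,2)] by (simp add: mult_right_mono)
  finally have "H ?L \<le> real (card S) * (H D / real (card D))"
    using D by (simp add: field_simps card_gt_0_iff)
  then show ?thesis using H_Diff_le[OF S L(3)] by linarith
qed

definition mean_entropy :: real where
  "mean_entropy = (INF D\<in>{D. finite D \<and> D \<noteq> {} \<and> D \<subseteq> carrier G}. H D / real (card D))"

text \<open>The infimum bounds each quotient from below, and a set \<open>D\<close> that nearly
  attains it bounds the quotients from above through the averaged covering. The limit is therefore
  the same along all Foelner sequences.\<close>

theorem folner_limit:
  assumes F: "folner_sequence G F"
  shows "(\<lambda>n. H (F n) / real (card (F n))) \<longlonglongrightarrow> mean_entropy"
proof (rule order_tendstoI)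
  let ?DD = "{D. finite D \<and> D \<noteq> {} \<and> D \<subseteq> carrier G}"
  have F': "finite (F n)" "F n \<noteq> {}" "F n \<subseteq> carrier G" for n
    using F by (auto simp: folner_sequence_def)
  have bdd: "bdd_below ((\<lambda>D. H D / real (card D)) ` ?DD)"
    using H_nonneg by (intro bdd_belowI[of _ 0]) auto
  fix a assume "a < mean_entropy"
  moreover have "mean_entropy \<le> H (F n) / real (card (F n))" for n
    unfolding mean_entropy_def using F' by (intro cINF_lower[OF bdd]) auto
  ultimately show "\<forall>\<^sub>F n in sequentially. a < H (F n) / real (card (F n))"
    by (intro always_eventually allI) (rule less_le_trans)
next
  let ?DD = "{D. finite D \<and> D \<noteq> {} \<and> D \<subseteq> carrier G}"
  have F': "finite (F n)" "F n \<noteq> {}" "F n \<subseteq> carrier G" for n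
    using F by (auto simp: folner_sequence_def)
  fix a assume "mean_entropy < a"
  moreover have "?DD \<noteq> {}" by (auto intro!: exI[of _ "{\<one>}"])
  moreover have bdd: "bdd_below ((\<lambda>D. H D / real (card D)) ` ?DD)"
    using H_nonneg by (intro bdd_belowI[of _ 0]) auto
  ultimately obtain D where D: "finite D" "D \<noteq> {}" "D \<subseteq> carrier G" and a: "H D / real (card D) < a"
    unfolding mean_entropy_def by (subst (asm) cINF_less_iff) auto
  define M where "M = (\<lambda>d. inv d) ` D \<union> (\<lambda>(d, d'). inv d \<otimes> d') ` (D \<times> D)"
  have M: "finite M" "M \<subseteq> carrier G" using D by (auto simp: M_def)
  let ?u = "\<lambda>n. H D / real (card D) + real (card (F n - inner_points M (F n))) / real (card (F n)) * H {\<one>}"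
  have "?u \<longlonglongrightarrow> H D / real (card D) + 0 * H {\<one>}"
    by (intro tendsto_intros folner_inner_points F M)
  then have "\<forall>\<^sub>F n in sequentially. ?u n < a" using a by (intro order_tendstoD(2)) auto
  moreover have "H (F n) / real (card (F n)) \<le> ?u n" for n
  proof -
    have "0 < real (card (F n))" using F'[of n] by (simp add: card_gt_0_iff)
    then show ?thesis
      using H_tiling_bound[OF D(1,3,2) F'(1,3), of n] unfolding M_def[symmetric]
      by (simp add: field_simps)
  qed
  ultimately show "\<forall>\<^sub>F n in sequentially. H (F n) / real (card (F n)) < a"
    by (auto elim!: eventually_mono intro: le_less_trans)
qed

end

section \<open>Subshifts and cylinders\<close>

locale subshift_system = group G for G :: "('g, 'm) monoid_scheme" (structure) +
  fixes A :: "'a set" and X :: "('g \<Rightarrow> 'a) set"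
  assumes countable_carrier: "countable (carrier G)"
    and finite_alphabet: "finite A"
    and subshift: "subshift G A X"
begin

abbreviation "XT \<equiv> subshift_topology G A X"

definition cyl :: "'g set \<Rightarrow> ('g \<Rightarrow> 'a) \<Rightarrow> ('g \<Rightarrow> 'a) set" where
  "cyl W w = {x\<in>X. restrict x W = w}"

definition patterns :: "('g set \<times> ('g \<Rightarrow> 'a)) set" where
  "patterns = (SIGMA W:{W. finite W \<and> W \<subseteq> carrier G}. W \<rightarrow>\<^sub>E A)"

lemma topspace_XT: "topspace XT = X" and X_subset: "X \<subseteq> carrier G \<rightarrow>\<^sub>E A"
  using subshift closedin_subset[of "full_shift_topology G A" X]
  by (auto simp: subshift_def subshift_topology_def full_shift_topology_def)

lemma X_in: "x \<in> X \<Longrightarrow> h \<in> carrier G \<Longrightarrow> x h \<in> A"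
  using X_subset by auto

lemma X_ext: "x \<in> X \<Longrightarrow> x \<in> extensional (carrier G)"
  using X_subset by (auto simp: PiE_def)

lemma X_eqI: "x \<in> X \<Longrightarrow> y \<in> X \<Longrightarrow> (\<And>h. h \<in> carrier G \<Longrightarrow> x h = y h) \<Longrightarrow> x = y"
  by (rule extensionalityI[of x "carrier G" y]) (simp_all add: X_ext)

lemma shift_X: "g \<in> carrier G \<Longrightarrow> x \<in> X \<Longrightarrow> shift G g x \<in> X"
  using subshift by (auto simp: subshift_def)

lemma shift_apply [simp]: "h \<in> carrier G \<Longrightarrow> shift G g x h = x (g \<otimes> h)"
  by (simp add: shift_def)

lemma shift_shift: "g \<in> carrier G \<Longrightarrow> h \<in> carrier G \<Longrightarrow> shift G g (shift G h x) = shift G (h \<otimes> g) x"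
  by (auto simp: shift_def m_assoc)

lemma shift_one: "x \<in> extensional (carrier G) \<Longrightarrow> shift G \<one> x = x"
  by (rule extensionalityI[of _ "carrier G"]) (simp_all add: shift_def)

lemma countable_patterns: "countable patterns"
  unfolding patterns_def
proof (rule countable_SIGMA)
  show "countable {W. finite W \<and> W \<subseteq> carrier G}"
    using countable_Collect_finite_subset[OF countable_carrier] by (simp add: conj_commute)
  fix W :: "'g set" assume "W \<in> {W. finite W \<and> W \<subseteq> carrier G}"
  then show "countable (W \<rightarrow>\<^sub>E A)"
    by (intro countable_finite finite_PiE) (simp_all add: finite_alphabet)
qed

lemma restrict_pattern: "x \<in> X \<Longrightarrow> finite W \<Longrightarrow> W \<subseteq> carrier G \<Longrightarrow> (W, restrict x W) \<in> patterns"
  using X_in by (auto simp: patterns_def)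

lemma open_contains_box:
  assumes "openin (full_shift_topology G A) V" "x \<in> V"
  obtains P where "finite {i \<in> carrier G. P i \<noteq> A}" "x \<in> Pi\<^sub>E (carrier G) P" "Pi\<^sub>E (carrier G) P \<subseteq> V"
proof -
  have "\<exists>P. finite {i \<in> carrier G. P i \<noteq> topspace (discrete_topology A)} \<and>
      (\<forall>i\<in>carrier G. openin (discrete_topology A) (P i)) \<and> x \<in> Pi\<^sub>E (carrier G) P \<and> Pi\<^sub>E (carrier G) P \<subseteq> V"
    using assms(1) unfolding full_shift_topology_def openin_product_topology_alt using assms(2) by (rule bspec)
  then show thesis using that by auto
qed

text \<open>Closedness in the product topology, in the form that carries membership in
  \<open>X\<close> from finitely many resampled sites to infinitely many.\<close>

lemma closed_X:
  assumes y: "y \<in> carrier G \<rightarrow>\<^sub>E A"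
    and approx: "\<And>W. finite W \<Longrightarrow> W \<subseteq> carrier G \<Longrightarrow> \<exists>x\<in>X. restrict x W = restrict y W"
  shows "y \<in> X"
proof (rule ccontr)
  let ?T = "full_shift_topology G A"
  assume "y \<notin> X"
  have "openin ?T (topspace ?T - X)" using subshift by (auto simp: subshift_def)
  moreover have "y \<in> topspace ?T - X" using y \<open>y \<notin> X\<close> by (simp add: full_shift_topology_def)
  ultimately obtain U where U: "finite {i \<in> carrier G. U i \<noteq> A}" "y \<in> Pi\<^sub>E (carrier G) U"
    "Pi\<^sub>E (carrier G) U \<subseteq> topspace ?T - X"
    by (rule open_contains_box)
  let ?W = "{i \<in> carrier G. U i \<noteq> A}"
  obtain x where x: "x \<in> X" "restrict x ?W = restrict y ?W"
    using approx[of ?W] U(1) by auto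
  have "x \<in> Pi\<^sub>E (carrier G) U"
  proof (rule PiE_I)
    fix i assume i: "i \<in> carrier G"
    show "x i \<in> U i"
    proof (cases "U i = A")
      case False
      then have "x i = y i" using fun_cong[OF x(2), of i] i by simp
      then show ?thesis using U(2) i by auto
    qed (use x(1) i X_in in auto)
  next
    fix i assume "i \<notin> carrier G"
    then show "x i = undefined" using X_ext[OF x(1)] by (simp add: extensional_def)
  qed
  then show False using U(3) x(1) by auto
qed

lemma open_coordinate: "h \<in> carrier G \<Longrightarrow> openin XT {x\<in>X. x h \<in> B}"
proof -
  assume h: "h \<in> carrier G"
  have "continuous_map XT (discrete_topology A) (\<lambda>x. x h)"
    unfolding subshift_topology_def full_shift_topology_def
    by (intro continuous_map_from_subtopology continuous_map_product_projection h)
  then have "openin XT {x \<in> topspace XT. x h \<in> B \<inter> A}"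
    by (rule openin_continuous_map_preimage) simp
  also have "{x \<in> topspace XT. x h \<in> B \<inter> A} = {x\<in>X. x h \<in> B}"
    using X_in h by (auto simp: topspace_XT)
  finally show ?thesis .
qed

lemma restrict_eq_iff: "w \<in> extensional W \<Longrightarrow> restrict x W = w \<longleftrightarrow> (\<forall>h\<in>W. x h = w h)"
  unfolding restrict_def extensional_def fun_eq_iff by simp metis

lemma cyl_eq_Inter: "w \<in> extensional W \<Longrightarrow> cyl W w = X \<inter> (\<Inter>h\<in>W. {x\<in>X. x h = w h})"
  unfolding cyl_def by (auto simp: restrict_eq_iff)

lemma open_cyl:
  assumes "finite W" "W \<subseteq> carrier G" "w \<in> extensional W"
  shows "openin XT (cyl W w)"
proof -
  have "openin XT {x\<in>X. x h = w h}" if "h \<in> W" for h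
    using open_coordinate[of h "{w h}"] that assms by auto
  moreover have "openin XT X" using openin_topspace[of XT] by (simp add: topspace_XT)
  ultimately show ?thesis
    unfolding cyl_eq_Inter[OF assms(3)] using assms(1)
    by (cases "W = {}") (auto intro!: openin_Inter)
qed

lemma open_contains_cyl:
  assumes U: "openin XT U" and x: "x \<in> U"
  obtains W where "finite W" "W \<subseteq> carrier G" "cyl W (restrict x W) \<subseteq> U"
proof -
  obtain V where V: "openin (full_shift_topology G A) V" "U = V \<inter> X"
    using U by (auto simp: subshift_topology_def openin_subtopology)
  then obtain P where P: "finite {i \<in> carrier G. P i \<noteq> A}" "x \<in> Pi\<^sub>E (carrier G) P"
    "Pi\<^sub>E (carrier G) P \<subseteq> V"
    using open_contains_box[OF V(1), of x] x by blast
  let ?W = "{i \<in> carrier G. P i \<noteq> A}"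
  have "cyl ?W (restrict x ?W) \<subseteq> U"
  proof
    fix y assume "y \<in> cyl ?W (restrict x ?W)"
    then have y: "y \<in> X" "restrict y ?W = restrict x ?W" by (auto simp: cyl_def)
    have "y \<in> Pi\<^sub>E (carrier G) P"
    proof (rule PiE_I)
      fix i assume i: "i \<in> carrier G"
      show "y i \<in> P i"
      proof (cases "P i = A")
        case False
        then have "y i = x i" using fun_cong[OF y(2), of i] i by simp
        then show ?thesis using P(2) i by auto
      qed (use y(1) i X_in in auto)
    next
      fix i assume "i \<notin> carrier G"
      then show "y i = undefined" using X_ext[OF y(1)] by (simp add: extensional_def)
    qed
    then show "y \<in> U" using P(3) V(2) y(1) by auto
  qed
  then show thesis using that[of ?W] P(1) by auto
qed

lemma compact_XT: "compact_space XT"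
proof -
  have "compact_space (full_shift_topology G A)"
    unfolding full_shift_topology_def compact_space_product_topology
    using finite_alphabet by (simp add: compact_space_discrete_topology)
  then show ?thesis
    unfolding subshift_topology_def using subshift
    by (intro closedin_compact_space compact_space_subtopology) (auto simp: subshift_def)
qed

text \<open>A Lebesgue number lemma: compactness leaves finitely many of the cylinders chosen around
  the points, and the union of their windows is fine enough everywhere.\<close>

lemma uniform_cylinders:
  assumes cover: "\<And>x. x \<in> X \<Longrightarrow> \<exists>U. openin XT U \<and> x \<in> U \<and> P U"
  obtains W where "finite W" "W \<subseteq> carrier G" "\<And>x. x \<in> X \<Longrightarrow> \<exists>U. P U \<and> cyl W (restrict x W) \<subseteq> U"
proof -
  have "\<exists>W. finite W \<and> W \<subseteq> carrier G \<and> (\<exists>U. P U \<and> cyl W (restrict x W) \<subseteq> U)" if "x \<in> X" for x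
    using cover[OF that] by (meson open_contains_cyl)
  then obtain K where K: "\<And>x. x \<in> X \<Longrightarrow> finite (K x) \<and> K x \<subseteq> carrier G \<and> (\<exists>U. P U \<and> cyl (K x) (restrict x (K x)) \<subseteq> U)"
    by metis
  let ?C = "\<lambda>x. cyl (K x) (restrict x (K x))"
  have "\<forall>U\<in>?C ` X. openin XT U" using K by (auto intro!: open_cyl)
  moreover have "topspace XT \<subseteq> \<Union> (?C ` X)" by (auto simp: cyl_def topspace_XT)
  ultimately obtain F where "finite F" "F \<subseteq> ?C ` X" "topspace XT \<subseteq> \<Union> F"
    using compact_XT unfolding compact_space_alt by meson
  then obtain Y where Y: "finite Y" "Y \<subseteq> X" "X \<subseteq> \<Union> (?C ` Y)"
    using finite_subset_image[of F ?C X] topspace_XT by auto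
  show thesis
  proof (rule that[of "\<Union> (K ` Y)"])
    have KY: "finite (K y)" "K y \<subseteq> carrier G" if "y \<in> Y" for y
      using K[of y] Y that by blast+
    then show "finite (\<Union> (K ` Y))" "\<Union> (K ` Y) \<subseteq> carrier G"
      using Y(1) by (simp_all add: UN_least)
    fix x assume "x \<in> X"
    then obtain y where y: "y \<in> Y" "x \<in> ?C y" using Y(3) by blast
    have "cyl (\<Union> (K ` Y)) (restrict x (\<Union> (K ` Y))) \<subseteq> ?C y"
    proof
      fix z assume "z \<in> cyl (\<Union> (K ` Y)) (restrict x (\<Union> (K ` Y)))"
      then have z: "z \<in> X" "restrict z (\<Union> (K ` Y)) = restrict x (\<Union> (K ` Y))"
        by (simp_all add: cyl_def)
      have "z h = x h" if "h \<in> K y" for h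
        using fun_cong[OF z(2), of h] that y(1) by (auto simp: restrict_def split: if_splits)
      then have "restrict z (K y) = restrict x (K y)" by (auto intro!: restrict_ext)
      then show "z \<in> ?C y" using z y by (auto simp: cyl_def)
    qed
    then show "\<exists>U. P U \<and> cyl (\<Union> (K ` Y)) (restrict x (\<Union> (K ` Y))) \<subseteq> U"
      using K[of y] y Y by blast
  qed
qed

text \<open>There are only countably many patterns, so every open set is a countable union of
  cylinders.\<close>

lemma sets_borel_XT: "sets (borel_of XT) = sigma_sets X ((\<lambda>(W, w). cyl W w) ` patterns)"
  and space_borel_XT: "space (borel_of XT) = X"
proof -
  have sub: "{U. openin XT U} \<subseteq> Pow X" using openin_subset[of XT] by (auto simp: topspace_XT)
  then show "space (borel_of XT) = X"
    unfolding borel_of_def by (simp add: topspace_XT)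
  have "sets (borel_of XT) = sigma_sets X {U. openin XT U}"
    unfolding borel_of_def topspace_XT using sub by (rule sets_measure_of)
  also have "\<dots> = sigma_sets X ((\<lambda>(W, w). cyl W w) ` patterns)"
  proof (rule sigma_sets_eqI)
    fix U assume "U \<in> {U. openin XT U}"
    then have U: "openin XT U" by simp
    let ?P = "{p\<in>patterns. (\<lambda>(W, w). cyl W w) p \<subseteq> U}"
    have "U \<subseteq> (\<Union>p\<in>?P. (\<lambda>(W, w). cyl W w) p)"
    proof
      fix x assume x: "x \<in> U"
      then have xX: "x \<in> X" using sub U by auto
      obtain W where W: "finite W" "W \<subseteq> carrier G" "cyl W (restrict x W) \<subseteq> U"
        by (rule open_contains_cyl[OF U x])
      then have "(W, restrict x W) \<in> ?P" using restrict_pattern[OF xX] by auto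
      moreover have "x \<in> cyl W (restrict x W)" using xX by (simp add: cyl_def)
      ultimately show "x \<in> (\<Union>p\<in>?P. (\<lambda>(W, w). cyl W w) p)" by force
    qed
    then have eq: "U = (\<Union>p\<in>?P. (\<lambda>(W, w). cyl W w) p)" by auto
    show "U \<in> sigma_sets X ((\<lambda>(W, w). cyl W w) ` patterns)"
      by (subst eq, rule sigma_sets_UNION) (auto intro: countable_subset[OF _ countable_patterns])
  next
    fix C assume "C \<in> (\<lambda>(W, w). cyl W w) ` patterns"
    then show "C \<in> sigma_sets X {U. openin XT U}"
      by (auto simp: patterns_def PiE_def intro!: sigma_sets.Basic open_cyl)
  qed
  finally show "sets (borel_of XT) = sigma_sets X ((\<lambda>(W, w). cyl W w) ` patterns)" .
qed

lemma measurable_into_X: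
  assumes sets: "sets M = sets (borel_of XT)"
    and X: "\<And>\<omega>. \<omega> \<in> space N \<Longrightarrow> f \<omega> \<in> X"
    and coord: "\<And>h a. h \<in> carrier G \<Longrightarrow> a \<in> A \<Longrightarrow> {\<omega>\<in>space N. f \<omega> h = a} \<in> sets N"
  shows "f \<in> measurable N M"
proof -
  have sp: "space M = X" using sets_eq_imp_space_eq[OF sets] space_borel_XT by simp
  show ?thesis
  proof (rule measurable_sigma_sets)
    show "sets M = sigma_sets X ((\<lambda>(W, w). cyl W w) ` patterns)" using sets sets_borel_XT by simp
    show "(\<lambda>(W, w). cyl W w) ` patterns \<subseteq> Pow X" by (auto simp: cyl_def)
    show "f \<in> space N \<rightarrow> X" using X by auto
    fix C assume "C \<in> (\<lambda>(W, w). cyl W w) ` patterns"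
    then obtain W w where C: "C = cyl W w" and W: "finite W" "W \<subseteq> carrier G" and w: "w \<in> W \<rightarrow>\<^sub>E A"
      by (auto simp: patterns_def)
    have "f -` C \<inter> space N = {\<omega>\<in>space N. \<forall>h\<in>W. f \<omega> h = w h}"
      using X w by (auto simp: C cyl_def fun_eq_iff PiE_def extensional_def restrict_def)
    also have "\<dots> \<in> sets N"
      using W w coord by (intro sets.sets_Collect_finite_All) (auto simp: PiE_def Pi_iff subset_iff)
    finally show "f -` C \<inter> space N \<in> sets N" .
  qed
qed

end

locale subshift_measure = subshift_system G A X + prob_space \<mu>
  for G :: "('g, 'm) monoid_scheme" (structure) and A :: "'a set" and X :: "('g \<Rightarrow> 'a) set"
    and \<mu> :: "('g \<Rightarrow> 'a) measure" +
  assumes sets_mu: "sets \<mu> = sets (borel_of (subshift_topology G A X))"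
    and invariant: "\<And>g. g \<in> carrier G \<Longrightarrow> distr \<mu> \<mu> (shift G g) = \<mu>"
begin

lemma space_mu: "space \<mu> = X"
  using sets_eq_imp_space_eq[OF sets_mu] space_borel_XT by simp

lemma cyl_sets: "finite W \<Longrightarrow> W \<subseteq> carrier G \<Longrightarrow> cyl W w \<in> sets \<mu>"
proof (cases "w \<in> W \<rightarrow>\<^sub>E A")
  case True
  moreover assume "finite W" "W \<subseteq> carrier G"
  ultimately show ?thesis unfolding sets_mu sets_borel_XT
    by (intro sigma_sets.Basic) (auto simp: patterns_def)
next
  assume "finite W" "W \<subseteq> carrier G"
  case False
  have "cyl W w = {}"
  proof (rule ccontr)
    assume "cyl W w \<noteq> {}"
    then obtain x where "x \<in> X" "restrict x W = w" by (auto simp: cyl_def)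
    then have "w \<in> W \<rightarrow>\<^sub>E A" using X_in \<open>W \<subseteq> carrier G\<close> by auto
    then show False using False by simp
  qed
  then show ?thesis by simp
qed

lemma coordinate_sets: "h \<in> carrier G \<Longrightarrow> {x\<in>X. x h = a} \<in> sets \<mu>"
proof -
  assume h: "h \<in> carrier G"
  have "{x\<in>X. x h = a} = cyl {h} (restrict (\<lambda>_. a) {h})"
    by (auto simp: cyl_def restrict_def fun_eq_iff)
  then show ?thesis using cyl_sets[of "{h}"] h by simp
qed

lemma shift_measurable: "g \<in> carrier G \<Longrightarrow> shift G g \<in> measurable \<mu> \<mu>"
proof (rule measurable_into_X[OF sets_mu])
  assume g: "g \<in> carrier G"
  fix h a assume h: "h \<in> carrier G"
  have "{x \<in> space \<mu>. shift G g x h = a} = {x\<in>X. x (g \<otimes> h) = a}"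
    using h by (simp add: space_mu)
  then show "{x \<in> space \<mu>. shift G g x h = a} \<in> sets \<mu>"
    using coordinate_sets[of "g \<otimes> h" a] g h by simp
qed (simp add: shift_X space_mu)

lemma measure_shift: "g \<in> carrier G \<Longrightarrow> B \<in> sets \<mu> \<Longrightarrow> measure \<mu> {x\<in>X. shift G g x \<in> B} = measure \<mu> B"
proof -
  assume g: "g \<in> carrier G" and B: "B \<in> sets \<mu>"
  have "measure \<mu> B = measure (distr \<mu> \<mu> (shift G g)) B" using invariant[OF g] by simp
  also have "\<dots> = measure \<mu> (shift G g -` B \<inter> space \<mu>)"
    by (rule measure_distr[OF shift_measurable[OF g] B])
  also have "shift G g -` B \<inter> space \<mu> = {x\<in>X. shift G g x \<in> B}" by (auto simp: space_mu)
  finally show ?thesis by simp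
qed

end

section \<open>Entropy of the action and entropy of windows\<close>

lemma restrict_name_eq_iff: "(\<lambda>g\<in>F. u g) = (\<lambda>g\<in>F. v g) \<longleftrightarrow> (\<forall>g\<in>F. u g = v g)"
  unfolding restrict_def fun_eq_iff by auto

lemma simple_function_restrict:
  assumes "finite F" "\<And>g. g \<in> F \<Longrightarrow> simple_function M (V g)"
  shows "simple_function M (\<lambda>x. \<lambda>g\<in>F. V g x)"
  using assms
proof (induction F rule: finite_induct)
  case empty
  then show ?case by (simp add: restrict_def)
next
  case (insert h F)
  have "simple_function M (\<lambda>x. (V h x, \<lambda>g\<in>F. V g x))"
    by (rule simple_function_Pair; rule insert) (simp_all add: insert)
  then have "simple_function M ((\<lambda>p. (snd p)(h := fst p)) \<circ> (\<lambda>x. (V h x, \<lambda>g\<in>F. V g x)))"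
    by (rule simple_function_compose)
  also have "(\<lambda>p. (snd p)(h := fst p)) \<circ> (\<lambda>x. (V h x, \<lambda>g\<in>F. V g x)) = (\<lambda>x. \<lambda>g\<in>insert h F. V g x)"
    using insert.hyps by (auto simp: fun_eq_iff)
  finally show ?case .
qed

lemma partition_entropy_fibers:
  "partition_entropy M ((\<lambda>y. V -` {y} \<inter> space M) ` V ` space M) = rv_entropy M V"
proof -
  have "inj_on (\<lambda>y. V -` {y} \<inter> space M) (V ` space M)"
    by (rule inj_onI) blast
  then show ?thesis unfolding partition_entropy_def rv_entropy_def by (subst sum.reindex) simp_all
qed

section \<open>Names of orbits and the limit in \<open>partition_ks_entropy\<close>\<close>

context subshift_measure
begin

definition label_entropy :: "(('g \<Rightarrow> 'a) \<Rightarrow> 'b) \<Rightarrow> 'g set \<Rightarrow> real" where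
  "label_entropy L F = rv_entropy \<mu> (\<lambda>x. \<lambda>g\<in>F. L (shift G g x))"

lemma simple_label_shift:
  "simple_function \<mu> L \<Longrightarrow> g \<in> carrier G \<Longrightarrow> simple_function \<mu> (\<lambda>x. L (shift G g x))"
  using simple_function_comp[OF shift_measurable, of g L] by (simp add: comp_def)

lemma simple_label_name:
  "simple_function \<mu> L \<Longrightarrow> finite F \<Longrightarrow> F \<subseteq> carrier G \<Longrightarrow> simple_function \<mu> (\<lambda>x. \<lambda>g\<in>F. L (shift G g x))"
  by (intro simple_function_restrict simple_label_shift) auto

lemma rv_entropy_shift:
  "simple_function \<mu> V \<Longrightarrow> g \<in> carrier G \<Longrightarrow> rv_entropy \<mu> (\<lambda>x. V (shift G g x)) = rv_entropy \<mu> V"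
  using rv_entropy_distr[OF shift_measurable, of g V] by (simp add: invariant)

lemma invariant_submodular_label:
  assumes L: "simple_function \<mu> L"
  shows "invariant_submodular G (label_entropy L)"
proof unfold_locales
  note s = simple_label_name[OF L]
  show "label_entropy L {} = 0"
    unfolding label_entropy_def by (rule rv_entropy_const[of _ "\<lambda>_. undefined"]) (simp add: restrict_def)
  show "label_entropy L S \<le> label_entropy L T" if "S \<subseteq> T" "finite T" "T \<subseteq> carrier G" for S T
    unfolding label_entropy_def using that
    by (intro rv_entropy_factor_le s) (auto simp: restrict_name_eq_iff)
  show "label_entropy L (S \<union> T) + label_entropy L (S \<inter> T) \<le> label_entropy L S + label_entropy L T"
    if ST: "finite S" "finite T" "S \<subseteq> carrier G" "T \<subseteq> carrier G" for S T
  proof -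
    let ?V = "\<lambda>F x. \<lambda>g\<in>F. L (shift G g x)"
    have sf: "simple_function \<mu> (?V S)" "simple_function \<mu> (?V T)" "simple_function \<mu> (?V (S \<inter> T))"
      "simple_function \<mu> (?V (S \<union> T))"
      using ST by (auto intro!: s)
    \<comment> \<open>The name on \<open>S \<union> T\<close> is recoded as the triple of the names
      on \<open>S\<close>, \<open>T\<close> and \<open>S \<inter> T\<close>, with the last as the
      condition in submodularity.\<close>
    have "rv_entropy \<mu> (?V (S \<union> T)) = rv_entropy \<mu> (\<lambda>x. (?V S x, ?V T x, ?V (S \<inter> T) x))"
      by (rule rv_entropy_eqI; (intro simple_function_Pair sf)?) (auto simp: restrict_name_eq_iff)
    moreover have "rv_entropy \<mu> (?V S) = rv_entropy \<mu> (\<lambda>x. (?V S x, ?V (S \<inter> T) x))"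
      by (rule rv_entropy_eqI; (intro simple_function_Pair sf)?) (auto simp: restrict_name_eq_iff)
    moreover have "rv_entropy \<mu> (?V T) = rv_entropy \<mu> (\<lambda>x. (?V T x, ?V (S \<inter> T) x))"
      by (rule rv_entropy_eqI; (intro simple_function_Pair sf)?) (auto simp: restrict_name_eq_iff)
    ultimately show ?thesis
      unfolding label_entropy_def using rv_entropy_submodular[OF sf(1-3)] by simp
  qed
  show "label_entropy L ((\<lambda>h. g \<otimes> h) ` S) = label_entropy L S"
    if g: "g \<in> carrier G" and S: "finite S" "S \<subseteq> carrier G" for g S
  proof -
    let ?V = "\<lambda>F x. \<lambda>g\<in>F. L (shift G g x)"
    have sub: "(\<lambda>h. g \<otimes> h) ` S \<subseteq> carrier G" using g S by auto
    have eq: "L (shift G h (shift G g x)) = L (shift G (g \<otimes> h) x)" if "h \<in> S" for h x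
      using g S that by (auto simp: shift_shift)
    \<comment> \<open>Because the shifts act on the right, the name along \<open>S\<close> of the
      shifted point is the name along \<open>g S\<close> of the point itself.\<close>
    have "rv_entropy \<mu> (?V S) = rv_entropy \<mu> (\<lambda>x. ?V S (shift G g x))"
      using rv_entropy_shift[OF s[OF S] g] by simp
    also have "\<dots> = rv_entropy \<mu> (?V ((\<lambda>h. g \<otimes> h) ` S))"
    proof (rule rv_entropy_eqI)
      show "simple_function \<mu> (?V ((\<lambda>h. g \<otimes> h) ` S))" using S sub by (intro s) auto
      show "simple_function \<mu> (\<lambda>x. ?V S (shift G g x))" by (rule simple_label_shift[OF s[OF S] g])
    qed (auto simp: restrict_name_eq_iff eq)
    finally show ?thesis by (simp add: label_entropy_def)
  qed
qed

definition label_mean :: "(('g \<Rightarrow> 'a) \<Rightarrow> 'b) \<Rightarrow> real" where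
  "label_mean L = invariant_submodular.mean_entropy G (label_entropy L)"

lemma label_entropy_limit:
  "simple_function \<mu> L \<Longrightarrow> folner_sequence G F \<Longrightarrow> (\<lambda>n. label_entropy L (F n) / real (card (F n))) \<longlonglongrightarrow> label_mean L"
  unfolding label_mean_def by (rule invariant_submodular.folner_limit[OF invariant_submodular_label])

definition cell_of :: "('g \<Rightarrow> 'a) set set \<Rightarrow> ('g \<Rightarrow> 'a) \<Rightarrow> ('g \<Rightarrow> 'a) set" where
  "cell_of P x = (THE C. C \<in> P \<and> x \<in> C)"

lemma cell_of_eq:
  assumes P: "finite_measurable_partition \<mu> P" and C: "C \<in> P" "x \<in> C"
  shows "cell_of P x = C"
  unfolding cell_of_def
proof (rule the_equality)
  fix D assume "D \<in> P \<and> x \<in> D"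
  then show "D = C" using P C unfolding finite_measurable_partition_def partition_on_def disjoint_def by blast
qed (use C in auto)

lemma cell_of_in:
  assumes P: "finite_measurable_partition \<mu> P" and x: "x \<in> X"
  shows "cell_of P x \<in> P" "x \<in> cell_of P x"
proof -
  obtain C where "C \<in> P" "x \<in> C"
    using P x unfolding finite_measurable_partition_def partition_on_def space_mu by blast
  then show "cell_of P x \<in> P" "x \<in> cell_of P x" using cell_of_eq[OF P] by auto
qed

lemma cell_of_iff:
  "finite_measurable_partition \<mu> P \<Longrightarrow> C \<in> P \<Longrightarrow> x \<in> X \<Longrightarrow> cell_of P x = C \<longleftrightarrow> x \<in> C"
  using cell_of_eq cell_of_in by blast

lemma simple_cell_of:
  assumes P: "finite_measurable_partition \<mu> P"
  shows "simple_function \<mu> (cell_of P)"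
  unfolding simple_function_def
proof (intro conjI ballI)
  have sub: "cell_of P ` space \<mu> \<subseteq> P" using cell_of_in[OF P] by (auto simp: space_mu)
  then show "finite (cell_of P ` space \<mu>)"
    using P finite_subset by (auto simp: finite_measurable_partition_def)
  fix C assume "C \<in> cell_of P ` space \<mu>"
  then have C: "C \<in> P" using sub by auto
  then have "C \<subseteq> X" using P by (auto simp: finite_measurable_partition_def partition_on_def space_mu)
  then have "cell_of P -` {C} \<inter> space \<mu> = C"
    using cell_of_iff[OF P C] by (auto simp: space_mu)
  then show "cell_of P -` {C} \<inter> space \<mu> \<in> sets \<mu>"
    using C P by (auto simp: finite_measurable_partition_def)
qed

text \<open>A choice of one block from every shifted partition has nonempty intersection exactly if
  some point has the corresponding name, and the intersection is then the fibre of that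
  name.\<close>

lemma common_refinement_shift_preimage:
  assumes P: "finite_measurable_partition \<mu> P" and F: "F \<noteq> {}" "F \<subseteq> carrier G"
  defines "V \<equiv> (\<lambda>x. \<lambda>g\<in>F. cell_of P (shift G g x))"
  shows "common_refinement ((\<lambda>g. shift_preimage G \<mu> g P) ` F) = (\<lambda>y. V -` {y} \<inter> space \<mu>) ` V ` space \<mu>"
    (is "common_refinement ?PP = _")
proof -
  have fiber: "V -` {V x} \<inter> space \<mu> = \<Inter> (f ` ?PP)"
    if x: "x \<in> X" and f: "\<And>Q. Q \<in> ?PP \<Longrightarrow> f Q \<in> Q \<and> x \<in> f Q" for x f
  proof -
    have fg: "f (shift_preimage G \<mu> g P) = {y\<in>X. cell_of P (shift G g y) = cell_of P (shift G g x)}" if g: "g \<in> F" for g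
    proof -
      obtain C where C: "C \<in> P" "f (shift_preimage G \<mu> g P) = shift G g -` C \<inter> X"
        using f[of "shift_preimage G \<mu> g P"] g by (auto simp: shift_preimage_def space_mu)
      have "shift G g x \<in> C" using f[of "shift_preimage G \<mu> g P"] g C(2) by auto
      then have "cell_of P (shift G g x) = C" by (rule cell_of_eq[OF P C(1)])
      moreover have "g \<in> carrier G" using g F by auto
      ultimately show ?thesis
        unfolding C(2) using cell_of_iff[OF P C(1)] shift_X by auto
    qed
    have "\<Inter> (f ` ?PP) = (\<Inter>g\<in>F. {y\<in>X. cell_of P (shift G g y) = cell_of P (shift G g x)})"
      using fg by auto
    also have "\<dots> = V -` {V x} \<inter> space \<mu>"
      using F(1) by (auto simp: V_def restrict_name_eq_iff space_mu)
    finally show ?thesis by simp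
  qed
  show ?thesis
  proof (intro equalityI subsetI)
    fix R assume "R \<in> common_refinement ?PP"
    then obtain f where f: "f \<in> (\<Pi> Q\<in>?PP. Q)" "R = \<Inter> (f ` ?PP)" "R \<noteq> {}"
      by (auto simp: common_refinement)
    then obtain x where x: "x \<in> R" by auto
    then have fx: "f Q \<in> Q \<and> x \<in> f Q" if "Q \<in> ?PP" for Q using f that by auto
    \<comment> \<open>With \<open>F\<close> nonempty, membership in a single block already places
      \<open>x\<close> in \<open>X\<close>.\<close>
    obtain g where "g \<in> F" using F by auto
    then have "x \<in> X" using fx[of "shift_preimage G \<mu> g P"] by (auto simp: shift_preimage_def space_mu)
    then show "R \<in> (\<lambda>y. V -` {y} \<inter> space \<mu>) ` V ` space \<mu>"
      using fiber[OF _ fx] f(2) by (auto simp: space_mu)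
  next
    fix R assume "R \<in> (\<lambda>y. V -` {y} \<inter> space \<mu>) ` V ` space \<mu>"
    then obtain x where x: "x \<in> X" "R = V -` {V x} \<inter> space \<mu>" by (auto simp: space_mu)
    have "\<exists>D\<in>Q. x \<in> D" if Q: "Q \<in> ?PP" for Q
    proof -
      obtain g where g: "g \<in> F" "Q = shift_preimage G \<mu> g P" using Q by auto
      then have "shift G g x \<in> X" using x F shift_X by auto
      then show ?thesis
        unfolding g(2) shift_preimage_def using cell_of_in[OF P, of "shift G g x"] x by (auto simp: space_mu)
    qed
    then obtain f where f: "\<And>Q. Q \<in> ?PP \<Longrightarrow> f Q \<in> Q \<and> x \<in> f Q" by metis
    have "R = \<Inter> (f ` ?PP)" using fiber[OF x(1) f] x(2) by simp
    moreover have "R \<noteq> {}" using x by (auto simp: space_mu)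
    moreover have "f \<in> (\<Pi> Q\<in>?PP. Q)" using f by auto
    ultimately show "R \<in> common_refinement ?PP" by (auto simp: common_refinement)
  qed
qed

text \<open>Resolves the definite description: \<open>folner_limit\<close> gives one value for all
  Foelner sequences, and amenability supplies a sequence along which limits are unique.\<close>

lemma partition_ks_entropy_eq:
  assumes am: "amenable G" and P: "finite_measurable_partition \<mu> P"
  shows "partition_ks_entropy G \<mu> P = label_mean (cell_of P)"
proof -
  have eq: "partition_entropy \<mu> (common_refinement ((\<lambda>g. shift_preimage G \<mu> g P) ` F n)) = label_entropy (cell_of P) (F n)"
    if F: "folner_sequence G F" for F n
  proof -
    have F': "F n \<noteq> {}" "F n \<subseteq> carrier G" using F by (auto simp: folner_sequence_def)
    show ?thesis
      unfolding common_refinement_shift_preimage[OF P F'] partition_entropy_fibers label_entropy_def ..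
  qed
  obtain F0 where F0: "folner_sequence G F0" using am by (auto simp: amenable_def)
  show ?thesis
    unfolding partition_ks_entropy_def
  proof (rule the_equality)
    show "\<forall>F. folner_sequence G F \<longrightarrow> (\<lambda>n. partition_entropy \<mu> (common_refinement ((\<lambda>g. shift_preimage G \<mu> g P) ` F n))
               / real (card (F n))) \<longlonglongrightarrow> label_mean (cell_of P)"
      using label_entropy_limit[OF simple_cell_of[OF P]] by (auto simp: eq)
    fix h assume "\<forall>F. folner_sequence G F \<longrightarrow> (\<lambda>n. partition_entropy \<mu> (common_refinement ((\<lambda>g. shift_preimage G \<mu> g P) ` F n))
               / real (card (F n))) \<longlonglongrightarrow> h"
    then have "(\<lambda>n. label_entropy (cell_of P) (F0 n) / real (card (F0 n))) \<longlonglongrightarrow> h"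
      using F0 by (auto simp: eq)
    then show "h = label_mean (cell_of P)"
      using label_entropy_limit[OF simple_cell_of[OF P] F0] by (rule LIMSEQ_unique)
  qed
qed

text \<open>The sets that can be approximated by window events contain the cylinders and are closed
  under complements and countable unions.\<close>

lemma cylinder_approximation:
  assumes "B \<in> sets \<mu>" "\<epsilon> > 0"
  shows "\<exists>W S. finite W \<and> W \<subseteq> carrier G \<and> measure \<mu> (sym_diff B {x\<in>X. restrict x W \<in> S}) < \<epsilon>"
proof -
  have cylS: "{x\<in>X. restrict x W \<in> S} \<in> sets \<mu>" if W: "finite W" "W \<subseteq> carrier G" for W S
  proof -
    have fin: "finite (W \<rightarrow>\<^sub>E A)" using W finite_alphabet by (intro finite_PiE) auto
    have "restrict x W \<in> W \<rightarrow>\<^sub>E A" if "x \<in> X" for x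
      using restrict_pattern[OF that W] by (simp add: patterns_def)
    then have "{x\<in>X. restrict x W \<in> S} = (\<Union>w\<in>S \<inter> (W \<rightarrow>\<^sub>E A). cyl W w)"
      by (auto simp: cyl_def)
    also have "\<dots> \<in> sets \<mu>" using fin cyl_sets[OF W] by (intro sets.finite_UN) auto
    finally show ?thesis .
  qed
  have "B \<in> sigma_sets X ((\<lambda>(W, w). cyl W w) ` patterns)"
    using assms(1) sets_mu sets_borel_XT by simp
  then show ?thesis using assms(2)
  proof (induction arbitrary: \<epsilon> rule: sigma_sets.induct)
    case (Basic C)
    then obtain W w where C: "C = cyl W w" "finite W" "W \<subseteq> carrier G" by (auto simp: patterns_def)
    have "sym_diff C {x\<in>X. restrict x W \<in> {w}} = {}" by (auto simp: C cyl_def)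
    then have "measure \<mu> (sym_diff C {x\<in>X. restrict x W \<in> {w}}) < \<epsilon>"
      using Basic by (simp only: measure_empty)
    then show ?case using C by blast
  next
    case Empty
    have "sym_diff {} {x\<in>X. restrict x {} \<in> {}} = ({}::('g \<Rightarrow> 'a) set)" by auto
    then have "measure \<mu> (sym_diff {} {x\<in>X. restrict x {} \<in> {}}) < \<epsilon>"
      using Empty by (simp only: measure_empty)
    then show ?case by blast
  next
    case (Compl B)
    obtain W S where W: "finite W" "W \<subseteq> carrier G" "measure \<mu> (sym_diff B {x\<in>X. restrict x W \<in> S}) < \<epsilon>"
      using Compl.IH[OF Compl.prems] by blast
    have "B \<subseteq> X" using Compl(1) by (rule sigma_sets_into_sp[rotated]) (auto simp: cyl_def)
    then have "sym_diff (X - B) {x\<in>X. restrict x W \<in> - S} = sym_diff B {x\<in>X. restrict x W \<in> S}" by auto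
    then have "measure \<mu> (sym_diff (X - B) {x\<in>X. restrict x W \<in> - S}) < \<epsilon>"
      using W by (simp only:)
    then show ?case using W by blast
  next
    case (Union B)
    have B: "B i \<in> sets \<mu>" for i using Union(1) sets_mu sets_borel_XT by simp
    have BX: "B i \<subseteq> X" for i using sets.sets_into_space[OF B, of i] by (simp add: space_mu)
    have "(\<lambda>n. measure \<mu> (\<Union>i<n. B i)) \<longlonglongrightarrow> measure \<mu> (\<Union>n. \<Union>i<n. B i)"
      using B by (intro finite_Lim_measure_incseq) (force simp: incseq_def)+
    moreover have "(\<Union>n. \<Union>i<n. B i) = \<Union> (range B)" by (auto intro: lessI)
    ultimately have "(\<lambda>n. measure \<mu> (\<Union>i<n. B i)) \<longlonglongrightarrow> measure \<mu> (\<Union> (range B))" by simp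
    then have "\<forall>\<^sub>F n in sequentially. measure \<mu> (\<Union> (range B)) - \<epsilon> / 2 < measure \<mu> (\<Union>i<n. B i)"
      using Union.prems by (intro order_tendstoD(1)) auto
    then obtain n where n: "measure \<mu> (\<Union> (range B)) - \<epsilon> / 2 < measure \<mu> (\<Union>i<n. B i)"
      using eventually_happens'[OF sequentially_bot] by blast
    \<comment> \<open>Cutting the union at \<open>n\<close> costs less than \<epsilon>/2. With this
      \<delta> the \<open>n\<close> approximation errors add up to at most \<epsilon>/2; the summand
      1 covers \<open>n = 0\<close>.\<close>
    define \<delta> where "\<delta> = \<epsilon> / (2 * (real n + 1))"
    have "\<delta> > 0" using Union.prems by (simp add: \<delta>_def)
    then have "\<forall>i. \<exists>W S. finite W \<and> W \<subseteq> carrier G \<and> measure \<mu> (sym_diff (B i) {x\<in>X. restrict x W \<in> S}) < \<delta>"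
      using Union.IH by blast
    from choice[OF this] obtain W where "\<forall>i. \<exists>S. finite (W i) \<and> W i \<subseteq> carrier G \<and>
      measure \<mu> (sym_diff (B i) {x\<in>X. restrict x (W i) \<in> S}) < \<delta>" ..
    from choice[OF this] obtain S where "\<forall>i. finite (W i) \<and> W i \<subseteq> carrier G \<and>
      measure \<mu> (sym_diff (B i) {x\<in>X. restrict x (W i) \<in> S i}) < \<delta>" ..
    then have W: "\<And>i. finite (W i)" "\<And>i. W i \<subseteq> carrier G"
      and WS: "\<And>i. measure \<mu> (sym_diff (B i) {x\<in>X. restrict x (W i) \<in> S i}) < \<delta>" by blast+
    let ?W = "\<Union>i<n. W i" and ?C = "\<lambda>i. {x\<in>X. restrict x (W i) \<in> S i}"
    define T where "T = {w. \<exists>i<n. restrict w (W i) \<in> S i}"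
    have T: "{x\<in>X. restrict x ?W \<in> T} = (\<Union>i<n. ?C i)"
    proof -
      have "restrict (restrict x ?W) (W i) = restrict x (W i)" if "i < n" for x :: "'g \<Rightarrow> 'a" and i
        using that by (auto simp: restrict_def fun_eq_iff)
      then show ?thesis by (auto simp: T_def)
    qed
    have "measure \<mu> (sym_diff (\<Union> (range B)) {x\<in>X. restrict x ?W \<in> T})
      \<le> measure \<mu> ((\<Union> (range B) - (\<Union>i<n. B i)) \<union> (\<Union>i<n. sym_diff (B i) (?C i)))"
      unfolding T using B cylS[OF W] by (intro finite_measure_mono) auto
    also have "\<dots> \<le> measure \<mu> (\<Union> (range B) - (\<Union>i<n. B i)) + measure \<mu> (\<Union>i<n. sym_diff (B i) (?C i))"
      using B cylS[OF W] by (intro measure_Un_le) auto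
    also have "measure \<mu> (\<Union>i<n. sym_diff (B i) (?C i)) \<le> (\<Sum>i<n. measure \<mu> (sym_diff (B i) (?C i)))"
      using B cylS[OF W] by (intro finite_measure_subadditive_finite) auto
    also have "\<dots> \<le> (\<Sum>i<n. \<delta>)"
      using WS by (intro sum_mono) (auto intro: less_imp_le)
    also have "\<dots> \<le> \<epsilon> / 2" using Union.prems by (simp add: \<delta>_def field_simps)
    also have "measure \<mu> (\<Union> (range B) - (\<Union>i<n. B i)) = measure \<mu> (\<Union> (range B)) - measure \<mu> (\<Union>i<n. B i)"
      using B by (intro finite_measure_Diff) auto
    finally have "measure \<mu> (sym_diff (\<Union> (range B)) {x\<in>X. restrict x ?W \<in> T}) < \<epsilon>"
      using n by linarith
    moreover have "finite ?W" "?W \<subseteq> carrier G" using W by auto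
    ultimately show ?case by blast
  qed
qed

end

context prob_space
begin

lemma rv_entropy_sum_superset:
  assumes "V ` space M \<subseteq> S" "finite S"
  shows "rv_entropy M V = - (\<Sum>y\<in>S. measure M (V -` {y} \<inter> space M) * ln (measure M (V -` {y} \<inter> space M)))"
proof -
  have "V -` {y} \<inter> space M = {}" if "y \<notin> V ` space M" for y using that by auto
  then show ?thesis
    unfolding rv_entropy_def using assms by (subst sum.mono_neutral_left[of S "V ` space M"]) auto
qed

text \<open>Crude, but it vanishes with the probability, which is all that is required of it. The
  square root comes from \<open>ln u \<le> u - 1\<close> at \<open>u = 1 / sqrt p\<close>.\<close>

lemma rv_entropy_event:
  assumes D: "D \<in> events"
  shows "rv_entropy M (\<lambda>x. x \<in> D) \<le> 2 * sqrt (prob D) + prob D"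
proof -
  let ?p = "prob D"
  have p: "0 \<le> ?p" "?p \<le> 1" by simp_all
  have "(\<lambda>x. x \<in> D) -` {True} \<inter> space M = D" "(\<lambda>x. x \<in> D) -` {False} \<inter> space M = space M - D"
    using sets.sets_into_space[OF D] by auto
  then have "rv_entropy M (\<lambda>x. x \<in> D) = - (?p * ln ?p) - (1 - ?p) * ln (1 - ?p)"
    using rv_entropy_sum_superset[of "\<lambda>x. x \<in> D" "{True, False}"] prob_compl[OF D] by auto
  moreover have "- (?p * ln ?p) \<le> 2 * sqrt ?p"
  proof (cases "?p = 0")
    case False
    then have "?p > 0" using p by linarith
    have "- ln ?p = 2 * ln (1 / sqrt ?p)" using \<open>?p > 0\<close> by (simp add: ln_div ln_sqrt)
    also have "\<dots> \<le> 2 * (1 / sqrt ?p)"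
      using ln_le_minus_one[of "1 / sqrt ?p"] \<open>?p > 0\<close> by simp
    finally have "?p * (- ln ?p) \<le> ?p * (2 * (1 / sqrt ?p))" using p(1) by (rule mult_left_mono)
    also have "\<dots> = 2 * (?p / sqrt ?p)" by simp
    also have "\<dots> = 2 * sqrt ?p" using \<open>?p > 0\<close> by (simp only: real_div_sqrt less_imp_le)
    finally show ?thesis by simp
  qed simp
  moreover have "- ((1 - ?p) * ln (1 - ?p)) \<le> ?p"
  proof (cases "?p = 1")
    case False
    then have q: "1 - ?p > 0" using p by linarith
    then have "- ln (1 - ?p) \<le> 1 / (1 - ?p) - 1"
      using ln_le_minus_one[of "1 / (1 - ?p)"] by (simp add: ln_div)
    then have "(1 - ?p) * (- ln (1 - ?p)) \<le> (1 - ?p) * (1 / (1 - ?p) - 1)" using q by (intro mult_left_mono) auto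
    also have "\<dots> = ?p" using q by (simp add: field_simps)
    finally show ?thesis by simp
  qed simp
  ultimately show ?thesis by linarith
qed

lemma rv_entropy_join_le:
  assumes "finite I" "simple_function M V" "\<And>i. i \<in> I \<Longrightarrow> simple_function M (U i)"
  shows "rv_entropy M (\<lambda>x. (V x, \<lambda>i\<in>I. U i x)) \<le> rv_entropy M V + (\<Sum>i\<in>I. rv_entropy M (U i))"
  using assms
proof (induction I rule: finite_induct)
  case empty
  have "rv_entropy M (\<lambda>x. (V x, \<lambda>i\<in>{}. U i x)) \<le> rv_entropy M V"
    by (rule rv_entropy_factor_le) (use empty in auto)
  then show ?case by (simp only: sum.empty add_0_right)
next
  case (insert i I)
  let ?V = "\<lambda>x. (V x, \<lambda>i\<in>I. U i x)"
  have sI: "simple_function M (\<lambda>x. \<lambda>i\<in>I. U i x)"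
    by (rule simple_function_restrict) (use insert in simp_all)
  have sV: "simple_function M ?V" by (rule simple_function_Pair[OF insert.prems(1) sI])
  have sU: "simple_function M (U i)" using insert.prems(2) by simp
  have "rv_entropy M (\<lambda>x. (V x, \<lambda>i\<in>insert i I. U i x)) \<le> rv_entropy M (\<lambda>x. (?V x, U i x))"
    by (rule rv_entropy_factor_le, rule simple_function_Pair[OF sV sU])
      (auto simp: restrict_name_eq_iff)
  also have "\<dots> \<le> rv_entropy M ?V + rv_entropy M (U i)" by (rule rv_entropy_pair_le[OF sV sU])
  also have "\<dots> \<le> (rv_entropy M V + (\<Sum>j\<in>I. rv_entropy M (U j))) + rv_entropy M (U i)"
    by (intro add_right_mono insert.IH) (use insert.prems in simp_all)
  also have "\<dots> = rv_entropy M V + (\<Sum>j\<in>insert i I. rv_entropy M (U j))"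
    using insert.hyps by simp
  finally show ?case .
qed

end

section \<open>Windows carry all the entropy of the action\<close>

context subshift_measure
begin

definition config_entropy :: "'g set \<Rightarrow> real" where
  "config_entropy F = rv_entropy \<mu> (\<lambda>x. restrict x F)"

definition entropy_rate :: real where
  "entropy_rate = label_mean (\<lambda>x. x \<one>)"

lemma simple_coordinate: "h \<in> carrier G \<Longrightarrow> simple_function \<mu> (\<lambda>x. x h)"
  unfolding simple_function_def
proof (intro conjI ballI)
  assume h: "h \<in> carrier G"
  then have "(\<lambda>x. x h) ` space \<mu> \<subseteq> A" using X_in by (auto simp: space_mu)
  then show "finite ((\<lambda>x. x h) ` space \<mu>)" using finite_alphabet finite_subset by auto
  fix a
  have "(\<lambda>x. x h) -` {a} \<inter> space \<mu> = {x\<in>X. x h = a}" by (auto simp: space_mu)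
  then show "(\<lambda>x. x h) -` {a} \<inter> space \<mu> \<in> events" using coordinate_sets[OF h] by simp
qed

lemma simple_restrict: "finite F \<Longrightarrow> F \<subseteq> carrier G \<Longrightarrow> simple_function \<mu> (\<lambda>x. restrict x F)"
  by (intro simple_function_restrict simple_coordinate) auto

lemma config_entropy_eq_label:
  "F \<subseteq> carrier G \<Longrightarrow> config_entropy F = label_entropy (\<lambda>x. x \<one>) F"
  unfolding config_entropy_def label_entropy_def
  by (intro rv_entropy_cong restrict_ext) (simp add: subset_iff)

lemma config_entropy_limit:
  assumes F: "folner_sequence G F"
  shows "(\<lambda>n. config_entropy (F n) / real (card (F n))) \<longlonglongrightarrow> entropy_rate"
proof -
  have "F n \<subseteq> carrier G" for n using F by (auto simp: folner_sequence_def)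
  then show ?thesis
    using label_entropy_limit[OF simple_coordinate[of \<one>] F]
    by (simp add: config_entropy_eq_label entropy_rate_def)
qed

text \<open>Each cell \<open>C\<close> is approximated by a window event, with error set
  \<open>D C\<close>. The word in the common window together with the indicators of the error sets
  determines the cell, since a point lies in \<open>C\<close> iff exactly one of the window event
  and \<open>D C\<close> contains it. The indicators have little entropy.\<close>

lemma partition_approximation:
  assumes P: "finite_measurable_partition \<mu> P" and \<epsilon>: "\<epsilon> > 0"
  shows "\<exists>W. finite W \<and> W \<subseteq> carrier G \<and>
    rv_entropy \<mu> (\<lambda>x. (cell_of P x, restrict x W)) \<le> rv_entropy \<mu> (\<lambda>x. restrict x W) + \<epsilon>"
proof -
  have fP: "finite P" using P by (auto simp: finite_measurable_partition_def)
  have "((\<lambda>p::real. 2 * sqrt p + p) \<longlongrightarrow> 2 * sqrt 0 + 0) (at 0)"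
    by (intro tendsto_intros)
  then have "\<forall>\<^sub>F p::real in at 0. 2 * sqrt p + p < \<epsilon> / (real (card P) + 1)"
    using \<epsilon> by (intro order_tendstoD(2)) auto
  \<comment> \<open>The punctured filter at 0 says nothing about \<open>p = 0\<close>, so error sets
    of probability 0 are treated separately.\<close>
  then obtain \<delta> where \<delta>: "\<delta> > 0" and \<delta>': "\<And>p::real. p \<noteq> 0 \<Longrightarrow> \<bar>p\<bar> < \<delta> \<Longrightarrow> 2 * sqrt p + p < \<epsilon> / (real (card P) + 1)"
    unfolding eventually_at by (auto simp: dist_real_def)
  have "\<forall>C\<in>P. \<exists>W S. finite W \<and> W \<subseteq> carrier G \<and> measure \<mu> (sym_diff C {x\<in>X. restrict x W \<in> S}) < \<delta>"
    using cylinder_approximation[OF _ \<delta>] P by (auto simp: finite_measurable_partition_def)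
  from bchoice[OF this] obtain W where "\<forall>C\<in>P. \<exists>S. finite (W C) \<and> W C \<subseteq> carrier G \<and>
      measure \<mu> (sym_diff C {x\<in>X. restrict x (W C) \<in> S}) < \<delta>" ..
  from bchoice[OF this] obtain S where "\<forall>C\<in>P. finite (W C) \<and> W C \<subseteq> carrier G \<and>
      measure \<mu> (sym_diff C {x\<in>X. restrict x (W C) \<in> S C}) < \<delta>" ..
  then have W: "\<And>C. C \<in> P \<Longrightarrow> finite (W C)" "\<And>C. C \<in> P \<Longrightarrow> W C \<subseteq> carrier G"
    and WS: "\<And>C. C \<in> P \<Longrightarrow> measure \<mu> (sym_diff C {x\<in>X. restrict x (W C) \<in> S C}) < \<delta>" by blast+
  define D where "D C = sym_diff C {x\<in>X. restrict x (W C) \<in> S C}" for C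
  define U where "U = (\<Union>C\<in>P. W C)"
  have U: "finite U" "U \<subseteq> carrier G" using fP W by (auto simp: U_def)
  have sU: "simple_function \<mu> (\<lambda>x. restrict x U)" by (rule simple_restrict[OF U])
  have D: "D C \<in> events" if "C \<in> P" for C
  proof -
    have "{x\<in>X. restrict x (W C) \<in> S C} = (\<lambda>x. restrict x (W C)) -` S C \<inter> space \<mu>" by (auto simp: space_mu)
    also have "\<dots> \<in> events" using simple_functionD(2)[OF simple_restrict[OF W[OF that]]] .
    finally show ?thesis using that P by (auto simp: D_def finite_measurable_partition_def)
  qed
  have sD: "simple_function \<mu> (\<lambda>x. x \<in> D C)" if "C \<in> P" for C
    unfolding simple_function_def
  proof (intro conjI ballI)
    show "finite ((\<lambda>x. x \<in> D C) ` space \<mu>)" by (rule finite_subset[of _ UNIV]) auto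
    fix b
    have "(\<lambda>x. x \<in> D C) -` {b} \<inter> space \<mu> = (if b then D C else space \<mu> - D C)"
      using sets.sets_into_space[OF D[OF that]] by auto
    then show "(\<lambda>x. x \<in> D C) -` {b} \<inter> space \<mu> \<in> events" using D[OF that] by simp
  qed
  have Dle: "rv_entropy \<mu> (\<lambda>x. x \<in> D C) \<le> \<epsilon> / (real (card P) + 1)" if "C \<in> P" for C
  proof (cases "prob (D C) = 0")
    case True
    then have "rv_entropy \<mu> (\<lambda>x. x \<in> D C) \<le> 0" using rv_entropy_event[OF D[OF that]] by simp
    also have "0 \<le> \<epsilon> / (real (card P) + 1)" using \<epsilon> by simp
    finally show ?thesis .
  next
    case False
    then show ?thesis
      using rv_entropy_event[OF D[OF that]] \<delta>'[OF False] WS[OF that] by (simp add: D_def)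
  qed
  have "rv_entropy \<mu> (\<lambda>x. (cell_of P x, restrict x U)) \<le> rv_entropy \<mu> (\<lambda>x. (restrict x U, \<lambda>C\<in>P. x \<in> D C))"
  proof (rule rv_entropy_factor_le)
    show "simple_function \<mu> (\<lambda>x. (restrict x U, \<lambda>C\<in>P. x \<in> D C))"
      by (rule simple_function_Pair[OF sU simple_function_restrict[OF fP sD]])
    fix x y assume xy: "x \<in> space \<mu>" "y \<in> space \<mu>"
      "(restrict x U, \<lambda>C\<in>P. x \<in> D C) = (restrict y U, \<lambda>C\<in>P. y \<in> D C)"
    have xyX: "x \<in> X" "y \<in> X" using xy by (auto simp: space_mu)
    have U_eq: "restrict x U = restrict y U" and D_eq: "\<forall>C\<in>P. (x \<in> D C) = (y \<in> D C)"
      using xy(3) by (auto simp: restrict_name_eq_iff)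
    have "x \<in> C \<longleftrightarrow> y \<in> C" if C: "C \<in> P" for C
    proof -
      have "restrict x (W C) = restrict y (W C)"
        using U_eq C unfolding restrict_name_eq_iff U_def by blast
      moreover have "z \<in> C \<longleftrightarrow> (z \<in> D C) \<noteq> (restrict z (W C) \<in> S C)" if "z \<in> X" for z
        using that by (auto simp: D_def)
      ultimately show ?thesis using D_eq C xyX by simp
    qed
    then have "cell_of P x = cell_of P y"
      using cell_of_eq[OF P cell_of_in(1)[OF P xyX(1)], of y] cell_of_in[OF P xyX(1)] by simp
    then show "(cell_of P x, restrict x U) = (cell_of P y, restrict y U)" using U_eq by simp
  qed
  also have "\<dots> \<le> rv_entropy \<mu> (\<lambda>x. restrict x U) + (\<Sum>C\<in>P. rv_entropy \<mu> (\<lambda>x. x \<in> D C))"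
    by (rule rv_entropy_join_le[OF fP sU sD])
  also have "(\<Sum>C\<in>P. rv_entropy \<mu> (\<lambda>x. x \<in> D C)) \<le> (\<Sum>C\<in>P. \<epsilon> / (real (card P) + 1))"
    by (rule sum_mono) (rule Dle)
  also have "\<dots> \<le> \<epsilon>" using \<epsilon> by (simp add: field_simps)
  finally have "rv_entropy \<mu> (\<lambda>x. (cell_of P x, restrict x U)) \<le> rv_entropy \<mu> (\<lambda>x. restrict x U) + \<epsilon>"
    by linarith
  then show ?thesis using U by blast
qed

text \<open>\<open>c\<close> bounds the conditional entropy of the label given the word in
  \<open>W\<close>. At an inner point \<open>g\<close> the translated window lies in
  \<open>F\<close>, so by invariance the label at \<open>g\<close> adds at most \<open>c\<close>
  once the word on \<open>F\<close> is known. The labels are joined one at a time by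
  submodularity.\<close>

lemma label_entropy_relative:
  assumes L: "simple_function \<mu> L" and W: "finite W" "W \<subseteq> carrier G" and F: "finite F" "F \<subseteq> carrier G"
    and c: "rv_entropy \<mu> (\<lambda>x. (L x, restrict x W)) \<le> rv_entropy \<mu> (\<lambda>x. restrict x W) + c"
  shows "F' \<subseteq> inner_points W F \<Longrightarrow>
    rv_entropy \<mu> (\<lambda>x. (\<lambda>g\<in>F'. L (shift G g x), restrict x F)) \<le> config_entropy F + real (card F') * c"
proof -
  have sF: "simple_function \<mu> (\<lambda>x. restrict x F)" by (rule simple_restrict[OF F])
  have sW: "simple_function \<mu> (\<lambda>x. restrict x W)" by (rule simple_restrict[OF W])
  have fin: "finite (inner_points W F)" "inner_points W F \<subseteq> carrier G" using F by (auto simp: inner_points_def)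
  assume "F' \<subseteq> inner_points W F"
  then have "finite F'" using fin finite_subset by auto
  then show ?thesis using \<open>F' \<subseteq> inner_points W F\<close>
  proof (induction F' rule: finite_induct)
    case empty
    have "rv_entropy \<mu> (\<lambda>x. (\<lambda>g\<in>{}. L (shift G g x), restrict x F)) \<le> rv_entropy \<mu> (\<lambda>x. restrict x F)"
      by (rule rv_entropy_factor_le[OF sF]) auto
    then show ?case by (simp only: config_entropy_def card.empty of_nat_0 mult_zero_left add_0_right)
  next
    case (insert g F')
    have g: "g \<in> carrier G" "\<And>m. m \<in> W \<Longrightarrow> g \<otimes> m \<in> F" using insert.prems fin by (auto simp: inner_points_def)
    let ?V = "\<lambda>x. restrict x F" and ?Lg = "\<lambda>x. L (shift G g x)" and ?L' = "\<lambda>x. \<lambda>g\<in>F'. L (shift G g x)"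
      and ?Wg = "\<lambda>x. restrict (shift G g x) W"
    have sLg: "simple_function \<mu> ?Lg" by (rule simple_label_shift[OF L g(1)])
    have sWg: "simple_function \<mu> ?Wg" by (rule simple_label_shift[OF sW g(1)])
    have sL': "simple_function \<mu> ?L'" using insert fin by (intro simple_label_name L) auto
    have WgV: "restrict (shift G g x) W = restrict (shift G g y) W" if "restrict x F = restrict y F" for x y
    proof -
      have "x h = y h" if "h \<in> F" for h
        using fun_cong[OF \<open>restrict x F = restrict y F\<close>, of h] that by simp
      then show ?thesis using g W by (auto intro!: restrict_ext simp: subset_iff)
    qed
    have "rv_entropy \<mu> (\<lambda>x. (\<lambda>g\<in>insert g F'. L (shift G g x), restrict x F)) \<le> rv_entropy \<mu> (\<lambda>x. (?Lg x, ?L' x, ?V x))"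
      by (rule rv_entropy_factor_le, intro simple_function_Pair sLg sL' sF)
        (auto simp: restrict_name_eq_iff)
    also have "\<dots> \<le> rv_entropy \<mu> (\<lambda>x. (?Lg x, ?V x)) + rv_entropy \<mu> (\<lambda>x. (?L' x, ?V x)) - rv_entropy \<mu> ?V"
      using rv_entropy_submodular[OF sLg sL' sF] by simp
    also have "rv_entropy \<mu> (\<lambda>x. (?L' x, ?V x)) \<le> config_entropy F + real (card F') * c"
      by (rule insert.IH) (use insert.prems in blast)
    also have "rv_entropy \<mu> (\<lambda>x. (?Lg x, ?V x)) \<le> rv_entropy \<mu> ?V + c"
    proof -
      have "rv_entropy \<mu> (\<lambda>x. (?Lg x, ?V x)) \<le> rv_entropy \<mu> (\<lambda>x. (?Lg x, ?V x, ?Wg x))"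
        by (rule rv_entropy_factor_le, intro simple_function_Pair sLg sWg sF) auto
      also have "\<dots> \<le> rv_entropy \<mu> (\<lambda>x. (?Lg x, ?Wg x)) + rv_entropy \<mu> (\<lambda>x. (?V x, ?Wg x)) - rv_entropy \<mu> ?Wg"
        using rv_entropy_submodular[OF sLg sF sWg] by simp
      also have "rv_entropy \<mu> (\<lambda>x. (?V x, ?Wg x)) \<le> rv_entropy \<mu> ?V"
        by (rule rv_entropy_factor_le[OF sF]) (use WgV in simp)
      also have "rv_entropy \<mu> ?Wg = rv_entropy \<mu> (\<lambda>x. restrict x W)"
        by (rule rv_entropy_shift[OF sW g(1)])
      also have "rv_entropy \<mu> (\<lambda>x. (?Lg x, ?Wg x)) = rv_entropy \<mu> (\<lambda>x. (L x, restrict x W))"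
        by (rule rv_entropy_shift[OF simple_function_Pair[OF L sW] g(1)])
      finally show ?thesis using c by linarith
    qed
    finally have "rv_entropy \<mu> (\<lambda>x. (\<lambda>g\<in>insert g F'. L (shift G g x), restrict x F)) \<le> config_entropy F + real (card F') * c + c"
      by linarith
    also have "config_entropy F + real (card F') * c + c = config_entropy F + real (card (insert g F')) * c"
      using insert.hyps by (simp add: algebra_simps)
    finally show ?case .
  qed
qed

text \<open>The upper half of the generator theorem. Given the word on a Foelner set, a label at an
  inner point costs at most \<epsilon>; the labels on the boundary cost a bounded amount each and
  disappear in the average.\<close>

lemma label_mean_le_entropy_rate:
  assumes am: "amenable G" and P: "finite_measurable_partition \<mu> P"
  shows "label_mean (cell_of P) \<le> entropy_rate"
proof (rule field_le_epsilon)
  fix \<epsilon> :: real assume "\<epsilon> > 0"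
  then obtain W where W: "finite W" "W \<subseteq> carrier G"
    and c: "rv_entropy \<mu> (\<lambda>x. (cell_of P x, restrict x W)) \<le> rv_entropy \<mu> (\<lambda>x. restrict x W) + \<epsilon>"
    using partition_approximation[OF P] by blast
  obtain F where F: "folner_sequence G F" using am by (auto simp: amenable_def)
  let ?L = "cell_of P"
  have L: "simple_function \<mu> ?L" by (rule simple_cell_of[OF P])
  interpret S: invariant_submodular G "label_entropy ?L" by (rule invariant_submodular_label[OF L])
  let ?I = "\<lambda>n. inner_points W (F n)"
  have F': "finite (F n)" "F n \<noteq> {}" "F n \<subseteq> carrier G" and I: "finite (?I n)" "?I n \<subseteq> F n" "?I n \<subseteq> carrier G" for n
    using F by (auto simp: folner_sequence_def inner_points_def)
  have bound: "label_entropy ?L (F n) / real (card (F n))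
    \<le> config_entropy (F n) / real (card (F n)) + \<epsilon> + real (card (F n - ?I n)) / real (card (F n)) * label_entropy ?L {\<one>}" for n
  proof -
    have "label_entropy ?L (F n) \<le> label_entropy ?L (?I n) + real (card (F n - ?I n)) * label_entropy ?L {\<one>}"
      by (rule S.H_Diff_le[OF F'(1,3) I(2)])
    also have "label_entropy ?L (?I n) \<le> rv_entropy \<mu> (\<lambda>x. (\<lambda>g\<in>?I n. ?L (shift G g x), restrict x (F n)))"
      unfolding label_entropy_def
      by (rule rv_entropy_factor_le, intro simple_function_Pair simple_label_name L simple_restrict F' I) auto
    also have "\<dots> \<le> config_entropy (F n) + real (card (?I n)) * \<epsilon>"
      by (rule label_entropy_relative[OF L W F'(1,3) c order_refl])
    also have "\<dots> \<le> config_entropy (F n) + real (card (F n)) * \<epsilon>"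
      using card_mono[OF F'(1) I(2)] \<open>\<epsilon> > 0\<close> by (simp add: mult_right_mono)
    finally have "label_entropy ?L (F n) / real (card (F n)) \<le>
      (config_entropy (F n) + real (card (F n)) * \<epsilon> + real (card (F n - ?I n)) * label_entropy ?L {\<one>}) / real (card (F n))"
      by (simp add: divide_right_mono)
    then show ?thesis using F'[of n] by (simp add: add_divide_distrib)
  qed
  have "(\<lambda>n. config_entropy (F n) / real (card (F n)) + \<epsilon> + real (card (F n - ?I n)) / real (card (F n)) * label_entropy ?L {\<one>})
    \<longlonglongrightarrow> entropy_rate + \<epsilon> + 0 * label_entropy ?L {\<one>}"
    by (intro tendsto_intros config_entropy_limit folner_inner_points F W)
  then show "label_mean ?L \<le> entropy_rate + \<epsilon>"
    using LIMSEQ_le[OF label_entropy_limit[OF L F]] bound by auto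
qed

text \<open>The partition by the letter at \<open>\<one>\<close> generates and attains the supremum.
  The entropy is thus a real number, so the variational inequality between extended reals becomes
  one between reals, from which terms can be subtracted.\<close>

theorem ks_entropy_eq:
  assumes am: "amenable G"
  shows "ks_entropy G \<mu> = ereal entropy_rate"
  unfolding ks_entropy_def
proof (rule antisym)
  show "(SUP P\<in>{P. finite_measurable_partition \<mu> P}. ereal (partition_ks_entropy G \<mu> P)) \<le> ereal entropy_rate"
    by (rule SUP_least) (simp add: partition_ks_entropy_eq[OF am] label_mean_le_entropy_rate[OF am])
  let ?V = "\<lambda>x::'g \<Rightarrow> 'a. x \<one>"
  define P where "P = (\<lambda>y. ?V -` {y} \<inter> space \<mu>) ` ?V ` space \<mu>"
  have sV: "simple_function \<mu> ?V" by (rule simple_coordinate) simp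
  have P: "finite_measurable_partition \<mu> P"
    unfolding finite_measurable_partition_def
  proof (intro conjI)
    show "finite P" unfolding P_def using simple_functionD(1)[OF sV] by simp
    show "P \<subseteq> events" unfolding P_def using simple_functionD(2)[OF sV] by blast
    show "partition_on (space \<mu>) P" by (rule partition_onI) (auto simp: P_def disjnt_def)
  qed
  have "label_entropy (cell_of P) F = label_entropy ?V F" if F: "finite F" "F \<subseteq> carrier G" for F
    unfolding label_entropy_def
  proof (rule rv_entropy_eqI)
    show "simple_function \<mu> (\<lambda>x. \<lambda>g\<in>F. ?V (shift G g x))" by (rule simple_label_name[OF sV F])
    show "simple_function \<mu> (\<lambda>x. \<lambda>g\<in>F. cell_of P (shift G g x))" by (rule simple_label_name[OF simple_cell_of[OF P] F])
    have cell: "cell_of P x = ?V -` {?V x} \<inter> space \<mu>" if "x \<in> X" for x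
      using that by (intro cell_of_eq[OF P]) (auto simp: P_def space_mu)
    have "cell_of P x = cell_of P y \<longleftrightarrow> ?V x = ?V y" if "x \<in> X" "y \<in> X" for x y
      unfolding cell[OF that(1)] cell[OF that(2)] using that by (auto simp: space_mu)
    then show "((\<lambda>g\<in>F. ?V (shift G g x)) = (\<lambda>g\<in>F. ?V (shift G g y))) =
        ((\<lambda>g\<in>F. cell_of P (shift G g x)) = (\<lambda>g\<in>F. cell_of P (shift G g y)))"
      if "x \<in> space \<mu>" "y \<in> space \<mu>" for x y
      using that F shift_X by (simp add: restrict_name_eq_iff space_mu subset_iff del: shift_apply)
  qed
  moreover obtain F where F: "folner_sequence G F" using am by (auto simp: amenable_def)
  ultimately have "(\<lambda>n. label_entropy ?V (F n) / real (card (F n))) \<longlonglongrightarrow> label_mean (cell_of P)"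
    using label_entropy_limit[OF simple_cell_of[OF P] F] by (simp add: folner_sequence_def)
  then have "label_mean (cell_of P) = entropy_rate"
    unfolding entropy_rate_def using label_entropy_limit[OF sV F] by (rule LIMSEQ_unique)
  then show "ereal entropy_rate \<le> (SUP P\<in>{P. finite_measurable_partition \<mu> P}. ereal (partition_ks_entropy G \<mu> P))"
    using P by (intro SUP_upper2[of P]) (simp_all add: partition_ks_entropy_eq[OF am])
qed

end

section \<open>Potentials of summable variation\<close>

lemma nonneg_infsum_tail:
  fixes f :: "'b \<Rightarrow> real"
  assumes "f summable_on S" "\<And>x. x \<in> S \<Longrightarrow> 0 \<le> f x" "\<epsilon> > 0"
  shows "\<exists>B. finite B \<and> B \<subseteq> S \<and> infsum f (S - B) \<le> \<epsilon>"
proof -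
  have "(sum f \<longlongrightarrow> infsum f S) (finite_subsets_at_top S)"
    using has_sum_infsum[OF assms(1)] by (simp add: has_sum_def)
  then have "\<forall>\<^sub>F B in finite_subsets_at_top S. dist (sum f B) (infsum f S) < \<epsilon>"
    using assms(3) by (rule tendstoD)
  then obtain B where B: "finite B" "B \<subseteq> S" "dist (sum f B) (infsum f S) < \<epsilon>"
    unfolding eventually_finite_subsets_at_top by blast
  have "infsum f (S - B) = infsum f S - infsum f B"
    using B assms(1) by (intro infsum_Diff) (auto intro: summable_on_finite)
  then show ?thesis using B by (intro exI[of _ B]) (auto simp: dist_real_def)
qed

context subshift_system
begin

definition patch :: "'g set \<Rightarrow> ('g \<Rightarrow> 'a) \<Rightarrow> ('g \<Rightarrow> 'a) \<Rightarrow> 'g \<Rightarrow> 'a" where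
  "patch W w x = (\<lambda>h. if h \<in> W then w h else x h)"

text \<open>Both substitutions are demanded on the full cylinders, so that the exchange is a
  bijection between them; in a general subshift this cannot be read off the two words alone.\<close>

definition interchangeable :: "'g set \<Rightarrow> ('g \<Rightarrow> 'a) \<Rightarrow> ('g \<Rightarrow> 'a) \<Rightarrow> bool" where
  "interchangeable W w w' \<longleftrightarrow> finite W \<and> W \<subseteq> carrier G \<and> w \<in> W \<rightarrow>\<^sub>E A \<and> w' \<in> W \<rightarrow>\<^sub>E A \<and>
     (\<forall>x\<in>cyl W w. patch W w' x \<in> X) \<and> (\<forall>x\<in>cyl W w'. patch W w x \<in> X)"

definition translate :: "'g \<Rightarrow> 'g set \<Rightarrow> 'g set" where
  "translate g W = (\<lambda>k. g \<otimes> k) ` W"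

lemma translate_iff:
  "g \<in> carrier G \<Longrightarrow> W \<subseteq> carrier G \<Longrightarrow> h \<in> translate g W \<longleftrightarrow> h \<in> carrier G \<and> inv g \<otimes> h \<in> W"
proof
  assume *: "g \<in> carrier G" "W \<subseteq> carrier G" "h \<in> translate g W"
  then obtain k where "k \<in> W" "h = g \<otimes> k" "k \<in> carrier G" by (auto simp: translate_def)
  then show "h \<in> carrier G \<and> inv g \<otimes> h \<in> W" using *(1) by (simp add: m_assoc[symmetric])
next
  assume *: "g \<in> carrier G" "h \<in> carrier G \<and> inv g \<otimes> h \<in> W"
  then have "h = g \<otimes> (inv g \<otimes> h)" by (simp add: m_assoc[symmetric])
  then show "h \<in> translate g W" using * unfolding translate_def by blast
qed

text \<open>\<open>\<beta> s\<close> bounds the effect on \<open>\<phi>\<close> of a change inside the translate \<open>s W\<close>. Additivity in the set \<open>T\<close> of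
  translates is what makes the errors summable when infinitely many sites are resampled.\<close>

definition influence_bound :: "(('g \<Rightarrow> 'a) \<Rightarrow> real) \<Rightarrow> 'g set \<Rightarrow> ('g \<Rightarrow> real) \<Rightarrow> bool" where
  "influence_bound \<phi> W \<beta> \<longleftrightarrow> (\<forall>s\<in>carrier G. 0 \<le> \<beta> s) \<and> \<beta> summable_on carrier G \<and>
     (\<forall>T x y. T \<subseteq> carrier G \<and> x \<in> X \<and> y \<in> X \<and> (\<forall>h\<in>carrier G - (\<Union>s\<in>T. translate s W). x h = y h)
        \<longrightarrow> \<bar>\<phi> x - \<phi> y\<bar> \<le> infsum \<beta> T)"

lemma influence_boundD:
  assumes "influence_bound \<phi> W \<beta>" "T \<subseteq> carrier G" "x \<in> X" "y \<in> X"
    "\<And>h. h \<in> carrier G - (\<Union>s\<in>T. translate s W) \<Longrightarrow> x h = y h"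
  shows "\<bar>\<phi> x - \<phi> y\<bar> \<le> infsum \<beta> T"
  using assms unfolding influence_bound_def by blast

lemma potential_bounded:
  assumes "potential G A X \<phi>"
  obtains c where "\<And>x. x \<in> X \<Longrightarrow> \<bar>\<phi> x\<bar> \<le> c"
proof -
  have "compactin euclideanreal (\<phi> ` topspace XT)"
    using assms compact_XT unfolding potential_def compact_space_def by (rule image_compactin[rotated])
  then have "bounded (\<phi> ` X)" by (simp add: topspace_XT compact_imp_bounded)
  then show thesis using that by (auto simp: bounded_iff)
qed

lemma potential_uniform:
  assumes \<phi>: "potential G A X \<phi>" and "\<epsilon> > 0"
  obtains W where "finite W" "W \<subseteq> carrier G"
    "\<And>x y. x \<in> X \<Longrightarrow> y \<in> X \<Longrightarrow> restrict x W = restrict y W \<Longrightarrow> \<bar>\<phi> x - \<phi> y\<bar> < \<epsilon>"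
proof -
  let ?P = "\<lambda>U. \<forall>x\<in>U. \<forall>y\<in>U. \<bar>\<phi> x - \<phi> y\<bar> < \<epsilon>"
  have "\<exists>U. openin XT U \<and> x \<in> U \<and> ?P U" if x: "x \<in> X" for x
  proof (intro exI conjI)
    let ?U = "{y \<in> topspace XT. \<phi> y \<in> ball (\<phi> x) (\<epsilon> / 2)}"
    show "openin XT ?U"
      using \<phi> unfolding potential_def by (rule openin_continuous_map_preimage) simp
    show "x \<in> ?U" using x \<open>\<epsilon> > 0\<close> by (simp add: topspace_XT)
    show "?P ?U"
    proof (intro ballI)
      fix y z assume "y \<in> ?U" "z \<in> ?U"
      then have "\<bar>\<phi> x - \<phi> y\<bar> < \<epsilon> / 2" "\<bar>\<phi> x - \<phi> z\<bar> < \<epsilon> / 2" by (auto simp: dist_real_def)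
      then show "\<bar>\<phi> y - \<phi> z\<bar> < \<epsilon>" by linarith
    qed
  qed
  then have "\<exists>W. finite W \<and> W \<subseteq> carrier G \<and> (\<forall>x\<in>X. \<exists>U. ?P U \<and> cyl W (restrict x W) \<subseteq> U)"
    by (rule uniform_cylinders[of ?P]) blast+
  then obtain W where W: "finite W" "W \<subseteq> carrier G"
    "\<And>x. x \<in> X \<Longrightarrow> \<exists>U. ?P U \<and> cyl W (restrict x W) \<subseteq> U" by blast
  show thesis
  proof (rule that[OF W(1,2)])
    fix x y assume xy: "x \<in> X" "y \<in> X" "restrict x W = restrict y W"
    then have "x \<in> cyl W (restrict x W)" "y \<in> cyl W (restrict x W)" by (auto simp: cyl_def)
    then show "\<bar>\<phi> x - \<phi> y\<bar> < \<epsilon>" using W(3)[OF xy(1)] by blast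
  qed
qed

lemma card_set_inv_diff:
  assumes "S \<subseteq> carrier G" "T \<subseteq> carrier G"
  shows "card (set_inv S - set_inv T) = card (S - T)"
proof -
  have im: "set_inv U = (\<lambda>h. inv h) ` U" for U by (auto simp: SET_INV_def)
  have inj: "inj_on (\<lambda>h. inv h) (carrier G)" by (rule inj_onI) (metis inv_inv)
  have "(\<lambda>h. inv h) ` S - (\<lambda>h. inv h) ` T = (\<lambda>h. inv h) ` (S - T)"
    by (rule inj_on_image_set_diff[OF inj, symmetric]) (use assms in blast)+
  then have "set_inv S - set_inv T = (\<lambda>h. inv h) ` (S - T)" by (simp only: im)
  moreover have "inj_on (\<lambda>h. inv h) (S - T)" using inj by (rule inj_on_subset) (use assms in blast)
  ultimately show ?thesis by (simp add: card_image)
qed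

text \<open>Compactness bounds \<phi>, which makes the real \<open>Sup\<close> in
  \<open>variation\<close> an actual supremum.\<close>

lemma variation_bound:
  assumes "potential G A X \<phi>" "x \<in> X" "y \<in> X" "restrict x E = restrict y E"
  shows "\<bar>\<phi> x - \<phi> y\<bar> \<le> variation X E \<phi>"
proof -
  obtain c where c: "\<And>x. x \<in> X \<Longrightarrow> \<bar>\<phi> x\<bar> \<le> c" using potential_bounded[OF assms(1)] by auto
  let ?V = "{\<phi> x - \<phi> y | x y. x \<in> X \<and> y \<in> X \<and> restrict x E = restrict y E}"
  have bdd: "bdd_above ?V"
  proof (rule bdd_aboveI)
    fix v assume "v \<in> ?V"
    then obtain x y where "v = \<phi> x - \<phi> y" "x \<in> X" "y \<in> X" by blast
    then show "v \<le> 2 * c" using c[of x] c[of y] by linarith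
  qed
  have "\<phi> x - \<phi> y \<le> variation X E \<phi>"
    unfolding variation_def by (rule cSup_upper[OF _ bdd]) (use assms in blast)
  moreover have "\<phi> y - \<phi> x \<le> variation X E \<phi>"
    unfolding variation_def by (rule cSup_upper[OF _ bdd]) (use assms in force)
  ultimately show ?thesis by linarith
qed

text \<open>\<open>\<beta> s\<close> is the variation of \<phi> on the last stage of the exhaustion
  that misses \<open>s W\<close>. At most \<open>card W * card (D (Suc n) - D n)\<close> translates
  first meet the exhaustion after stage \<open>n\<close>, so \<beta> is summable because the
  variation is. For a set \<open>T\<close> of translates, the one that is met first already bounds
  the change of \<phi>, and its \<beta> is a single term of the sum over \<open>T\<close>.\<close>

lemma influence_bound_exists:
  assumes sv: "summable_variation G A X \<phi>" and W: "finite W" "W \<subseteq> carrier G" "W \<noteq> {}" and "X \<noteq> {}"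
  obtains \<beta> where "influence_bound \<phi> W \<beta>"
proof -
  obtain x0 where x0: "x0 \<in> X" using assms by auto
  have \<phi>: "potential G A X \<phi>" using sv by (simp add: summable_variation_def)
  obtain E where E: "exhaustive_sequence G E"
    and sum: "summable (\<lambda>n. real (card (set_inv E (Suc n) - set_inv E n)) * variation X (E n) \<phi>)"
    using sv by (auto simp: summable_variation_def)
  have Efin: "finite (E n)" "E n \<subseteq> E (Suc n)" "(\<Union>n. E n) = carrier G" "E n \<subseteq> carrier G" for n
    using E by (auto simp: exhaustive_sequence_def)
  \<comment> \<open>The empty set is put in front of the exhaustion, so that translates meeting
    already \<open>E 0\<close> also have a last stage that they miss.\<close>
  define D where "D n = (case n of 0 \<Rightarrow> {} | Suc m \<Rightarrow> E m)" for n
  have D0: "D 0 = {}" and DS: "D (Suc n) = E n" for n by (simp_all add: D_def)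
  have Dfin: "finite (D n)" "D n \<subseteq> carrier G" for n using Efin by (cases n; simp add: D0 DS)+
  have Dmono: "D m \<subseteq> D n" if "m \<le> n" for m n
  proof (rule lift_Suc_mono_le[OF _ that])
    fix k show "D k \<subseteq> D (Suc k)" using Efin by (cases k) (simp_all add: D0 DS)
  qed
  define v where "v n = variation X (D n) \<phi>" for n
  have v0: "0 \<le> v n" for n using variation_bound[OF \<phi> x0 x0, of "D n"] by (simp add: v_def)
  define c where "c n = real (card (D (Suc n) - D n)) * v n" for n
  \<comment> \<open>The given series is the shift of \<open>c\<close> by one term. Its sets are
    inverted, which preserves the cardinality of differences.\<close>
  have "c (Suc n) = real (card (set_inv E (Suc n) - set_inv E n)) * variation X (E n) \<phi>" for n
    using card_set_inv_diff[OF Efin(4) Efin(4)] by (simp add: c_def v_def DS)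
  then have "summable (\<lambda>n. c (Suc n))" using sum by simp
  then have c_sum: "summable c" by (simp add: summable_Suc_iff)
  have c0: "0 \<le> c n" for n using v0 by (simp add: c_def)
  define m where "m s = (LEAST n. D (Suc n) \<inter> translate s W \<noteq> {})" for s
  have m_hit: "D (Suc (m s)) \<inter> translate s W \<noteq> {}" if s: "s \<in> carrier G" for s
    unfolding m_def
  proof (rule LeastI_ex)
    obtain k where "k \<in> W" using W by auto
    then have "s \<otimes> k \<in> carrier G" "s \<otimes> k \<in> translate s W" using s W by (auto simp: translate_def)
    then obtain n where "s \<otimes> k \<in> E n" using Efin(3) by blast
    then show "\<exists>n. D (Suc n) \<inter> translate s W \<noteq> {}"
      using \<open>s \<otimes> k \<in> translate s W\<close> by (auto simp: DS)
  qed
  have m_miss: "D (m s) \<inter> translate s W = {}" for s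
  proof (cases "m s")
    case (Suc k)
    then have "k < (LEAST n. D (Suc n) \<inter> translate s W \<noteq> {})" by (simp add: m_def)
    from not_less_Least[OF this] show ?thesis using Suc by simp
  qed (simp add: D0)
  define \<beta> where "\<beta> s = v (m s)" for s
  have \<beta>0: "0 \<le> \<beta> s" for s using v0 by (simp add: \<beta>_def)
  have count: "card {s\<in>S. m s = n} \<le> card W * card (D (Suc n) - D n)" if S: "finite S" "S \<subseteq> carrier G" for S n
  proof -
    have "{s\<in>S. m s = n} \<subseteq> (\<lambda>(h, k). h \<otimes> inv k) ` ((D (Suc n) - D n) \<times> W)"
    proof
      fix s assume "s \<in> {s\<in>S. m s = n}"
      then have s: "s \<in> carrier G" "m s = n" using S by auto
      obtain k where k: "k \<in> W" "s \<otimes> k \<in> D (Suc n)"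
        using m_hit[OF s(1)] s(2) by (auto simp: translate_def)
      have "s \<otimes> k \<notin> D n" using m_miss[of s] s(2) k(1) by (auto simp: translate_def)
      moreover have "s = s \<otimes> k \<otimes> inv k" using s k W by (simp add: m_assoc subset_iff)
      ultimately show "s \<in> (\<lambda>(h, k). h \<otimes> inv k) ` ((D (Suc n) - D n) \<times> W)"
        using k by (intro image_eqI[of _ _ "(s \<otimes> k, k)"]) auto
    qed
    then have "card {s\<in>S. m s = n} \<le> card ((D (Suc n) - D n) \<times> W)"
      using Dfin W by (intro surj_card_le) auto
    then show ?thesis by (simp add: card_cartesian_product mult.commute)
  qed
  have "\<beta> summable_on carrier G"
  proof (rule nonneg_bdd_above_summable_on)
    show "bdd_above (sum \<beta> ` {F. F \<subseteq> carrier G \<and> finite F})"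
    proof (rule bdd_aboveI2)
      fix S assume "S \<in> {F. F \<subseteq> carrier G \<and> finite F}"
      then have S: "finite S" "S \<subseteq> carrier G" by auto
      have "sum \<beta> S = (\<Sum>n\<in>m ` S. \<Sum>s\<in>{s\<in>S. m s = n}. \<beta> s)" by (rule sum.image_gen[OF S(1)])
      also have "\<dots> = (\<Sum>n\<in>m ` S. real (card {s\<in>S. m s = n}) * v n)"
        by (intro sum.cong refl) (simp add: \<beta>_def)
      also have "\<dots> \<le> (\<Sum>n\<in>m ` S. real (card W) * c n)"
      proof (rule sum_mono)
        fix n
        have "real (card {s\<in>S. m s = n}) \<le> real (card W * card (D (Suc n) - D n))"
          using count[OF S] by (simp only: of_nat_le_iff)
        then have "real (card {s\<in>S. m s = n}) * v n \<le> real (card W * card (D (Suc n) - D n)) * v n"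
          using v0 by (rule mult_right_mono)
        then show "real (card {s\<in>S. m s = n}) * v n \<le> real (card W) * c n"
          by (simp add: c_def mult.assoc)
      qed
      also have "\<dots> = real (card W) * (\<Sum>n\<in>m ` S. c n)" by (simp add: sum_distrib_left)
      also have "\<dots> \<le> real (card W) * suminf c"
        using S c0 by (intro mult_left_mono sum_le_suminf c_sum) auto
      finally show "sum \<beta> S \<le> real (card W) * suminf c" .
    qed
  qed (simp add: \<beta>0)
  moreover have "\<bar>\<phi> x - \<phi> y\<bar> \<le> infsum \<beta> T"
    if T: "T \<subseteq> carrier G" and xy: "x \<in> X" "y \<in> X"
      and eq: "\<And>h. h \<in> carrier G - (\<Union>s\<in>T. translate s W) \<Longrightarrow> x h = y h" for T x y
  proof (cases "T = {}")
    case True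
    then have "x = y" using eq by (intro X_eqI xy) auto
    then show ?thesis using True by simp
  next
    case False
    then obtain s where s: "s \<in> T" "\<And>s'. s' \<in> T \<Longrightarrow> m s \<le> m s'"
      using ex_has_least_nat[of "\<lambda>s. s \<in> T" _ m] by blast
    have "x h = y h" if h: "h \<in> D (m s)" for h
    proof (rule eq)
      have "h \<notin> translate s' W" if "s' \<in> T" for s'
        using m_miss[of s'] Dmono[OF s(2)[OF that]] h by blast
      then show "h \<in> carrier G - (\<Union>s\<in>T. translate s W)" using h Dfin(2) by blast
    qed
    then have "restrict x (D (m s)) = restrict y (D (m s))" by (rule restrict_ext)
    then have "\<bar>\<phi> x - \<phi> y\<bar> \<le> \<beta> s"
      unfolding \<beta>_def v_def by (rule variation_bound[OF \<phi> xy])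
    also have "\<beta> s = sum \<beta> {s}" by simp
    also have "\<dots> \<le> infsum \<beta> T"
      using \<open>\<beta> summable_on carrier G\<close> T s(1) \<beta>0
      by (intro finite_sum_le_infsum) (auto intro: summable_on_subset_banach)
    finally show ?thesis .
  qed
  ultimately show thesis using \<beta>0 by (intro that[of \<beta>]) (auto simp: influence_bound_def)
qed

lemma summable_on_inverse:
  fixes \<beta> :: "'g \<Rightarrow> real"
  assumes "\<beta> summable_on carrier G" "B \<subseteq> carrier G"
  shows "(\<lambda>g. \<beta> (inv g)) summable_on ((\<lambda>h. inv h) ` B)" "infsum (\<lambda>g. \<beta> (inv g)) ((\<lambda>h. inv h) ` B) = infsum \<beta> B"
proof -
  have inj: "inj_on (\<lambda>h. inv h) B" using assms(2) by (intro inj_onI) (metis inv_inv subsetD)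
  have eq: "\<beta> (inv (inv g)) = \<beta> g" if "g \<in> B" for g using that assms(2) by (simp add: subset_iff)
  have "\<beta> summable_on B" using assms by (rule summable_on_subset_banach)
  then have "(\<lambda>g. \<beta> (inv (inv g))) summable_on B" using eq by (simp cong: summable_on_cong)
  then show "(\<lambda>g. \<beta> (inv g)) summable_on ((\<lambda>h. inv h) ` B)"
    using summable_on_reindex[OF inj, of "\<lambda>g. \<beta> (inv g)"] by (simp add: comp_def)
  show "infsum (\<lambda>g. \<beta> (inv g)) ((\<lambda>h. inv h) ` B) = infsum \<beta> B"
    using infsum_reindex[OF inj, of "\<lambda>g. \<beta> (inv g)"] eq by (simp add: comp_def cong: infsum_cong)
qed

lemma inv_image_carrier: "(\<lambda>h. inv h) ` carrier G = carrier G"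
proof
  show "carrier G \<subseteq> (\<lambda>h. inv h) ` carrier G"
  proof
    fix h assume "h \<in> carrier G"
    then show "h \<in> (\<lambda>h. inv h) ` carrier G" by (intro image_eqI[of _ _ "inv h"]) auto
  qed
qed auto

text \<open>Seen after the shift by \<open>g\<close>, a change inside \<open>W\<close> is a change
  inside the single translate \<open>(inv g) W\<close>.\<close>

lemma shift_difference_bound:
  assumes \<beta>: "influence_bound \<phi> W \<beta>" and W: "W \<subseteq> carrier G" and xy: "x \<in> X" "y \<in> X"
    and eq: "\<And>h. h \<in> carrier G - W \<Longrightarrow> x h = y h" and g: "g \<in> carrier G"
  shows "\<bar>\<phi> (shift G g y) - \<phi> (shift G g x)\<bar> \<le> \<beta> (inv g)"
proof -
  have "shift G g y h = shift G g x h" if "h \<in> carrier G - (\<Union>s\<in>{inv g}. translate s W)" for h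
    using that eq[of "g \<otimes> h"] g W by (auto simp: translate_iff)
  then have "\<bar>\<phi> (shift G g y) - \<phi> (shift G g x)\<bar> \<le> infsum \<beta> {inv g}"
    by (intro influence_boundD[OF \<beta>]) (use xy g shift_X in simp_all)
  then show ?thesis by simp
qed

text \<open>With the summation index inverted, the term of \<open>s\<close> is bounded by
  \<open>\<beta> s\<close>. Hence the series converges absolutely, and dropping the terms outside
  \<open>B\<close> costs the tail of \<beta>.\<close>

lemma cocycle_finite_approx:
  assumes \<beta>: "influence_bound \<phi> W \<beta>" and W: "W \<subseteq> carrier G" and xy: "x \<in> X" "y \<in> X"
    and eq: "\<And>h. h \<in> carrier G - W \<Longrightarrow> x h = y h" and B: "finite B" "B \<subseteq> carrier G"
  shows "\<bar>potential_cocycle G \<phi> x y - (\<Sum>s\<in>B. \<phi> (shift G (inv s) y) - \<phi> (shift G (inv s) x))\<bar> \<le> infsum \<beta> (carrier G - B)"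
proof -
  let ?d = "\<lambda>g. \<phi> (shift G g y) - \<phi> (shift G g x)"
  let ?iB = "(\<lambda>h. inv h) ` B"
  have \<beta>s: "\<beta> summable_on carrier G" using \<beta> by (simp add: influence_bound_def)
  have bound: "norm (?d g) \<le> \<beta> (inv g)" if "g \<in> carrier G" for g
    using shift_difference_bound[OF \<beta> W xy eq that] by simp
  have s\<beta>: "(\<lambda>g. \<beta> (inv g)) summable_on carrier G"
    using summable_on_inverse(1)[OF \<beta>s subset_refl] by (simp add: inv_image_carrier)
  have abs: "(\<lambda>g. norm (?d g)) summable_on carrier G"
    by (rule Infinite_Sum.abs_summable_on_comparison_test'[OF s\<beta> bound])
  have inj: "inj_on (\<lambda>h. inv h) (carrier G)" by (rule inj_onI) (metis inv_inv)
  have iB: "finite ?iB" "?iB \<subseteq> carrier G" using B by auto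
  have diff: "carrier G - ?iB = (\<lambda>h. inv h) ` (carrier G - B)"
    using inj_on_image_set_diff[OF inj, of "carrier G" B] B by (simp add: inv_image_carrier)
  have "(\<Sum>s\<in>B. ?d (inv s)) = sum ?d ?iB"
    using inj B by (subst sum.reindex) (auto intro: inj_on_subset)
  moreover have "infsum ?d (carrier G - ?iB) = infsum ?d (carrier G) - infsum ?d ?iB"
    by (rule infsum_Diff[OF Infinite_Sum.abs_summable_summable[OF abs] summable_on_finite[OF iB(1)] iB(2)])
  moreover have abs': "(\<lambda>g. norm (?d g)) summable_on carrier G - ?iB"
    by (rule summable_on_subset_banach[OF abs Diff_subset])
  ultimately have "\<bar>potential_cocycle G \<phi> x y - (\<Sum>s\<in>B. ?d (inv s))\<bar> = norm (infsum ?d (carrier G - ?iB))"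
    using iB by (simp add: potential_cocycle_def)
  also have "\<dots> \<le> infsum (\<lambda>g. norm (?d g)) (carrier G - ?iB)"
    by (rule norm_infsum_bound[OF abs'])
  also have "\<dots> \<le> infsum (\<lambda>g. \<beta> (inv g)) (carrier G - ?iB)"
    by (rule infsum_mono[OF abs' summable_on_subset_banach[OF s\<beta> Diff_subset]]) (rule bound, simp)
  also have "\<dots> = infsum \<beta> (carrier G - B)"
    unfolding diff using \<beta>s by (rule summable_on_inverse) auto
  finally show ?thesis .
qed

end

section \<open>Entropy of a two-point resampling\<close>

definition entropy_fun :: "real \<Rightarrow> real" where
  "entropy_fun x = - (x * ln x)"

lemma entropy_fun_0 [simp]: "entropy_fun 0 = 0"
  by (simp add: entropy_fun_def)

lemma entropy_fun_mult:
  "0 \<le> x \<Longrightarrow> 0 \<le> y \<Longrightarrow> entropy_fun (x * y) = x * entropy_fun y + y * entropy_fun x"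
  by (cases "x = 0"; cases "y = 0") (simp_all add: entropy_fun_def ln_mult algebra_simps)

text \<open>The tangent at \<open>y\<close> lies above the concave graph. Both Jensen's inequality
  and the log-sum inequality are sums of this bound.\<close>

lemma entropy_fun_tangent:
  assumes "0 \<le> x" "0 < y"
  shows "entropy_fun x \<le> y - x - x * ln y"
proof (cases "x = 0")
  case False
  then have x: "0 < x" using assms by simp
  have "ln (y / x) \<le> y / x - 1" using assms x by (intro ln_le_minus_one) simp
  then have "x * ln (y / x) \<le> x * (y / x - 1)" using x by (intro mult_left_mono) auto
  then show ?thesis using x assms by (simp add: entropy_fun_def ln_div algebra_simps)
qed (use assms in simp)

lemma entropy_fun_concave:
  assumes fin: "finite S" and p: "\<And>s. s \<in> S \<Longrightarrow> 0 \<le> p s" "sum p S = 1" and y: "\<And>s. s \<in> S \<Longrightarrow> 0 \<le> y s"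
  shows "(\<Sum>s\<in>S. p s * entropy_fun (y s)) \<le> entropy_fun (\<Sum>s\<in>S. p s * y s)"
proof -
  let ?Y = "\<Sum>s\<in>S. p s * y s"
  have Y: "0 \<le> ?Y" using p y by (intro sum_nonneg) simp
  show ?thesis
  proof (cases "?Y = 0")
    case True
    then have "p s * y s = 0" if "s \<in> S" for s
      using that fin p y by (subst (asm) sum_nonneg_eq_0_iff) auto
    then have "p s * entropy_fun (y s) = 0" if "s \<in> S" for s using that by (auto simp: entropy_fun_def)
    then have "(\<Sum>s\<in>S. p s * entropy_fun (y s)) = 0" by (intro sum.neutral) auto
    then show ?thesis using True by simp
  next
    case False
    then have "0 < ?Y" using Y by simp
    then have "(\<Sum>s\<in>S. p s * entropy_fun (y s)) \<le> (\<Sum>s\<in>S. p s * (?Y - y s - y s * ln ?Y))"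
      by (intro sum_mono mult_left_mono entropy_fun_tangent y p)
    also have "\<dots> = (\<Sum>s\<in>S. p s) * ?Y - ?Y - ?Y * ln ?Y"
    proof -
      have "(\<Sum>s\<in>S. p s * (Y - y s - y s * ln Y)) = sum p S * Y - (\<Sum>s\<in>S. p s * y s) - (\<Sum>s\<in>S. p s * y s) * ln Y" for Y
        by (simp add: right_diff_distrib sum_subtractf sum_distrib_right mult.assoc)
      then show ?thesis .
    qed
    finally show ?thesis by (simp add: p entropy_fun_def)
  qed
qed

lemma log_sum_inequality:
  assumes fin: "finite S" and a: "\<And>z. z \<in> S \<Longrightarrow> 0 \<le> a z" "\<And>z. z \<in> S \<Longrightarrow> a z \<le> m z"
  shows "(\<Sum>z\<in>S. entropy_fun (a z) + a z * ln (m z)) \<le> entropy_fun (sum a S) + sum a S * ln (sum m S)"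
proof (cases "sum a S = 0")
  case True
  then have "a z = 0" if "z \<in> S" for z using that fin a by (subst (asm) sum_nonneg_eq_0_iff) auto
  then show ?thesis using True by simp
next
  case False
  let ?a = "sum a S" and ?m = "sum m S"
  have pos: "0 < ?a" using False a sum_nonneg[of S a] by (simp add: less_le)
  have "?a \<le> ?m" using a by (intro sum_mono)
  then have mpos: "0 < ?m" using pos by linarith
  have "entropy_fun (a z) + a z * ln (m z) \<le> m z * ?a / ?m - a z - a z * ln (?a / ?m)" if z: "z \<in> S" for z
  proof (cases "a z = 0")
    case True
    then show ?thesis using a[OF z] pos mpos by simp
  next
    case False
    then have "0 < m z" using a[OF z] by linarith
    \<comment> \<open>Tangent at the value that \<open>a z\<close> would have if the total mass of
      \<open>a\<close> were spread in proportion to \<open>m\<close>.\<close>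
    then have "entropy_fun (a z) \<le> m z * ?a / ?m - a z - a z * ln (m z * ?a / ?m)"
      using a[OF z] pos mpos by (intro entropy_fun_tangent) auto
    also have "ln (m z * ?a / ?m) = ln (m z) + ln (?a / ?m)"
      using \<open>0 < m z\<close> pos mpos by (simp add: ln_mult ln_div)
    finally show ?thesis by (simp add: algebra_simps)
  qed
  then have "(\<Sum>z\<in>S. entropy_fun (a z) + a z * ln (m z)) \<le> (\<Sum>z\<in>S. m z * ?a / ?m - a z - a z * ln (?a / ?m))"
    by (rule sum_mono)
  also have "\<dots> = ?m * ?a / ?m - ?a - ?a * ln (?a / ?m)"
    by (simp add: sum_subtractf sum_divide_distrib[symmetric] sum_distrib_right[symmetric])
  also have "\<dots> = entropy_fun ?a + ?a * ln ?m"
    using pos mpos by (simp add: entropy_fun_def ln_div algebra_simps)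
  finally show ?thesis .
qed

text \<open>Equal to \<open>(a + b)\<close> times the binary entropy of \<open>a / (a + b)\<close>:
  the entropy gained when an atom of mass \<open>a + b\<close> is split into atoms of masses
  \<open>a\<close> and \<open>b\<close>.\<close>

definition mixing_entropy :: "real \<Rightarrow> real \<Rightarrow> real" where
  "mixing_entropy a b = entropy_fun a + entropy_fun b - entropy_fun (a + b)"

text \<open>Conditioning reduces entropy: the uncertainty about the side, given the pair
  \<open>z\<close>, is at most the uncertainty when the pair is forgotten.\<close>

lemma mixing_entropy_sum:
  assumes fin: "finite S" and ab: "\<And>z. z \<in> S \<Longrightarrow> 0 \<le> a z" "\<And>z. z \<in> S \<Longrightarrow> 0 \<le> b z"
  shows "(\<Sum>z\<in>S. mixing_entropy (a z) (b z)) \<le> mixing_entropy (sum a S) (sum b S)"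
proof -
  let ?m = "\<lambda>z. a z + b z"
  have "(\<Sum>z\<in>S. mixing_entropy (a z) (b z)) = (\<Sum>z\<in>S. entropy_fun (a z) + a z * ln (?m z)) + (\<Sum>z\<in>S. entropy_fun (b z) + b z * ln (?m z))"
    by (simp add: mixing_entropy_def entropy_fun_def sum.distrib[symmetric] algebra_simps)
  also have "\<dots> \<le> (entropy_fun (sum a S) + sum a S * ln (sum ?m S)) + (entropy_fun (sum b S) + sum b S * ln (sum ?m S))"
    using ab by (intro add_mono log_sum_inequality fin) auto
  also have "\<dots> = mixing_entropy (sum a S) (sum b S)"
    by (simp add: mixing_entropy_def entropy_fun_def sum.distrib algebra_simps)
  finally show ?thesis .
qed

lemma resampling_entropy:
  assumes fin: "finite Q" and sub: "S \<subseteq> Q" "\<tau> ` S \<subseteq> Q" and disj: "S \<inter> \<tau> ` S = {}" and inj: "inj_on \<tau> S"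
    and P: "\<And>z. z \<in> Q \<Longrightarrow> 0 \<le> P z" and q: "0 \<le> q" "q \<le> 1"
    and P1: "\<And>z. z \<in> S \<Longrightarrow> P' z = q * (P z + P (\<tau> z))"
    and P2: "\<And>z. z \<in> S \<Longrightarrow> P' (\<tau> z) = (1 - q) * (P z + P (\<tau> z))"
    and P3: "\<And>z. z \<in> Q \<Longrightarrow> z \<notin> S \<Longrightarrow> z \<notin> \<tau> ` S \<Longrightarrow> P' z = P z"
  shows "(\<Sum>z\<in>Q. entropy_fun (P z)) + (sum P S + sum P (\<tau> ` S)) * mixing_entropy q (1 - q)
      - mixing_entropy (sum P S) (sum P (\<tau> ` S)) \<le> (\<Sum>z\<in>Q. entropy_fun (P' z))"
proof -
  let ?R = "Q - S - \<tau> ` S"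
  have finS: "finite S" using fin sub finite_subset by blast
  have split: "(\<Sum>z\<in>Q. f z) = (\<Sum>z\<in>S. f z + f (\<tau> z)) + sum f ?R" for f :: "'a \<Rightarrow> real"
  proof -
    have "Q = (S \<union> \<tau> ` S) \<union> ?R" using sub by auto
    then have "sum f Q = sum f (S \<union> \<tau> ` S) + sum f ?R"
      using fin finS by (subst sum.union_disjoint[symmetric]) auto
    also have "sum f (S \<union> \<tau> ` S) = sum f S + sum f (\<tau> ` S)"
      using finS disj by (intro sum.union_disjoint) auto
    finally show ?thesis using inj by (simp add: sum.reindex sum.distrib)
  qed
  have \<tau>: "sum P (\<tau> ` S) = (\<Sum>z\<in>S. P (\<tau> z))" using inj by (simp add: sum.reindex)
  have step: "entropy_fun (P' z) + entropy_fun (P' (\<tau> z)) =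
     entropy_fun (P z) + entropy_fun (P (\<tau> z)) - mixing_entropy (P z) (P (\<tau> z)) + (P z + P (\<tau> z)) * mixing_entropy q (1 - q)"
    if z: "z \<in> S" for z
  proof -
    define m where "m = P z + P (\<tau> z)"
    have "0 \<le> m" unfolding m_def using P z sub by (intro add_nonneg_nonneg) auto
    then have "entropy_fun (P' z) + entropy_fun (P' (\<tau> z)) = q * entropy_fun m + m * entropy_fun q + ((1 - q) * entropy_fun m + m * entropy_fun (1 - q))"
      unfolding P1[OF z] P2[OF z] m_def[symmetric] using q by (simp add: entropy_fun_mult)
    also have "\<dots> = entropy_fun m + m * (entropy_fun q + entropy_fun (1 - q))"
      by (simp add: algebra_simps)
    finally show ?thesis by (simp add: mixing_entropy_def entropy_fun_def[of 1] m_def)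
  qed
  have "(\<Sum>z\<in>S. mixing_entropy (P z) (P (\<tau> z))) \<le> mixing_entropy (sum P S) (sum P (\<tau> ` S))"
    unfolding \<tau> using P sub by (intro mixing_entropy_sum finS) auto
  moreover have "sum (\<lambda>z. entropy_fun (P' z)) ?R = sum (\<lambda>z. entropy_fun (P z)) ?R"
    by (intro sum.cong) (auto simp: P3)
  moreover have "(\<Sum>z\<in>S. entropy_fun (P' z) + entropy_fun (P' (\<tau> z))) = (\<Sum>z\<in>S. entropy_fun (P z) + entropy_fun (P (\<tau> z)))
      - (\<Sum>z\<in>S. mixing_entropy (P z) (P (\<tau> z))) + (sum P S + sum P (\<tau> ` S)) * mixing_entropy q (1 - q)"
    using step by (simp add: sum.distrib sum_subtractf sum_distrib_right[symmetric] \<tau>)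
  ultimately show ?thesis unfolding split by linarith
qed

text \<open>The free energy gained by resampling with the Gibbs weight \<open>q = 1 / (1 + e\<^sup>t)\<close> is a relative
  entropy, which dominates a squared Hellinger distance.\<close>

lemma gibbs_deviation:
  fixes a b t \<eta> :: real
  assumes ab: "0 \<le> a" "0 \<le> b" and \<eta>: "0 \<le> \<eta>"
  defines "q \<equiv> 1 / (1 + exp t)"
  assumes gain: "(a + b) * mixing_entropy q (1 - q) - mixing_entropy a b + (a * (1 - q) - b * q) * t \<le> (a + b) * \<eta>"
  shows "\<bar>b - exp t * a\<bar> \<le> (1 + exp t) * (2 * sqrt \<eta>) * (a + b)"
proof -
  let ?m = "a + b"
  have e: "0 < 1 + exp t" using exp_gt_zero[of t] by linarith
  have q: "0 < q" "1 - q = exp t * q" "0 < 1 - q" using e by (auto simp: q_def field_simps)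
  have lnq: "ln (1 - q) = t + ln q" unfolding q(2) using q(1) by (simp add: ln_mult)
  have m: "0 \<le> ?m" using ab by simp
  \<comment> \<open>For the Gibbs weight \<open>ln (1 - q) - ln q = t\<close>, so new entropy and
    energy combine to a cross entropy. Subtracting \<open>mixing_entropy a b\<close> leaves the
    relative entropy of \<open>(a, b)\<close> with respect to
    \<open>(?m * q, ?m * (1 - q))\<close>.\<close>
  have "?m * mixing_entropy q (1 - q) + (a * (1 - q) - b * q) * t = - a * ln q - b * ln (1 - q)"
    unfolding mixing_entropy_def entropy_fun_def lnq by (simp add: algebra_simps)
  then have gain': "- a * ln q - b * ln (1 - q) - mixing_entropy a b \<le> ?m * \<eta>" using gain by linarith
  \<comment> \<open>Applying \<open>ln u \<le> u - 1\<close> to the square root of the likelihood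
    ratio, instead of the ratio itself, produces the Hellinger affinity.\<close>
  have hell: "2 * x - 2 * sqrt (x * (m * r)) \<le> - entropy_fun x - x * ln m - x * ln r"
    if x: "0 \<le> x" "x \<le> m" and r: "0 < r" for x r m :: real
  proof (cases "x = 0")
    case False
    then have pos: "0 < x" "0 < m" using x by linarith+
    let ?u = "sqrt (m * r / x)"
    have upos: "0 < m * r / x" using pos r by simp
    have "ln (m * r / x) = 2 * ln ?u" using upos by (simp add: ln_sqrt)
    also have "\<dots> \<le> 2 * (?u - 1)" using ln_le_minus_one[of ?u] upos by simp
    finally have "x * ln (m * r / x) \<le> x * (2 * (?u - 1))" using x by (intro mult_left_mono) auto
    moreover have "x * ?u = sqrt (x * (m * r))"
    proof -
      have "x * ?u = sqrt (x^2) * ?u" using x by simp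
      also have "\<dots> = sqrt (x^2 * (m * r / x))" by (simp only: real_sqrt_mult)
      also have "x^2 * (m * r / x) = x * (m * r)" using pos by (simp add: power2_eq_square)
      finally show ?thesis .
    qed
    moreover have "x * ln (m * r / x) = x * ln m + x * ln r + entropy_fun x"
      using pos r by (simp add: entropy_fun_def ln_div ln_mult algebra_simps)
    ultimately show ?thesis by (simp add: algebra_simps)
  qed simp
  have "mixing_entropy a b = entropy_fun a + entropy_fun b + a * ln ?m + b * ln ?m"
    by (simp add: mixing_entropy_def entropy_fun_def algebra_simps)
  then have "2 * a - 2 * sqrt (a * (?m * q)) + (2 * b - 2 * sqrt (b * (?m * (1 - q)))) \<le> ?m * \<eta>"
    using hell[of a ?m q] hell[of b ?m "1 - q"] ab q gain' by simp
  moreover have sqdiff: "(sqrt u - sqrt v)\<^sup>2 = u + v - 2 * sqrt (u * v)" if "0 \<le> u" "0 \<le> v" for u v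
    using that by (simp add: power2_diff real_sqrt_mult)
  have "(sqrt a - sqrt (?m * q))\<^sup>2 = a + ?m * q - 2 * sqrt (a * (?m * q))"
    "(sqrt b - sqrt (?m * (1 - q)))\<^sup>2 = b + ?m * (1 - q) - 2 * sqrt (b * (?m * (1 - q)))"
    by (rule sqdiff; use ab m q in simp)+
  ultimately have "(sqrt a - sqrt (?m * q))\<^sup>2 + (sqrt b - sqrt (?m * (1 - q)))\<^sup>2 \<le> ?m * \<eta>"
    by (simp add: algebra_simps)
  then have "(sqrt a - sqrt (?m * q))\<^sup>2 \<le> ?m * \<eta>"
    using zero_le_power2[of "sqrt b - sqrt (?m * (1 - q))"] by linarith
  then have d: "\<bar>sqrt a - sqrt (?m * q)\<bar> \<le> sqrt (?m * \<eta>)"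
    using real_le_rsqrt by fastforce
  have s: "sqrt a + sqrt (?m * q) \<le> 2 * sqrt ?m"
  proof -
    have "?m * q \<le> ?m * 1" by (rule mult_left_mono) (use q(3) m in linarith)+
    then have "sqrt (?m * q) \<le> sqrt ?m" by (intro real_sqrt_le_mono) simp
    moreover have "sqrt a \<le> sqrt ?m" using ab by (intro real_sqrt_le_mono) simp
    ultimately show ?thesis by linarith
  qed
  \<comment> \<open>From the Hellinger distance back to masses. The second factor is of order
    \<open>sqrt ?m\<close>, so the final bound is proportional to \<open>?m\<close>.\<close>
  have "a - ?m * q = (sqrt a - sqrt (?m * q)) * (sqrt a + sqrt (?m * q))"
    using square_diff_square_factored[of "sqrt a" "sqrt (?m * q)"] ab m q by (simp add: mult.commute)
  then have "\<bar>a - ?m * q\<bar> = \<bar>sqrt a - sqrt (?m * q)\<bar> * (sqrt a + sqrt (?m * q))"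
    using ab m q by (simp add: abs_mult)
  also have "\<dots> \<le> sqrt (?m * \<eta>) * (2 * sqrt ?m)"
    using d s ab m q \<eta> by (intro mult_mono) auto
  also have "\<dots> = 2 * sqrt \<eta> * (sqrt ?m * sqrt ?m)" by (simp only: real_sqrt_mult mult_ac)
  also have "sqrt ?m * sqrt ?m = ?m" using m by (simp only: real_sqrt_mult_self abs_of_nonneg)
  finally have dev: "\<bar>a - ?m * q\<bar> \<le> 2 * sqrt \<eta> * ?m" .
  have "b - exp t * a = - ((1 + exp t) * (a - ?m * q))"
    using e by (simp add: q_def field_simps)
  then have "\<bar>b - exp t * a\<bar> = (1 + exp t) * \<bar>a - ?m * q\<bar>" using e by (simp add: abs_mult)
  also have "\<dots> \<le> (1 + exp t) * (2 * sqrt \<eta> * ?m)" using dev e by (intro mult_left_mono) auto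
  finally show ?thesis by (simp add: mult.assoc)
qed

section \<open>Resampling a configuration\<close>

text \<open>\<open>D\<close> is kept abstract: the condition on \<open>W\<close> makes the windows
  at chosen sites disjoint, and the differences of a further finite set are added when
  \<open>D\<close> is finally chosen. As \<open>active\<close> forbids marks at
  \<open>g \<otimes> d\<close>, the identity must be excluded.\<close>

locale resampling = subshift_system G A X
  for G :: "('g, 'm) monoid_scheme" (structure) and A :: "'a set" and X :: "('g \<Rightarrow> 'a) set" +
  fixes W :: "'g set" and w w' :: "'g \<Rightarrow> 'a" and D :: "'g set"
  assumes inter: "interchangeable W w w'" and distinct: "w \<noteq> w'"
    and finite_D: "finite D" and D_carrier: "D \<subseteq> carrier G" and one_notin_D: "\<one> \<notin> D"
    and D_separates: "\<And>k k'. k \<in> W \<Longrightarrow> k' \<in> W \<Longrightarrow> k \<noteq> k' \<Longrightarrow> k \<otimes> inv k' \<in> D"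
begin

lemma finite_W: "finite W" and W_carrier: "W \<subseteq> carrier G"
  and w_PiE: "w \<in> W \<rightarrow>\<^sub>E A" and w'_PiE: "w' \<in> W \<rightarrow>\<^sub>E A"
  using inter by (auto simp: interchangeable_def)

lemma W_in: "k \<in> W \<Longrightarrow> k \<in> carrier G"
  using W_carrier by auto

text \<open>With the patterns coded by booleans, Bernoulli variables serve directly as choices;
  \<open>True\<close> will have probability \<open>q\<close>.\<close>

definition pat :: "bool \<Rightarrow> 'g \<Rightarrow> 'a" where
  "pat b = (if b then w else w')"

lemma pat_PiE: "pat b \<in> W \<rightarrow>\<^sub>E A"
  using w_PiE w'_PiE by (simp add: pat_def)

lemma pat_in_A: "k \<in> W \<Longrightarrow> pat b k \<in> A"
  using pat_PiE by auto

lemma pat_ext: "pat b \<in> extensional W"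
  using pat_PiE[of b] by (auto simp: PiE_def)

definition shows_pat :: "bool \<Rightarrow> 'g \<Rightarrow> ('g \<Rightarrow> 'a) \<Rightarrow> bool" where
  "shows_pat b g x \<longleftrightarrow> (\<forall>k\<in>W. x (g \<otimes> k) = pat b k)"

definition hit :: "'g \<Rightarrow> ('g \<Rightarrow> 'a) \<Rightarrow> bool" where
  "hit g x \<longleftrightarrow> (\<exists>b. shows_pat b g x)"

lemma shows_pat_unique: "shows_pat b g x \<Longrightarrow> shows_pat b' g x \<Longrightarrow> b = b'"
proof (rule ccontr)
  assume *: "shows_pat b g x" "shows_pat b' g x" "b \<noteq> b'"
  then have "\<forall>k\<in>W. w k = w' k" unfolding shows_pat_def by (cases b; cases b') (simp_all add: pat_def)
  then have "w = w'" using pat_ext[of True] pat_ext[of False] by (intro extensionalityI[of w W]) (simp_all add: pat_def)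
  then show False using distinct by simp
qed

lemma shows_pat_shift: "h \<in> carrier G \<Longrightarrow> g \<in> carrier G \<Longrightarrow> shows_pat b g (shift G h x) \<longleftrightarrow> shows_pat b (h \<otimes> g) x"
  unfolding shows_pat_def by (auto simp: W_in m_assoc)

lemma hit_shift: "h \<in> carrier G \<Longrightarrow> g \<in> carrier G \<Longrightarrow> hit g (shift G h x) \<longleftrightarrow> hit (h \<otimes> g) x"
  unfolding hit_def by (simp add: shows_pat_shift)

lemma shows_pat_cyl: "g \<in> carrier G \<Longrightarrow> x \<in> X \<Longrightarrow> shows_pat b g x \<longleftrightarrow> shift G g x \<in> cyl W (pat b)"
  unfolding shows_pat_def cyl_def by (auto simp: shift_X restrict_eq_iff[OF pat_ext] W_in)

definition separated :: "'g set \<Rightarrow> bool" where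
  "separated T \<longleftrightarrow> T \<subseteq> carrier G \<and> (\<forall>g\<in>T. \<forall>g'\<in>T. \<forall>h. h \<in> translate g W \<longrightarrow> h \<in> translate g' W \<longrightarrow> g = g')"

lemma separated_carrier: "separated T \<Longrightarrow> g \<in> T \<Longrightarrow> g \<in> carrier G"
  by (auto simp: separated_def)

lemma separatedD:
  "separated T \<Longrightarrow> g \<in> T \<Longrightarrow> g' \<in> T \<Longrightarrow> h \<in> translate g W \<Longrightarrow> h \<in> translate g' W \<Longrightarrow> g = g'"
  unfolding separated_def by blast

lemma separatedI:
  "T \<subseteq> carrier G \<Longrightarrow> (\<And>g g' h. g \<in> T \<Longrightarrow> g' \<in> T \<Longrightarrow> h \<in> translate g W \<Longrightarrow> h \<in> translate g' W \<Longrightarrow> g = g') \<Longrightarrow> separated T"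
  unfolding separated_def by blast

lemma separated_subset: "separated T \<Longrightarrow> S \<subseteq> T \<Longrightarrow> separated S"
  by (rule separatedI) (use separatedD separated_carrier in blast)+

definition site :: "'g set \<Rightarrow> 'g \<Rightarrow> 'g" where
  "site T h = (THE g. g \<in> T \<and> h \<in> translate g W)"

lemma site_eq: "separated T \<Longrightarrow> g \<in> T \<Longrightarrow> h \<in> translate g W \<Longrightarrow> site T h = g"
  unfolding site_def by (rule the_equality) (use separatedD in blast)+

text \<open>Whether a site shows one of the two patterns is read off the original \<open>x\<close>,
  so infinitely many sites can be treated at once. For separated sites this agrees with successive
  patching.\<close>

definition set_sites :: "'g set \<Rightarrow> ('g \<Rightarrow> bool) \<Rightarrow> ('g \<Rightarrow> 'a) \<Rightarrow> 'g \<Rightarrow> 'a" where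
  "set_sites T c x = (\<lambda>h. if (\<exists>g\<in>T. h \<in> translate g W) \<and> hit (site T h) x
     then pat (c (site T h)) (inv (site T h) \<otimes> h) else x h)"

lemma set_sites_in:
  "separated T \<Longrightarrow> g \<in> T \<Longrightarrow> h \<in> translate g W \<Longrightarrow>
    set_sites T c x h = (if hit g x then pat (c g) (inv g \<otimes> h) else x h)"
  unfolding set_sites_def using site_eq by auto

lemma set_sites_out: "(\<And>g. g \<in> T \<Longrightarrow> h \<notin> translate g W) \<Longrightarrow> set_sites T c x h = x h"
  unfolding set_sites_def by auto

lemma translate_carrier: "g \<in> carrier G \<Longrightarrow> translate g W \<subseteq> carrier G"
  using W_in by (auto simp: translate_def)

lemma set_sites_empty: "set_sites {} c x = x"
  by (auto simp: set_sites_def)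

definition patch_site :: "'g \<Rightarrow> bool \<Rightarrow> ('g \<Rightarrow> 'a) \<Rightarrow> 'g \<Rightarrow> 'a" where
  "patch_site g b x = (\<lambda>h. if h \<in> translate g W then pat b (inv g \<otimes> h) else x h)"

text \<open>Interchangeability is stated at the identity, so the configuration is shifted by
  \<open>g\<close>, patched, and shifted back.\<close>

lemma patch_site_X:
  assumes g: "g \<in> carrier G" and x: "x \<in> X" and hit: "hit g x"
  shows "patch_site g b x \<in> X"
proof -
  let ?y = "shift G g x"
  have y: "?y \<in> X" using g x by (rule shift_X)
  obtain b' where b': "shows_pat b' g x" using hit by (auto simp: hit_def)
  then have yc: "?y \<in> cyl W (pat b')" using shows_pat_cyl[OF g x] by simp
  have "patch W (pat b) ?y \<in> X"
  proof (cases "b = b'")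
    case True
    have "patch W (pat b) ?y = ?y"
      using yc True unfolding cyl_def patch_def by (auto simp: restrict_eq_iff[OF pat_ext])
    then show ?thesis using y by simp
  next
    case False
    then show ?thesis using inter yc unfolding interchangeable_def by (cases b) (auto simp: pat_def)
  qed
  then have "shift G (inv g) (patch W (pat b) ?y) \<in> X" using g by (intro shift_X) auto
  also have "shift G (inv g) (patch W (pat b) ?y) = patch_site g b x"
  proof (rule extensionalityI[of _ "carrier G"])
    show "shift G (inv g) (patch W (pat b) ?y) \<in> extensional (carrier G)" by (simp add: shift_def)
    show "patch_site g b x \<in> extensional (carrier G)"
      using X_ext[OF x] translate_carrier[OF g] by (auto simp: patch_site_def extensional_def)
    fix h assume h: "h \<in> carrier G"
    then have "h \<in> translate g W \<longleftrightarrow> inv g \<otimes> h \<in> W" using translate_iff[OF g W_carrier] by simp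
    then show "shift G (inv g) (patch W (pat b) ?y) h = patch_site g b x h"
      using h g by (simp add: patch_def patch_site_def m_assoc[symmetric])
  qed
  finally show ?thesis .
qed

lemma set_sites_cong_hit:
  assumes T: "separated (insert g T)" and g: "g \<notin> T"
  shows "shows_pat b g (set_sites T c x) \<longleftrightarrow> shows_pat b g x"
proof -
  have "set_sites T c x (g \<otimes> k) = x (g \<otimes> k)" if "k \<in> W" for k
  proof (rule set_sites_out)
    fix g' assume "g' \<in> T"
    moreover have "g \<otimes> k \<in> translate g W" using that by (auto simp: translate_def)
    ultimately show "g \<otimes> k \<notin> translate g' W" using separatedD[OF T, of g g'] g by blast
  qed
  then show ?thesis unfolding shows_pat_def by simp
qed

text \<open>Windows of separated sites are disjoint, so the other sites do not affect what
  \<open>g\<close> shows. This is the inductive step both for membership in \<open>X\<close> and for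
  the entropy gain.\<close>

lemma set_sites_insert:
  assumes T: "separated (insert g T)" and g: "g \<notin> T"
  shows "set_sites (insert g T) c x = (if hit g x then patch_site g (c g) (set_sites T c x) else set_sites T c x)"
proof
  fix h
  have T': "separated T" by (rule separated_subset[OF T]) blast
  show "set_sites (insert g T) c x h = (if hit g x then patch_site g (c g) (set_sites T c x) else set_sites T c x) h"
  proof (cases "h \<in> translate g W")
    case True
    then have "h \<notin> translate g' W" if "g' \<in> T" for g'
      using separatedD[OF T, of g g'] g that True by blast
    then have "set_sites T c x h = x h" by (rule set_sites_out)
    then show ?thesis using set_sites_in[OF T _ True] True by (simp add: patch_site_def)
  next
    case nin: False
    show ?thesis
    proof (cases "\<exists>g'\<in>T. h \<in> translate g' W")
      case True
      then obtain g' where g': "g' \<in> T" "h \<in> translate g' W" by blast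
      then have "set_sites (insert g T) c x h = set_sites T c x h"
        using set_sites_in[OF T _ g'(2)] set_sites_in[OF T' g'] by simp
      then show ?thesis using nin by (simp add: patch_site_def)
    next
      case False
      then have "set_sites (insert g T) c x h = x h" "set_sites T c x h = x h"
        using nin by (auto intro!: set_sites_out)
      then show ?thesis using nin by (simp add: patch_site_def)
    qed
  qed
qed

lemma set_sites_finite_X: "finite T \<Longrightarrow> separated T \<Longrightarrow> x \<in> X \<Longrightarrow> set_sites T c x \<in> X"
proof (induction T rule: finite_induct)
  case (insert g T)
  then have y: "set_sites T c x \<in> X" using separated_subset by blast
  have g: "g \<in> carrier G" using insert.prems(1) by (simp add: separated_def)
  have "hit g (set_sites T c x) \<longleftrightarrow> hit g x"
    unfolding hit_def using set_sites_cong_hit[OF insert.prems(1) insert.hyps(2)] by simp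
  then show ?case
    using patch_site_X[OF g y] y by (simp add: set_sites_insert[OF insert.prems(1) insert.hyps(2)])
qed (simp add: set_sites_empty)

definition sites_near :: "'g \<Rightarrow> 'g set" where
  "sites_near h = (\<lambda>k. h \<otimes> inv k) ` W"

lemma finite_sites_near: "finite (sites_near h)"
  by (simp add: sites_near_def finite_W)

lemma sites_near_iff: "g \<in> carrier G \<Longrightarrow> h \<in> carrier G \<Longrightarrow> h \<in> translate g W \<longleftrightarrow> g \<in> sites_near h"
proof
  assume *: "g \<in> carrier G" "h \<in> carrier G"
  { assume "h \<in> translate g W"
    then obtain k where "k \<in> W" "h = g \<otimes> k" by (auto simp: translate_def)
    then show "g \<in> sites_near h" using * W_in
      by (auto simp: sites_near_def m_assoc intro!: image_eqI[of _ _ k]) }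
  { assume "g \<in> sites_near h"
    then obtain k where "k \<in> W" "g = h \<otimes> inv k" by (auto simp: sites_near_def)
    then show "h \<in> translate g W" using * W_in
      by (auto simp: translate_def m_assoc intro!: image_eqI[of _ _ k]) }
qed

lemma set_sites_local:
  assumes T: "separated T" and S: "separated S" and h: "h \<in> carrier G"
    and eq: "T \<inter> sites_near h = S \<inter> sites_near h" and c: "\<And>g. g \<in> T \<Longrightarrow> c g = c' g"
  shows "set_sites T c x h = set_sites S c' x h"
proof (cases "\<exists>g\<in>T. h \<in> translate g W")
  case True
  then obtain g where g: "g \<in> T" "h \<in> translate g W" by blast
  then have gc: "g \<in> carrier G" using T by (auto simp: separated_def)
  then have "g \<in> S" using eq g sites_near_iff[OF gc h] by blast
  then show ?thesis using set_sites_in[OF T g] set_sites_in[OF S \<open>g \<in> S\<close> g(2)] c[OF g(1)] by simp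
next
  case False
  have "h \<notin> translate g W" if "g \<in> S" for g
  proof
    assume "h \<in> translate g W"
    moreover have "g \<in> carrier G" using S that by (auto simp: separated_def)
    ultimately have "g \<in> T" using eq that sites_near_iff[OF _ h, of g] by blast
    then show False using False \<open>h \<in> translate g W\<close> by blast
  qed
  then show ?thesis using False by (simp add: set_sites_out)
qed

text \<open>A finite window sees only the finitely many sites near it, for which the claim is known;
  closedness of \<open>X\<close> does the rest.\<close>

lemma set_sites_X:
  assumes T: "separated T" and x: "x \<in> X"
  shows "set_sites T c x \<in> X"
proof (rule closed_X)
  have approx: "\<exists>y\<in>X. \<forall>h\<in>L. y h = set_sites T c x h" if L: "finite L" "L \<subseteq> carrier G" for L
  proof (intro bexI ballI)
    let ?S = "T \<inter> (\<Union>h\<in>L. sites_near h)"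
    have S: "separated ?S" by (rule separated_subset[OF T]) blast
    show "set_sites ?S c x \<in> X"
      using L finite_sites_near by (intro set_sites_finite_X S x) auto
    fix h assume "h \<in> L"
    then show "set_sites ?S c x h = set_sites T c x h"
      using L by (intro set_sites_local S T) auto
  qed
  show "set_sites T c x \<in> carrier G \<rightarrow>\<^sub>E A"
  proof (rule PiE_I)
    fix h assume h: "h \<in> carrier G"
    then obtain y where "y \<in> X" "y h = set_sites T c x h" using approx[of "{h}"] by auto
    then show "set_sites T c x h \<in> A" using X_in[of y h] h by simp
  next
    fix h assume h: "h \<notin> carrier G"
    have "set_sites T c x h = x h"
      using T h translate_carrier by (intro set_sites_out) (auto simp: separated_def)
    then show "set_sites T c x h = undefined" using X_ext[OF x] h by (simp add: extensional_def)
  qed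
  fix L :: "'g set" assume "finite L" "L \<subseteq> carrier G"
  then obtain y where "y \<in> X" "\<forall>h\<in>L. y h = set_sites T c x h" using approx by blast
  then show "\<exists>y\<in>X. restrict y L = restrict (set_sites T c x) L" by (auto intro!: bexI[of _ y] restrict_ext)
qed

text \<open>Equivariance under the joint shift of configuration, sites and choices, which makes the
  resampled measure invariant.\<close>

lemma set_sites_shift:
  assumes T: "separated T" and h: "h \<in> carrier G" and x: "x \<in> X"
  shows "shift G h (set_sites T c x) = set_sites {g\<in>carrier G. h \<otimes> g \<in> T} (\<lambda>g. c (h \<otimes> g)) (shift G h x)"
    and "separated {g\<in>carrier G. h \<otimes> g \<in> T}"
proof -
  let ?S = "{g\<in>carrier G. h \<otimes> g \<in> T}"
  have tr: "h \<otimes> f \<in> translate (h \<otimes> g) W \<longleftrightarrow> f \<in> translate g W" if "g \<in> carrier G" "f \<in> carrier G" for f g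
    using that h by (simp add: translate_iff W_carrier inv_mult_group m_assoc) (simp add: m_assoc[symmetric])
  show S: "separated ?S"
  proof (rule separatedI)
    fix g g' f assume g: "g \<in> ?S" "g' \<in> ?S" and f: "f \<in> translate g W" "f \<in> translate g' W"
    then have "f \<in> carrier G" using translate_carrier by auto
    then have "h \<otimes> f \<in> translate (h \<otimes> g) W" "h \<otimes> f \<in> translate (h \<otimes> g') W" using f g tr by auto
    then have "h \<otimes> g = h \<otimes> g'" using separatedD[OF T] g by blast
    then show "g = g'" using g h by simp
  qed auto
  show "shift G h (set_sites T c x) = set_sites ?S (\<lambda>g. c (h \<otimes> g)) (shift G h x)"
  proof (rule X_eqI)
    show "shift G h (set_sites T c x) \<in> X" by (intro shift_X h set_sites_X T x)
    show "set_sites ?S (\<lambda>g. c (h \<otimes> g)) (shift G h x) \<in> X" by (intro set_sites_X S shift_X h x)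
    fix f assume f: "f \<in> carrier G"
    show "shift G h (set_sites T c x) f = set_sites ?S (\<lambda>g. c (h \<otimes> g)) (shift G h x) f"
    proof (cases "\<exists>g\<in>?S. f \<in> translate g W")
      case True
      then obtain g where g: "g \<in> ?S" "f \<in> translate g W" by blast
      then have "h \<otimes> g \<in> T" "h \<otimes> f \<in> translate (h \<otimes> g) W" using tr f by auto
      then show ?thesis
        using set_sites_in[OF S g] set_sites_in[OF T, of "h \<otimes> g" "h \<otimes> f"] g f h
        by (simp add: hit_shift inv_mult_group m_assoc) (simp add: m_assoc[symmetric])
    next
      case False
      have "h \<otimes> f \<notin> translate g W" if "g \<in> T" for g
      proof
        assume *: "h \<otimes> f \<in> translate g W"
        have g: "g \<in> carrier G" using T that by (auto simp: separated_def)
        then have "g = h \<otimes> (inv h \<otimes> g)" using h by (simp add: m_assoc[symmetric])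
        then have "inv h \<otimes> g \<in> ?S" "f \<in> translate (inv h \<otimes> g) W"
          using that h g f * tr[of "inv h \<otimes> g" f] by auto
        then show False using False by blast
      qed
      then have "set_sites T c x (h \<otimes> f) = x (h \<otimes> f)" by (rule set_sites_out)
      moreover have "set_sites ?S (\<lambda>g. c (h \<otimes> g)) (shift G h x) f = shift G h x f"
        using False by (intro set_sites_out) auto
      ultimately show ?thesis using f by simp
    qed
  qed
qed

text \<open>A local thinning rule that commutes with the shifts: a marked site survives if no site
  of \<open>g D\<close> is marked. Applied to independent marks, it yields an invariant random set
  of sites of positive density. \<open>D\<close> need not be symmetric, since of two survivors
  neither may forbid the other.\<close>

definition active :: "('g \<Rightarrow> bool) \<Rightarrow> 'g set" where
  "active e = {g\<in>carrier G. e g \<and> (\<forall>d\<in>D. \<not> e (g \<otimes> d))}"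

lemma active_separation: "g \<in> active e \<Longrightarrow> g' \<in> active e \<Longrightarrow> g \<noteq> g' \<Longrightarrow> inv g \<otimes> g' \<notin> D"
proof
  assume *: "g \<in> active e" "g' \<in> active e" "inv g \<otimes> g' \<in> D"
  then have "\<not> e (g \<otimes> (inv g \<otimes> g'))" "g \<in> carrier G" "g' \<in> carrier G" by (auto simp: active_def)
  then have "\<not> e g'" by (simp add: m_assoc[symmetric])
  then show False using * by (simp add: active_def)
qed

lemma separated_active: "separated (active e)"
proof (rule separatedI)
  show "active e \<subseteq> carrier G" by (auto simp: active_def)
  fix g g' h assume g: "g \<in> active e" "g' \<in> active e" and h: "h \<in> translate g W" "h \<in> translate g' W"
  then have gc: "g \<in> carrier G" "g' \<in> carrier G" by (auto simp: active_def)
  obtain k k' where k: "k \<in> W" "k' \<in> W" "g \<otimes> k = g' \<otimes> k'" using h by (auto simp: translate_def)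
  then have kc: "k \<in> carrier G" "k' \<in> carrier G" using W_in by auto
  have "g' = g' \<otimes> k' \<otimes> inv k'" using gc kc by (simp add: m_assoc)
  also have "\<dots> = g \<otimes> k \<otimes> inv k'" using k(3) by simp
  finally have g': "g' = g \<otimes> k \<otimes> inv k'" .
  have "inv g \<otimes> (g \<otimes> k \<otimes> inv k') = k \<otimes> inv k'" using gc kc by (simp add: m_assoc[symmetric])
  then have eq: "inv g \<otimes> g' = k \<otimes> inv k'" using g' by simp
  show "g = g'"
  proof (rule ccontr)
    assume ne: "g \<noteq> g'"
    have "k \<noteq> k'" using k(3) ne gc kc by auto
    then show False using D_separates[OF k(1,2)] active_separation[OF g ne] eq by simp
  qed
qed

lemma active_shift: "h \<in> carrier G \<Longrightarrow> active (shift G h e) = {g\<in>carrier G. h \<otimes> g \<in> active e}"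
  using D_carrier by (auto simp: active_def m_assoc subset_iff)

definition resample :: "('g \<Rightarrow> 'a) \<times> ('g \<Rightarrow> bool) \<times> ('g \<Rightarrow> bool) \<Rightarrow> 'g \<Rightarrow> 'a" where
  "resample = (\<lambda>(x, e, c). set_sites (active e) c x)"

lemma resample_X: "x \<in> X \<Longrightarrow> resample (x, e, c) \<in> X"
  unfolding resample_def by (simp add: set_sites_X separated_active)

lemma set_sites_cong_choice:
  "separated T \<Longrightarrow> (\<And>g. g \<in> T \<Longrightarrow> c g = c' g) \<Longrightarrow> set_sites T c x = set_sites T c' x"
proof
  fix h assume T: "separated T" and c: "\<And>g. g \<in> T \<Longrightarrow> c g = c' g"
  show "set_sites T c x h = set_sites T c' x h"
    by (cases "\<exists>g\<in>T. h \<in> translate g W") (auto simp: set_sites_in[OF T] set_sites_out c)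
qed

lemma resample_shift:
  assumes h: "h \<in> carrier G" and x: "x \<in> X"
  shows "resample (shift G h x, shift G h e, shift G h c) = shift G h (resample (x, e, c))"
proof -
  let ?S = "{g \<in> carrier G. h \<otimes> g \<in> active e}"
  have "set_sites ?S (shift G h c) (shift G h x) = set_sites ?S (\<lambda>g. c (h \<otimes> g)) (shift G h x)"
    by (rule set_sites_cong_choice[OF set_sites_shift(2)[OF separated_active h x]]) simp
  also have "\<dots> = shift G h (set_sites (active e) c x)"
    by (rule set_sites_shift(1)[OF separated_active h x, symmetric])
  finally show ?thesis by (simp add: resample_def active_shift[OF h])
qed

end

section \<open>The resampled measure\<close>

lemma (in prob_space) measure_pair_Times:
  assumes "prob_space N" "S \<in> sets M" "T \<in> sets N"
  shows "measure (M \<Otimes>\<^sub>M N) (S \<times> T) = measure M S * measure N T"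
proof -
  interpret N: prob_space N by fact
  show ?thesis
    using N.emeasure_pair_measure_Times[OF assms(2,3)] by (simp add: measure_def enn2real_mult)
qed

locale resampling_measure = subshift_measure G A X \<mu> + resampling G A X W w w' D
  for G :: "('g, 'm) monoid_scheme" (structure) and A :: "'a set" and X :: "('g \<Rightarrow> 'a) set"
    and \<mu> :: "('g \<Rightarrow> 'a) measure" and W :: "'g set" and w w' :: "'g \<Rightarrow> 'a" and D :: "'g set" +
  fixes q :: real
  assumes q: "0 \<le> q" "q \<le> 1"
begin

definition sitesM :: "('g \<Rightarrow> bool) measure" where
  "sitesM = PiM (carrier G) (\<lambda>_. measure_pmf (bernoulli_pmf (1/2)))"

definition choiceM :: "('g \<Rightarrow> bool) measure" where
  "choiceM = PiM (carrier G) (\<lambda>_. measure_pmf (bernoulli_pmf q))"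

definition jointM :: "(('g \<Rightarrow> 'a) \<times> ('g \<Rightarrow> bool) \<times> ('g \<Rightarrow> bool)) measure" where
  "jointM = \<mu> \<Otimes>\<^sub>M (sitesM \<Otimes>\<^sub>M choiceM)"

definition resampled :: "('g \<Rightarrow> 'a) measure" where
  "resampled = distr jointM \<mu> resample"

lemma prob_space_sites: "prob_space sitesM" and prob_space_choice: "prob_space choiceM"
  unfolding sitesM_def choiceM_def by (intro prob_space_PiM prob_space_measure_pmf)+

lemma prob_space_sites_choice: "prob_space (sitesM \<Otimes>\<^sub>M choiceM)"
  by (intro prob_space_pair prob_space_sites prob_space_choice)

lemma prob_space_joint: "prob_space jointM"
  unfolding jointM_def by (intro prob_space_pair prob_space_axioms prob_space_sites_choice)

lemma space_sites: "space sitesM = (carrier G \<rightarrow>\<^sub>E UNIV)" and space_choice: "space choiceM = (carrier G \<rightarrow>\<^sub>E UNIV)"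
  by (simp_all add: sitesM_def choiceM_def space_PiM)

lemma space_joint: "space jointM = X \<times> (carrier G \<rightarrow>\<^sub>E UNIV) \<times> (carrier G \<rightarrow>\<^sub>E UNIV)"
  by (simp add: jointM_def space_pair_measure space_sites space_choice space_mu)

lemma coordinate_PiM_pmf:
  "g \<in> carrier G \<Longrightarrow> (\<lambda>e. e g) \<in> measurable (PiM (carrier G) (\<lambda>_. measure_pmf P)) (count_space UNIV)"
proof -
  assume "g \<in> carrier G"
  then have "(\<lambda>e. e g) \<in> measurable (PiM (carrier G) (\<lambda>_. measure_pmf P)) (measure_pmf P)"
    by (rule measurable_component_singleton)
  then show ?thesis by (simp cong: measurable_cong_sets)
qed

lemma coordinate_measurable: "h \<in> carrier G \<Longrightarrow> (\<lambda>x. x h) \<in> measurable \<mu> (count_space UNIV)"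
  using simple_coordinate[of h] by (rule measurable_simple_function)

lemma joint_x: "h \<in> carrier G \<Longrightarrow> (\<lambda>\<omega>. fst \<omega> h) \<in> measurable jointM (count_space UNIV)"
  unfolding jointM_def by (rule measurable_compose[OF measurable_fst coordinate_measurable])

lemma joint_e: "h \<in> carrier G \<Longrightarrow> (\<lambda>\<omega>. fst (snd \<omega>) h) \<in> measurable jointM (count_space UNIV)"
  unfolding jointM_def sitesM_def
  by (rule measurable_compose[OF measurable_compose[OF measurable_snd measurable_fst] coordinate_PiM_pmf])

lemma joint_c: "h \<in> carrier G \<Longrightarrow> (\<lambda>\<omega>. snd (snd \<omega>) h) \<in> measurable jointM (count_space UNIV)"
  unfolding jointM_def choiceM_def
  by (rule measurable_compose[OF measurable_compose[OF measurable_snd measurable_snd] coordinate_PiM_pmf])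

lemma pred_of: "f \<in> measurable M (count_space UNIV) \<Longrightarrow> Measurable.pred M (\<lambda>\<omega>. P (f \<omega>))"
  by (rule measurable_compose[of f M "count_space UNIV"]) simp_all

lemma pred_active: "g \<in> carrier G \<Longrightarrow> Measurable.pred jointM (\<lambda>\<omega>. g \<in> active (fst (snd \<omega>)))"
proof -
  assume g: "g \<in> carrier G"
  have "Measurable.pred jointM (\<lambda>\<omega>. fst (snd \<omega>) g \<and> (\<forall>d\<in>D. \<not> fst (snd \<omega>) (g \<otimes> d)))"
    by (intro pred_intros_logic pred_intros_finite finite_D joint_e)
      (use g D_carrier in auto)
  then show ?thesis using g by (simp add: active_def)
qed

lemma pred_shows_pat: "g \<in> carrier G \<Longrightarrow> Measurable.pred jointM (\<lambda>\<omega>. shows_pat b g (fst \<omega>))"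
proof -
  assume g: "g \<in> carrier G"
  have "Measurable.pred jointM (\<lambda>\<omega>. fst \<omega> (g \<otimes> k) = pat b k)" if "k \<in> W" for k
    using pred_of[OF joint_x, of "g \<otimes> k" "\<lambda>a. a = pat b k"] g W_in[OF that] by simp
  then show ?thesis unfolding shows_pat_def by (intro pred_intros_finite finite_W)
qed

lemma hit_iff: "hit g x \<longleftrightarrow> shows_pat True g x \<or> shows_pat False g x"
  unfolding hit_def using bool.exhaust by metis

lemma pred_hit: "g \<in> carrier G \<Longrightarrow> Measurable.pred jointM (\<lambda>\<omega>. hit g (fst \<omega>))"
  unfolding hit_iff by (intro pred_intros_logic pred_shows_pat)

lemma sites_near_carrier: "h \<in> carrier G \<Longrightarrow> g \<in> sites_near h \<Longrightarrow> g \<in> carrier G"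
  using W_in by (auto simp: sites_near_def)

text \<open>Even though infinitely many sites are resampled, the letter at \<open>h\<close> is
  decided by quantifiers over the finite set \<open>sites_near h\<close>; measurability follows from
  this form.\<close>

lemma resample_eq_iff:
  assumes h: "h \<in> carrier G"
  shows "resample (x, e, c) h = a \<longleftrightarrow>
    (\<exists>g\<in>sites_near h. g \<in> active e \<and> hit g x \<and> pat (c g) (inv g \<otimes> h) = a) \<or>
    ((\<forall>g\<in>sites_near h. \<not> (g \<in> active e \<and> hit g x)) \<and> x h = a)"
proof -
  note S = separated_active[of e]
  have near: "h \<in> translate g W \<longleftrightarrow> g \<in> sites_near h" if "g \<in> active e" for g
    using sites_near_iff[OF separated_carrier[OF S that] h] .
  show ?thesis
  proof (cases "\<exists>g\<in>active e. h \<in> translate g W")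
    case True
    then obtain g where g: "g \<in> active e" "h \<in> translate g W" by blast
    have uniq: "g' = g" if "g' \<in> active e" "g' \<in> sites_near h" for g'
      using separatedD[OF S that(1) g(1) _ g(2)] near[OF that(1)] that(2) by simp
    have eq: "resample (x, e, c) h = (if hit g x then pat (c g) (inv g \<otimes> h) else x h)"
      unfolding resample_def using set_sites_in[OF S g] by simp
    have gn: "g \<in> sites_near h" using near g by simp
    have ex: "(\<exists>g'\<in>sites_near h. g' \<in> active e \<and> hit g' x \<and> Q g') \<longleftrightarrow> hit g x \<and> Q g" for Q
      using uniq gn g(1) by metis
    have all: "(\<forall>g'\<in>sites_near h. \<not> (g' \<in> active e \<and> hit g' x)) \<longleftrightarrow> \<not> hit g x"
      using uniq gn g(1) by metis
    show ?thesis unfolding eq ex all by simp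
  next
    case False
    then have eq: "resample (x, e, c) h = x h" unfolding resample_def by (auto intro: set_sites_out)
    have none: "\<not> (g \<in> active e \<and> hit g x)" if "g \<in> sites_near h" for g
      using False near that by blast
    show ?thesis unfolding eq using none by blast
  qed
qed

lemma resample_measurable: "resample \<in> measurable jointM \<mu>"
proof (rule measurable_into_X[OF sets_mu])
  fix \<omega> assume "\<omega> \<in> space jointM"
  then show "resample \<omega> \<in> X" by (auto simp: space_joint resample_X)
next
  fix h a assume h: "h \<in> carrier G"
  have "resample \<omega> h = a \<longleftrightarrow>
    (\<exists>g\<in>sites_near h. g \<in> active (fst (snd \<omega>)) \<and> hit g (fst \<omega>) \<and> pat (snd (snd \<omega>) g) (inv g \<otimes> h) = a) \<or>
    ((\<forall>g\<in>sites_near h. \<not> (g \<in> active (fst (snd \<omega>)) \<and> hit g (fst \<omega>))) \<and> fst \<omega> h = a)" for \<omega>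
    using resample_eq_iff[OF h, of "fst \<omega>" "fst (snd \<omega>)" "snd (snd \<omega>)" a] by simp
  moreover have "Measurable.pred jointM (\<lambda>\<omega>.
    (\<exists>g\<in>sites_near h. g \<in> active (fst (snd \<omega>)) \<and> hit g (fst \<omega>) \<and> pat (snd (snd \<omega>) g) (inv g \<otimes> h) = a) \<or>
    ((\<forall>g\<in>sites_near h. \<not> (g \<in> active (fst (snd \<omega>)) \<and> hit g (fst \<omega>))) \<and> fst \<omega> h = a))"
  proof -
    have c: "Measurable.pred jointM (\<lambda>\<omega>. pat (snd (snd \<omega>) g) (inv g \<otimes> h) = a)" if "g \<in> carrier G" for g
      using pred_of[OF joint_c[OF that], of "\<lambda>b. pat b (inv g \<otimes> h) = a"] .
    have xh: "Measurable.pred jointM (\<lambda>\<omega>. fst \<omega> h = a)"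
      using pred_of[OF joint_x[OF h], of "\<lambda>b. b = a"] .
    show ?thesis
      by (intro pred_intros_logic pred_intros_finite finite_sites_near pred_active pred_hit c xh
          sites_near_carrier[OF h])
  qed
  ultimately have "Measurable.pred jointM (\<lambda>\<omega>. resample \<omega> h = a)" by simp
  then show "{\<omega> \<in> space jointM. resample \<omega> h = a} \<in> sets jointM" by (simp add: pred_def)
qed

lemma shift_PiM_pmf:
  assumes h: "h \<in> carrier G"
  shows "distr (PiM (carrier G) (\<lambda>_. measure_pmf P)) (PiM (carrier G) (\<lambda>_. measure_pmf P)) (shift G h) = PiM (carrier G) (\<lambda>_. measure_pmf P)"
    and "shift G h \<in> measurable (PiM (carrier G) (\<lambda>_. measure_pmf P)) (PiM (carrier G) (\<lambda>_. measure_pmf P))"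
proof -
  have eq: "(\<lambda>\<omega>. \<lambda>n\<in>carrier G. \<omega> (h \<otimes> n)) = shift G h" by (simp add: shift_def fun_eq_iff)
  show "distr (PiM (carrier G) (\<lambda>_. measure_pmf P)) (PiM (carrier G) (\<lambda>_. measure_pmf P)) (shift G h) = PiM (carrier G) (\<lambda>_. measure_pmf P)"
    unfolding eq[symmetric]
    by (rule distr_PiM_reindex) (use h in \<open>auto simp: prob_space_measure_pmf inj_on_def\<close>)
  show "shift G h \<in> measurable (PiM (carrier G) (\<lambda>_. measure_pmf P)) (PiM (carrier G) (\<lambda>_. measure_pmf P))"
    unfolding shift_def using h by (intro measurable_restrict measurable_component_singleton) auto
qed

definition joint_shift :: "'g \<Rightarrow> ('g \<Rightarrow> 'a) \<times> ('g \<Rightarrow> bool) \<times> ('g \<Rightarrow> bool) \<Rightarrow> ('g \<Rightarrow> 'a) \<times> ('g \<Rightarrow> bool) \<times> ('g \<Rightarrow> bool)" where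
  "joint_shift h = (\<lambda>(x, e, c). (shift G h x, shift G h e, shift G h c))"

lemma joint_shift_measurable: "h \<in> carrier G \<Longrightarrow> joint_shift h \<in> measurable jointM jointM"
proof -
  assume h: "h \<in> carrier G"
  have e: "shift G h \<in> measurable sitesM sitesM" and c: "shift G h \<in> measurable choiceM choiceM"
    unfolding sitesM_def choiceM_def by (rule shift_PiM_pmf(2)[OF h])+
  have "(\<lambda>\<omega>. (shift G h (fst \<omega>), shift G h (fst (snd \<omega>)), shift G h (snd (snd \<omega>)))) \<in> measurable jointM jointM"
    unfolding jointM_def
    by (intro measurable_Pair measurable_compose[OF measurable_fst shift_measurable[OF h]]
        measurable_compose[OF measurable_compose[OF measurable_snd measurable_fst] e]
        measurable_compose[OF measurable_compose[OF measurable_snd measurable_snd] c])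
  then show ?thesis by (simp add: joint_shift_def case_prod_beta')
qed

lemma joint_invariant:
  assumes h: "h \<in> carrier G"
  shows "distr jointM jointM (joint_shift h) = jointM"
proof -
  have me: "shift G h \<in> measurable sitesM sitesM" and mc: "shift G h \<in> measurable choiceM choiceM"
    and de: "distr sitesM sitesM (shift G h) = sitesM" and dc: "distr choiceM choiceM (shift G h) = choiceM"
    unfolding sitesM_def choiceM_def by (rule shift_PiM_pmf[OF h])+
  interpret C: prob_space choiceM by (rule prob_space_choice)
  interpret EC: prob_space "sitesM \<Otimes>\<^sub>M choiceM" by (rule prob_space_sites_choice)
  let ?sec = "\<lambda>(e, c). (shift G h e, shift G h c)"
  have ec: "distr (sitesM \<Otimes>\<^sub>M choiceM) (sitesM \<Otimes>\<^sub>M choiceM) ?sec = sitesM \<Otimes>\<^sub>M choiceM"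
    using pair_measure_distr[OF me mc] C.sigma_finite_measure_axioms by (simp add: de dc)
  have mec: "?sec \<in> measurable (sitesM \<Otimes>\<^sub>M choiceM) (sitesM \<Otimes>\<^sub>M choiceM)"
    using me mc by measurable
  have "distr (\<mu> \<Otimes>\<^sub>M (sitesM \<Otimes>\<^sub>M choiceM)) (\<mu> \<Otimes>\<^sub>M (sitesM \<Otimes>\<^sub>M choiceM)) (\<lambda>(x, p). (shift G h x, ?sec p)) = \<mu> \<Otimes>\<^sub>M (sitesM \<Otimes>\<^sub>M choiceM)"
    using pair_measure_distr[OF shift_measurable[OF h] mec] EC.sigma_finite_measure_axioms
    by (simp add: ec invariant[OF h])
  moreover have "(\<lambda>(x, p). (shift G h x, ?sec p)) = joint_shift h"
    by (auto simp: joint_shift_def fun_eq_iff)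
  ultimately show ?thesis by (simp add: jointM_def)
qed

lemma resample_joint_shift:
  "h \<in> carrier G \<Longrightarrow> \<omega> \<in> space jointM \<Longrightarrow> resample (joint_shift h \<omega>) = shift G h (resample \<omega>)"
  by (auto simp: joint_shift_def space_joint resample_shift)

lemma sets_resampled: "sets resampled = sets \<mu>" and space_resampled: "space resampled = X"
  by (simp_all add: resampled_def space_mu)

text \<open>An equivariant measurable image of an invariant measure is invariant;
  \<open>resample\<close> intertwines \<open>joint_shift\<close> with the shift.\<close>

lemma resampled_measure: "subshift_measure G A X resampled"
proof (intro subshift_measure.intro subshift_measure_axioms.intro)
  show "subshift_system G A X" by unfold_locales
  show "prob_space resampled"
    unfolding resampled_def by (rule prob_space.prob_space_distr[OF prob_space_joint resample_measurable])
  show "sets resampled = sets (borel_of (subshift_topology G A X))" by (simp add: sets_resampled sets_mu)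
  fix h assume h: "h \<in> carrier G"
  have "distr resampled resampled (shift G h) = distr resampled \<mu> (shift G h)"
    by (rule distr_cong) (simp_all add: sets_resampled)
  also have "\<dots> = distr jointM \<mu> (shift G h \<circ> resample)"
    unfolding resampled_def by (rule distr_distr[OF shift_measurable[OF h] resample_measurable])
  also have "\<dots> = distr jointM \<mu> (resample \<circ> joint_shift h)"
    by (rule distr_cong) (simp_all add: resample_joint_shift[OF h])
  also have "\<dots> = distr (distr jointM jointM (joint_shift h)) \<mu> resample"
    by (rule distr_distr[OF resample_measurable joint_shift_measurable[OF h], symmetric])
  also have "\<dots> = resampled" by (simp add: joint_invariant[OF h] resampled_def)
  finally show "distr resampled resampled (shift G h) = resampled" .
qed

lemma shows_pat_patch_site: "g \<in> carrier G \<Longrightarrow> shows_pat b g (patch_site g b y)"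
  unfolding shows_pat_def patch_site_def translate_def using W_in by (simp add: m_assoc[symmetric])

lemma patch_site_eq:
  assumes g: "g \<in> carrier G" and y: "shows_pat b g y"
  shows "patch_site g b y = y"
proof
  fix h
  show "patch_site g b y h = y h"
  proof (cases "h \<in> translate g W")
    case True
    then obtain k where "k \<in> W" "h = g \<otimes> k" by (auto simp: translate_def)
    then show ?thesis using y g W_in by (simp add: patch_site_def shows_pat_def m_assoc[symmetric] translate_def)
  qed (simp add: patch_site_def)
qed

lemma patch_site_patch_site: "patch_site g b (patch_site g b' y) = patch_site g b y"
  by (auto simp: patch_site_def)

lemma finite_words: "finite L \<Longrightarrow> finite (L \<rightarrow>\<^sub>E A)"
  using finite_alphabet by (intro finite_PiE) auto

lemma restrict_word: "x \<in> X \<Longrightarrow> finite L \<Longrightarrow> L \<subseteq> carrier G \<Longrightarrow> restrict x L \<in> L \<rightarrow>\<^sub>E A"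
  using restrict_pattern[of x L] unfolding patterns_def by blast

section \<open>Entropy of the resampled measure\<close>

definition weight :: "bool \<Rightarrow> real" where
  "weight b = (if b then q else 1 - q)"

lemma weight_nonneg: "0 \<le> weight b"
  using q by (simp add: weight_def)

definition config_law :: "'g set \<Rightarrow> 'g set \<Rightarrow> ('g \<Rightarrow> bool) \<Rightarrow> ('g \<Rightarrow> 'a) \<Rightarrow> real" where
  "config_law L s c z = measure \<mu> {x\<in>X. restrict (set_sites s c x) L = z}"

definition choice_prob :: "'g set \<Rightarrow> ('g \<Rightarrow> bool) \<Rightarrow> real" where
  "choice_prob s c = (\<Prod>g\<in>s. weight (c g))"

text \<open>The law of the word on \<open>L\<close> when exactly the sites in \<open>s\<close> are
  resampled. Only the choices are averaged here; the randomness of \<open>s\<close> enters later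
  through concavity of entropy.\<close>

definition mixed_law :: "'g set \<Rightarrow> 'g set \<Rightarrow> ('g \<Rightarrow> 'a) \<Rightarrow> real" where
  "mixed_law L s z = (\<Sum>c\<in>s \<rightarrow>\<^sub>E UNIV. choice_prob s c * config_law L s c z)"

lemma finite_choices: "finite s \<Longrightarrow> finite (s \<rightarrow>\<^sub>E (UNIV :: bool set))"
  by (intro finite_PiE) simp_all

lemma choice_prob_nonneg: "0 \<le> choice_prob s c"
  unfolding choice_prob_def by (intro prod_nonneg) (simp add: weight_nonneg)

lemma sum_choice_prob: "finite s \<Longrightarrow> (\<Sum>c\<in>s \<rightarrow>\<^sub>E UNIV. choice_prob s c) = 1"
proof -
  assume s: "finite s"
  have "(\<Prod>g\<in>s. \<Sum>b\<in>UNIV. weight b) = (\<Sum>c\<in>s \<rightarrow>\<^sub>E UNIV. choice_prob s c)"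
    unfolding choice_prob_def using s by (intro prod_sum_PiE) auto
  moreover have "(\<Sum>b\<in>UNIV. weight b) = 1" by (simp add: UNIV_bool weight_def)
  ultimately show ?thesis by simp
qed

lemma mixed_law_nonneg: "0 \<le> mixed_law L s z"
  unfolding mixed_law_def config_law_def by (intro sum_nonneg mult_nonneg_nonneg choice_prob_nonneg) simp

lemma set_sites_measurable:
  assumes s: "separated s"
  shows "(\<lambda>x. set_sites s c x) \<in> measurable \<mu> \<mu>"
proof (rule measurable_into_X[OF sets_mu])
  fix h a assume h: "h \<in> carrier G"
  have coord: "Measurable.pred \<mu> (\<lambda>x. x f = a)" if "f \<in> carrier G" for f a
    using pred_of[OF coordinate_measurable[OF that], of "\<lambda>b. b = a"] .
  show "{x \<in> space \<mu>. set_sites s c x h = a} \<in> sets \<mu>"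
  proof (cases "\<exists>g\<in>s. h \<in> translate g W")
    case True
    then obtain g where g: "g \<in> s" "h \<in> translate g W" by blast
    have gc: "g \<in> carrier G" using separated_carrier[OF s g(1)] .
    have "Measurable.pred \<mu> (\<lambda>x. shows_pat b g x)" for b
      unfolding shows_pat_def using gc W_in by (intro pred_intros_finite finite_W coord) auto
    then have "Measurable.pred \<mu> (\<lambda>x. (hit g x \<and> pat (c g) (inv g \<otimes> h) = a) \<or> (\<not> hit g x \<and> x h = a))"
      unfolding hit_iff by (intro pred_intros_logic coord h) simp_all
    moreover have "set_sites s c x h = a \<longleftrightarrow> (hit g x \<and> pat (c g) (inv g \<otimes> h) = a) \<or> (\<not> hit g x \<and> x h = a)" for x
      unfolding set_sites_in[OF s g] by simp
    ultimately show ?thesis by (simp add: pred_def)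
  next
    case False
    then have "set_sites s c x h = x h" for x by (intro set_sites_out) blast
    then show ?thesis using coord[OF h, of a] by (simp add: pred_def)
  qed
qed (simp add: set_sites_X[OF s] space_mu)

lemma config_law_sets:
  "separated s \<Longrightarrow> finite L \<Longrightarrow> L \<subseteq> carrier G \<Longrightarrow> {x\<in>X. restrict (set_sites s c x) L = z} \<in> sets \<mu>"
proof -
  assume *: "separated s" "finite L" "L \<subseteq> carrier G"
  have "{x\<in>X. restrict (set_sites s c x) L = z} = (\<lambda>x. set_sites s c x) -` cyl L z \<inter> space \<mu>"
    using set_sites_X[OF *(1)] by (auto simp: cyl_def space_mu)
  then show ?thesis using measurable_sets[OF set_sites_measurable[OF *(1)] cyl_sets[OF *(2,3)]] by simp
qed

text \<open>A word showing pattern \<open>b\<close> at \<open>g\<close> can arise only if the choice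
  at \<open>g\<close> is \<open>b\<close>, and then from the two words that differ from it at most
  by the pattern at \<open>g\<close>. A word showing neither pattern there is left alone.\<close>

lemma config_law_insert:
  assumes sep: "separated (insert g s)" and g: "g \<notin> s" and L: "finite L" "L \<subseteq> carrier G" "translate g W \<subseteq> L"
    and z: "z \<in> L \<rightarrow>\<^sub>E A"
  shows "shows_pat b g z \<Longrightarrow> config_law L (insert g s) c z
      = (if c g = b then config_law L s c z + config_law L s c (patch_site g (\<not> b) z) else 0)" (is "_ \<Longrightarrow> ?hit")
    and "\<not> hit g z \<Longrightarrow> config_law L (insert g s) c z = config_law L s c z" (is "_ \<Longrightarrow> ?nohit")
proof -
  have s: "separated s" by (rule separated_subset[OF sep]) blast
  have gc: "g \<in> carrier G" using separated_carrier[OF sep] by simp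
  let ?y = "\<lambda>x. set_sites s c x"
  have gk: "g \<otimes> k \<in> L" "g \<otimes> k \<in> translate g W" if "k \<in> W" for k
    using L(3) that by (auto simp: translate_def)
  have pat_restrict: "shows_pat b g (restrict y L) \<longleftrightarrow> shows_pat b g y" for b y
    unfolding shows_pat_def using gk by simp
  have hit_restrict: "hit g (restrict y L) \<longleftrightarrow> hit g y" for y
    unfolding hit_def using pat_restrict by simp
  note pat_patch = shows_pat_patch_site[OF gc]
  have hit_y: "hit g (?y x) \<longleftrightarrow> hit g x" for x
    unfolding hit_def using set_sites_cong_hit[OF sep g] by simp
  have ins: "restrict (set_sites (insert g s) c x) L =
      (if hit g (?y x) then patch_site g (c g) (restrict (?y x) L) else restrict (?y x) L)" for x
  proof -
    have "restrict (patch_site g (c g) (?y x)) L = patch_site g (c g) (restrict (?y x) L)"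
      using L(3) by (auto simp: patch_site_def restrict_def fun_eq_iff)
    then show ?thesis unfolding set_sites_insert[OF sep g] hit_y by simp
  qed
  note patch_eq = patch_site_eq[OF gc] and patch_patch = patch_site_patch_site
  show ?hit if zb: "shows_pat b g z"
  proof (cases "c g = b")
    case True
    have iff: "restrict (set_sites (insert g s) c x) L = z \<longleftrightarrow>
       restrict (?y x) L = z \<or> restrict (?y x) L = patch_site g (\<not> b) z" for x
    proof (cases "hit g (?y x)")
      case hit: True
      then obtain b' where b': "shows_pat b' g (restrict (?y x) L)" using pat_restrict by (auto simp: hit_def)
      have "patch_site g b (restrict (?y x) L) = z \<longleftrightarrow> restrict (?y x) L = patch_site g b' z"
      proof
        assume "patch_site g b (restrict (?y x) L) = z"
        then have "patch_site g b' z = patch_site g b' (restrict (?y x) L)" using patch_patch by metis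
        then show "restrict (?y x) L = patch_site g b' z" using patch_eq[OF b'] by simp
      next
        assume "restrict (?y x) L = patch_site g b' z"
        then show "patch_site g b (restrict (?y x) L) = z" using patch_patch patch_eq[OF zb] by simp
      qed
      moreover have "restrict (?y x) L \<noteq> patch_site g b'' z" if "b'' \<noteq> b'" for b''
        using pat_patch[of b'' z] b' that shows_pat_unique by metis
      ultimately show ?thesis unfolding ins using hit True patch_eq[OF zb] by (cases b; cases b') auto
    next
      case nohit: False
      have "restrict (?y x) L \<noteq> patch_site g (\<not> b) z"
        using nohit hit_restrict[of "?y x"] pat_patch[of "\<not> b" z] by (auto simp: hit_def)
      then show ?thesis unfolding ins using nohit by simp
    qed
    have ne: "z \<noteq> patch_site g (\<not> b) z"
    proof
      assume "z = patch_site g (\<not> b) z"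
      then have "shows_pat (\<not> b) g z" using pat_patch[of "\<not> b" z] by simp
      from shows_pat_unique[OF zb this] show False by simp
    qed
    have "{x\<in>X. restrict (set_sites (insert g s) c x) L = z} =
        {x\<in>X. restrict (?y x) L = z} \<union> {x\<in>X. restrict (?y x) L = patch_site g (\<not> b) z}"
      unfolding iff by blast
    then show ?thesis
      unfolding config_law_def using True ne config_law_sets[OF s L(1,2)]
      by (subst finite_measure_Union[symmetric]) auto
  next
    case False
    have "restrict (set_sites (insert g s) c x) L \<noteq> z" for x
    proof (cases "hit g (?y x)")
      case True
      then show ?thesis unfolding ins using pat_patch[of "c g" "restrict (?y x) L"] shows_pat_unique[OF zb, of "c g"] False by auto
    next
      case False
      then show ?thesis unfolding ins using hit_restrict[of "?y x"] zb by (auto simp: hit_def)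
    qed
    then show ?thesis using False by (simp add: config_law_def)
  qed
  show ?nohit if nz: "\<not> hit g z"
  proof -
    have "restrict (set_sites (insert g s) c x) L = z \<longleftrightarrow> restrict (?y x) L = z" for x
    proof (cases "hit g (?y x)")
      case True
      have "patch_site g (c g) (restrict (?y x) L) \<noteq> z"
        using pat_patch[of "c g" "restrict (?y x) L"] nz by (auto simp: hit_def)
      moreover have "restrict (?y x) L \<noteq> z" using hit_restrict[of "?y x"] True nz by auto
      ultimately show ?thesis unfolding ins using True by simp
    qed (simp add: ins)
    then show ?thesis by (simp add: config_law_def)
  qed
qed

lemma config_law_cong:
  "separated s \<Longrightarrow> (\<And>g. g \<in> s \<Longrightarrow> c g = c' g) \<Longrightarrow> config_law L s c z = config_law L s c' z"
  unfolding config_law_def using set_sites_cong_choice[of s c c'] by simp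

text \<open>Provides the three equations between the old and the new law that
  \<open>resampling_entropy\<close> requires for one further site.\<close>

lemma mixed_law_insert:
  assumes sep: "separated (insert g s)" and g: "g \<notin> s" and s: "finite s"
    and L: "finite L" "L \<subseteq> carrier G" "translate g W \<subseteq> L" and z: "z \<in> L \<rightarrow>\<^sub>E A"
  shows "shows_pat b g z \<Longrightarrow> mixed_law L (insert g s) z = weight b * (mixed_law L s z + mixed_law L s (patch_site g (\<not> b) z))"
    and "\<not> hit g z \<Longrightarrow> mixed_law L (insert g s) z = mixed_law L s z"
proof -
  have seps: "separated s" by (rule separated_subset[OF sep]) blast
  \<comment> \<open>A choice on \<open>insert g s\<close> is a choice on \<open>s\<close> together
    with a bit for \<open>g\<close>, and its probability factors accordingly.\<close>
  let ?ext = "\<lambda>(b, c). c(g := b)"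
  have inj: "inj_on ?ext (UNIV \<times> (s \<rightarrow>\<^sub>E (UNIV :: bool set)))"
  proof (rule inj_onI, clarify)
    fix b b' :: bool and c c' assume c: "c \<in> s \<rightarrow>\<^sub>E (UNIV :: bool set)" "c' \<in> s \<rightarrow>\<^sub>E UNIV" and eq: "c(g := b) = c'(g := b')"
    have "c h = c' h" for h
    proof (cases "h = g")
      case True
      then show ?thesis using c g by (auto simp: PiE_def extensional_def)
    next
      case False
      then show ?thesis using fun_cong[OF eq, of h] by simp
    qed
    then show "b = b' \<and> c = c'" using fun_cong[OF eq, of g] by auto
  qed
  have split: "mixed_law L (insert g s) z =
     (\<Sum>b\<in>UNIV. \<Sum>c\<in>s \<rightarrow>\<^sub>E UNIV. weight b * choice_prob s c * config_law L (insert g s) (c(g := b)) z)"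
  proof -
    have "mixed_law L (insert g s) z = (\<Sum>c\<in>?ext ` (UNIV \<times> (s \<rightarrow>\<^sub>E UNIV)). choice_prob (insert g s) c * config_law L (insert g s) c z)"
      unfolding mixed_law_def PiE_insert_eq ..
    also have "\<dots> = (\<Sum>(b, c)\<in>UNIV \<times> (s \<rightarrow>\<^sub>E UNIV). choice_prob (insert g s) (c(g := b)) * config_law L (insert g s) (c(g := b)) z)"
      by (subst sum.reindex[OF inj]) (simp add: case_prod_beta')
    also have "\<dots> = (\<Sum>(b, c)\<in>UNIV \<times> (s \<rightarrow>\<^sub>E UNIV). weight b * choice_prob s c * config_law L (insert g s) (c(g := b)) z)"
    proof (rule sum.cong[OF refl], clarify)
      fix b c
      have "(\<Prod>h\<in>s. weight ((c(g := b)) h)) = (\<Prod>h\<in>s. weight (c h))"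
        using g by (intro prod.cong) auto
      then show "choice_prob (insert g s) (c(g := b)) * config_law L (insert g s) (c(g := b)) z
        = weight b * choice_prob s c * config_law L (insert g s) (c(g := b)) z"
        unfolding choice_prob_def using g s by simp
    qed
    finally show ?thesis by (simp add: sum.cartesian_product)
  qed
  have cong: "config_law L s (c(g := b)) z = config_law L s c z" for b c z
    using g by (intro config_law_cong[OF seps]) auto
  show "mixed_law L (insert g s) z = weight b * (mixed_law L s z + mixed_law L s (patch_site g (\<not> b) z))"
    if b: "shows_pat b g z"
  proof -
    have "(\<Sum>c\<in>s \<rightarrow>\<^sub>E UNIV. weight b' * choice_prob s c * config_law L (insert g s) (c(g := b')) z)
      = (if b' = b then weight b * (mixed_law L s z + mixed_law L s (patch_site g (\<not> b) z)) else 0)" for b'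
      unfolding config_law_insert(1)[OF sep g L z b] cong
      by (auto simp: mixed_law_def sum_distrib_left sum.distrib algebra_simps)
    then show ?thesis unfolding split by simp
  qed
  show "mixed_law L (insert g s) z = mixed_law L s z" if nz: "\<not> hit g z"
  proof -
    have "mixed_law L (insert g s) z = (\<Sum>b\<in>UNIV. weight b * mixed_law L s z)"
      unfolding split config_law_insert(2)[OF sep g L z nz] cong
      by (simp add: mixed_law_def sum_distrib_left mult.assoc)
    also have "\<dots> = mixed_law L s z" by (simp add: UNIV_bool weight_def algebra_simps)
    finally show ?thesis .
  qed
qed

section \<open>Entropy gained by resampling finitely many given sites\<close>

definition pattern_prob :: "bool \<Rightarrow> real" where
  "pattern_prob b = measure \<mu> (cyl W (pat b))"

text \<open>The gain per site: the binary entropy of \<open>q\<close>, weighted by the chance that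
  the site shows one of the patterns, less the mixing entropy of the two original pattern
  probabilities.\<close>

definition entropy_gain :: real where
  "entropy_gain = (pattern_prob True + pattern_prob False) * mixing_entropy q (1 - q)
     - mixing_entropy (pattern_prob True) (pattern_prob False)"

lemma measure_shows_pat: "g \<in> carrier G \<Longrightarrow> measure \<mu> {x\<in>X. shows_pat b g x} = pattern_prob b"
proof -
  assume g: "g \<in> carrier G"
  have "{x\<in>X. shows_pat b g x} = {x\<in>X. shift G g x \<in> cyl W (pat b)}"
    using shows_pat_cyl[OF g] by auto
  then show ?thesis unfolding pattern_prob_def
    using measure_shift[OF g cyl_sets[OF finite_W W_carrier]] by simp
qed

text \<open>Resampling the other sites does not touch the window at \<open>g\<close>, so the pattern
  probabilities there are still those of \<mu>. Hence every site has the same gain, and the gains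
  add up.\<close>

lemma mixed_law_pattern:
  assumes sep: "separated (insert g s)" and g: "g \<notin> s" and s: "finite s"
    and L: "finite L" "L \<subseteq> carrier G" "translate g W \<subseteq> L"
  shows "(\<Sum>z\<in>{z \<in> L \<rightarrow>\<^sub>E A. shows_pat b g z}. mixed_law L s z) = pattern_prob b"
proof -
  let ?Z = "{z \<in> L \<rightarrow>\<^sub>E A. shows_pat b g z}"
  have seps: "separated s" by (rule separated_subset[OF sep]) blast
  have gc: "g \<in> carrier G" using separated_carrier[OF sep] by simp
  have fin: "finite ?Z" using finite_words[OF L(1)] by simp
  have gk: "g \<otimes> k \<in> L" if "k \<in> W" for k using L(3) that by (auto simp: translate_def)
  have one: "(\<Sum>z\<in>?Z. config_law L s c z) = pattern_prob b" for c
  proof -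
    have "(\<Sum>z\<in>?Z. config_law L s c z) = measure \<mu> (\<Union>z\<in>?Z. {x\<in>X. restrict (set_sites s c x) L = z})"
      unfolding config_law_def using fin config_law_sets[OF seps L(1,2)]
      by (intro finite_measure_finite_Union[symmetric]) (auto simp: disjoint_family_on_def)
    also have "(\<Union>z\<in>?Z. {x\<in>X. restrict (set_sites s c x) L = z}) = {x\<in>X. shows_pat b g x}"
    proof -
      have "restrict (set_sites s c x) L \<in> ?Z \<longleftrightarrow> shows_pat b g x" if x: "x \<in> X" for x
      proof -
        have "restrict (set_sites s c x) L \<in> L \<rightarrow>\<^sub>E A"
          by (rule restrict_word[OF set_sites_X[OF seps x] L(1,2)])
        moreover have "shows_pat b g (restrict (set_sites s c x) L) \<longleftrightarrow> shows_pat b g x"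
          using set_sites_cong_hit[OF sep g, of b c x] gk by (simp add: shows_pat_def)
        ultimately show ?thesis by simp
      qed
      then show ?thesis by blast
    qed
    finally show ?thesis using measure_shows_pat[OF gc] by simp
  qed
  have "(\<Sum>z\<in>?Z. mixed_law L s z) = (\<Sum>c\<in>s \<rightarrow>\<^sub>E UNIV. choice_prob s c * (\<Sum>z\<in>?Z. config_law L s c z))"
    unfolding mixed_law_def by (subst sum.swap) (simp add: sum_distrib_left)
  then show ?thesis unfolding one using sum_choice_prob[OF s] by (simp add: sum_distrib_right[symmetric])
qed

text \<open>Sites are added one by one. Each step is \<open>resampling_entropy\<close> with the
  words showing \<open>w\<close> at \<open>g\<close> as \<open>S\<close> and the replacement of
  \<open>w\<close> by \<open>w'\<close> as \<tau>.\<close>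

lemma mixed_law_entropy:
  assumes L: "finite L" "L \<subseteq> carrier G"
  shows "finite s \<Longrightarrow> separated s \<Longrightarrow> (\<And>g. g \<in> s \<Longrightarrow> translate g W \<subseteq> L) \<Longrightarrow>
    config_entropy L + real (card s) * entropy_gain \<le> (\<Sum>z\<in>L \<rightarrow>\<^sub>E A. entropy_fun (mixed_law L s z))"
proof (induction s rule: finite_induct)
  case empty
  note fin = finite_words[OF L(1)]
  have sub: "(\<lambda>x. restrict x L) ` space \<mu> \<subseteq> L \<rightarrow>\<^sub>E A"
    using restrict_word[OF _ L] unfolding space_mu by blast
  have "(\<lambda>x. restrict x L) -` {z} \<inter> space \<mu> = {x\<in>X. restrict x L = z}" for z by (auto simp: space_mu)
  then have "config_entropy L = (\<Sum>z\<in>L \<rightarrow>\<^sub>E A. entropy_fun (mixed_law L {} z))"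
    unfolding config_entropy_def rv_entropy_sum_superset[OF sub fin]
    by (simp add: mixed_law_def choice_prob_def config_law_def set_sites_empty entropy_fun_def sum_negf)
  then show ?case by simp
next
  case (insert g s)
  have sep: "separated (insert g s)" and g: "g \<notin> s" and gL: "translate g W \<subseteq> L" and s: "finite s"
    using insert by auto
  have gc: "g \<in> carrier G" using separated_carrier[OF sep] by simp
  have seps: "separated s" by (rule separated_subset[OF sep]) blast
  note pat_patch = shows_pat_patch_site[OF gc]
  note patch_eq = patch_site_eq[OF gc] and patch_patch = patch_site_patch_site
  have patch_Q: "patch_site g b z \<in> L \<rightarrow>\<^sub>E A" if z: "z \<in> L \<rightarrow>\<^sub>E A" for b z
  proof (rule PiE_I)
    fix h assume "h \<in> L"
    then show "patch_site g b z h \<in> A"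
      using z gc translate_iff[OF gc W_carrier, of h] by (auto simp: patch_site_def pat_in_A)
  next
    fix h assume "h \<notin> L"
    then show "patch_site g b z h = undefined"
      using z gL by (auto simp: patch_site_def PiE_def extensional_def)
  qed
  let ?Q = "L \<rightarrow>\<^sub>E A" and ?\<tau> = "patch_site g False"
  let ?S = "{z \<in> ?Q. shows_pat True g z}"
  have im: "?\<tau> ` ?S = {z \<in> ?Q. shows_pat False g z}"
  proof (intro equalityI subsetI)
    fix z assume "z \<in> ?\<tau> ` ?S"
    then show "z \<in> {z \<in> ?Q. shows_pat False g z}" using patch_Q pat_patch by auto
  next
    fix z assume z: "z \<in> {z \<in> ?Q. shows_pat False g z}"
    then have "z = ?\<tau> (patch_site g True z)" using patch_patch patch_eq by auto
    moreover have "patch_site g True z \<in> ?S" using z patch_Q pat_patch by auto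
    ultimately show "z \<in> ?\<tau> ` ?S" by blast
  qed
  have "(\<Sum>z\<in>?Q. entropy_fun (mixed_law L s z)) + (sum (mixed_law L s) ?S + sum (mixed_law L s) (?\<tau> ` ?S)) * mixing_entropy q (1 - q)
      - mixing_entropy (sum (mixed_law L s) ?S) (sum (mixed_law L s) (?\<tau> ` ?S)) \<le> (\<Sum>z\<in>?Q. entropy_fun (mixed_law L (insert g s) z))"
  proof (rule resampling_entropy[OF _ _ _ _ _ mixed_law_nonneg q])
    show "finite ?Q" by (rule finite_words[OF L(1)])
    show "?\<tau> ` ?S \<subseteq> ?Q" unfolding im by blast
    show "?S \<inter> ?\<tau> ` ?S = {}" unfolding im using shows_pat_unique by blast
    show "inj_on ?\<tau> ?S"
    proof (rule inj_onI)
      fix y z assume yz: "y \<in> ?S" "z \<in> ?S" "?\<tau> y = ?\<tau> z"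
      then have "patch_site g True (?\<tau> y) = patch_site g True (?\<tau> z)" by simp
      then show "y = z" using yz(1,2) patch_patch patch_eq by simp
    qed
    fix z
    show "mixed_law L (insert g s) z = q * (mixed_law L s z + mixed_law L s (?\<tau> z))" if "z \<in> ?S"
      using mixed_law_insert(1)[OF sep g s L gL, of z True] that by (simp add: weight_def)
    show "mixed_law L (insert g s) (?\<tau> z) = (1 - q) * (mixed_law L s z + mixed_law L s (?\<tau> z))" if z: "z \<in> ?S"
    proof -
      have "patch_site g True (?\<tau> z) = z" using z patch_patch patch_eq by simp
      then show ?thesis
        using mixed_law_insert(1)[OF sep g s L gL patch_Q pat_patch, of z False] z
        by (simp add: weight_def add.commute)
    qed
    show "mixed_law L (insert g s) z = mixed_law L s z" if "z \<in> ?Q" "z \<notin> ?S" "z \<notin> ?\<tau> ` ?S"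
      using mixed_law_insert(2)[OF sep g s L gL that(1)] that unfolding im by (simp add: hit_iff)
  qed auto
  then have "(\<Sum>z\<in>?Q. entropy_fun (mixed_law L s z)) + entropy_gain \<le> (\<Sum>z\<in>?Q. entropy_fun (mixed_law L (insert g s) z))"
    unfolding im mixed_law_pattern[OF sep g s L gL] entropy_gain_def by linarith
  moreover have "config_entropy L + real (card s) * entropy_gain \<le> (\<Sum>z\<in>?Q. entropy_fun (mixed_law L s z))"
    using insert by (intro insert.IH seps) auto
  moreover have "real (card (insert g s)) * entropy_gain = real (card s) * entropy_gain + entropy_gain"
    using g s by (simp add: algebra_simps)
  ultimately show ?case by linarith
qed

section \<open>The law of the active sites in a finite set\<close>

definition site_prob :: real where
  "site_prob = measure sitesM {e\<in>space sitesM. \<one> \<in> active e}"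

lemma pred_active_sites: "g \<in> carrier G \<Longrightarrow> Measurable.pred sitesM (\<lambda>e. g \<in> active e)"
proof -
  assume g: "g \<in> carrier G"
  have "Measurable.pred sitesM (\<lambda>e. e g \<and> (\<forall>d\<in>D. \<not> e (g \<otimes> d)))"
    unfolding sitesM_def
    by (intro pred_intros_logic pred_intros_finite finite_D coordinate_PiM_pmf)
      (use g D_carrier in auto)
  then show ?thesis using g by (simp add: active_def)
qed

lemma sets_active: "g \<in> carrier G \<Longrightarrow> {e\<in>space sitesM. g \<in> active e} \<in> sets sitesM"
  using pred_active_sites[of g] by (simp add: pred_def)

lemma measure_active:
  assumes g: "g \<in> carrier G"
  shows "measure sitesM {e\<in>space sitesM. g \<in> active e} = site_prob"
proof -
  have m: "shift G g \<in> measurable sitesM sitesM" and d: "distr sitesM sitesM (shift G g) = sitesM"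
    unfolding sitesM_def by (rule shift_PiM_pmf[OF g])+
  have "site_prob = measure (distr sitesM sitesM (shift G g)) {e\<in>space sitesM. \<one> \<in> active e}"
    unfolding d site_prob_def ..
  also have "\<dots> = measure sitesM (shift G g -` {e\<in>space sitesM. \<one> \<in> active e} \<inter> space sitesM)"
    by (rule measure_distr[OF m sets_active]) simp
  also have "shift G g -` {e\<in>space sitesM. \<one> \<in> active e} \<inter> space sitesM = {e\<in>space sitesM. g \<in> active e}"
    using measurable_space[OF m] g by (auto simp: active_shift)
  finally show ?thesis by simp
qed

lemma site_prob_pos: "0 < site_prob"
proof -
  let ?B = "\<lambda>i. if i = \<one> then {True} else {False}" and ?J = "insert \<one> D"
  interpret product_prob_space "\<lambda>_. measure_pmf (bernoulli_pmf (1/2))" "carrier G"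
    by unfold_locales
  have J: "?J \<subseteq> carrier G" "finite ?J" using D_carrier finite_D by auto
  have "{e\<in>space sitesM. \<one> \<in> active e} = {e\<in>space sitesM. \<forall>i\<in>?J. e i \<in> ?B i}"
    using one_notin_D D_carrier by (auto simp: active_def subset_iff)
  then have "emeasure sitesM {e\<in>space sitesM. \<one> \<in> active e} = (\<Prod>i\<in>?J. emeasure (measure_pmf (bernoulli_pmf (1/2))) (?B i))"
    using emeasure_PiM_Collect[OF J, of ?B] by (simp add: sitesM_def)
  \<comment> \<open>The event prescribes one bit at each point of \<open>insert \<one> D\<close>,
    and a fair coin gives both values probability 1/2.\<close>
  also have "\<dots> = (\<Prod>i\<in>?J. ennreal (1/2))"
    by (intro prod.cong) (auto simp: emeasure_pmf_single)
  also have "\<dots> = ennreal (\<Prod>i\<in>?J. 1/2)" by (rule prod_ennreal) simp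
  finally have "site_prob = enn2real (ennreal (\<Prod>i\<in>?J. 1/2))" unfolding site_prob_def measure_def by simp
  also have "\<dots> = (\<Prod>i\<in>?J. 1/2)" by (intro enn2real_ennreal prod_nonneg) simp
  also have "0 < \<dots>" by (intro prod_pos) simp
  finally show ?thesis .
qed

definition site_law :: "'g set \<Rightarrow> 'g set \<Rightarrow> real" where
  "site_law N s = measure sitesM {e\<in>space sitesM. active e \<inter> N = s}"

lemma sets_site_law:
  assumes N: "finite N" "N \<subseteq> carrier G"
  shows "{e\<in>space sitesM. active e \<inter> N = s} \<in> sets sitesM"
proof (cases "s \<subseteq> N")
  case True
  have "Measurable.pred sitesM (\<lambda>e. \<forall>g\<in>N. g \<in> active e \<longleftrightarrow> g \<in> s)"
    by (intro pred_intros_finite N(1) pred_intros_logic pred_active_sites) (use N in auto)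
  moreover have "active e \<inter> N = s \<longleftrightarrow> (\<forall>g\<in>N. g \<in> active e \<longleftrightarrow> g \<in> s)" for e using True by auto
  ultimately show ?thesis by (simp add: pred_def)
next
  case False
  then have "{e\<in>space sitesM. active e \<inter> N = s} = {}" by auto
  then show ?thesis by (simp only: sets.empty_sets)
qed

lemma sum_site_law:
  assumes N: "finite N" "N \<subseteq> carrier G" and Q: "Q \<subseteq> Pow N"
  shows "(\<Sum>s\<in>Q. site_law N s) = measure sitesM {e\<in>space sitesM. active e \<inter> N \<in> Q}"
proof -
  interpret E: prob_space sitesM by (rule prob_space_sites)
  have "finite Q" using N Q by (meson finite_Pow_iff finite_subset)
  then have "(\<Sum>s\<in>Q. site_law N s) = measure sitesM (\<Union>s\<in>Q. {e\<in>space sitesM. active e \<inter> N = s})"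
    unfolding site_law_def using sets_site_law[OF N]
    by (intro E.finite_measure_finite_Union[symmetric]) (auto simp: disjoint_family_on_def)
  also have "(\<Union>s\<in>Q. {e\<in>space sitesM. active e \<inter> N = s}) = {e\<in>space sitesM. active e \<inter> N \<in> Q}" by auto
  finally show ?thesis .
qed

lemma site_law_nonneg: "0 \<le> site_law N s"
  by (simp add: site_law_def)

lemma site_law_total:
  assumes N: "finite N" "N \<subseteq> carrier G"
  shows "(\<Sum>s\<in>Pow N. site_law N s) = 1"
proof -
  interpret E: prob_space sitesM by (rule prob_space_sites)
  have "{e\<in>space sitesM. active e \<inter> N \<in> Pow N} = space sitesM" by auto
  then show ?thesis using sum_site_law[OF N subset_refl] E.prob_space by simp
qed

text \<open>Linearity of expectation for the number of active sites in \<open>N\<close>, each active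
  with the same probability by invariance of the marks.\<close>

lemma site_law_card:
  assumes N: "finite N" "N \<subseteq> carrier G"
  shows "(\<Sum>s\<in>Pow N. site_law N s * real (card s)) = real (card N) * site_prob"
proof -
  have card: "real (card s) = (\<Sum>g\<in>N. if g \<in> s then 1 else 0)" if "s \<in> Pow N" for s
    using that N by (simp add: sum.If_cases Int_absorb1)
  have "(\<Sum>s\<in>Pow N. site_law N s * real (card s)) = (\<Sum>s\<in>Pow N. \<Sum>g\<in>N. if g \<in> s then site_law N s else 0)"
    by (rule sum.cong[OF refl]) (simp add: card sum_distrib_left if_distrib cong: if_cong)
  also have "\<dots> = (\<Sum>g\<in>N. \<Sum>s\<in>Pow N. if g \<in> s then site_law N s else 0)" by (rule sum.swap)
  also have "\<dots> = (\<Sum>g\<in>N. site_prob)"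
  proof (rule sum.cong[OF refl])
    fix g assume g: "g \<in> N"
    have "(\<Sum>s\<in>Pow N. if g \<in> s then site_law N s else 0) = (\<Sum>s\<in>{s\<in>Pow N. g \<in> s}. site_law N s)"
      using N by (intro sum.inter_filter[symmetric]) simp
    also have "\<dots> = measure sitesM {e\<in>space sitesM. active e \<inter> N \<in> {s\<in>Pow N. g \<in> s}}"
      by (rule sum_site_law[OF N]) auto
    also have "{e\<in>space sitesM. active e \<inter> N \<in> {s\<in>Pow N. g \<in> s}} = {e\<in>space sitesM. g \<in> active e}"
      using g by auto
    also have "measure sitesM \<dots> = site_prob" using measure_active g N by blast
    finally show "(\<Sum>s\<in>Pow N. if g \<in> s then site_law N s else 0) = site_prob" .
  qed
  finally show ?thesis by simp
qed

lemma choice_cylinder: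
  assumes s: "finite s" "s \<subseteq> carrier G" and c: "c \<in> s \<rightarrow>\<^sub>E UNIV"
  shows "{d\<in>space choiceM. restrict d s = c} \<in> sets choiceM"
    and "measure choiceM {d\<in>space choiceM. restrict d s = c} = choice_prob s c"
proof -
  interpret product_prob_space "\<lambda>_. measure_pmf (bernoulli_pmf q)" "carrier G"
    by unfold_locales
  have "restrict d s = c \<longleftrightarrow> (\<forall>i\<in>s. d i \<in> {c i})" for d
    using c by (auto simp: PiE_def extensional_def restrict_def fun_eq_iff)
  then have eq: "{d\<in>space choiceM. restrict d s = c} = {d\<in>space choiceM. \<forall>i\<in>s. d i \<in> {c i}}" by auto
  have "Measurable.pred choiceM (\<lambda>d. \<forall>i\<in>s. d i \<in> {c i})"
  proof (intro pred_intros_finite s(1))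
    fix i assume "i \<in> s"
    then have "(\<lambda>e. e i) \<in> measurable choiceM (count_space UNIV)"
      unfolding choiceM_def using s by (intro coordinate_PiM_pmf) auto
    then show "Measurable.pred choiceM (\<lambda>d. d i \<in> {c i})" by (rule pred_of)
  qed
  then show "{d\<in>space choiceM. restrict d s = c} \<in> sets choiceM" unfolding eq by (simp only: pred_def)
  have "emeasure choiceM {d\<in>space choiceM. \<forall>i\<in>s. d i \<in> {c i}} = (\<Prod>i\<in>s. emeasure (measure_pmf (bernoulli_pmf q)) {c i})"
    using emeasure_PiM_Collect[OF s(2,1), of "\<lambda>i. {c i}"] by (simp add: choiceM_def)
  also have "\<dots> = (\<Prod>i\<in>s. ennreal (weight (c i)))"
  proof (intro prod.cong refl)
    fix i
    show "emeasure (measure_pmf (bernoulli_pmf q)) {c i} = ennreal (weight (c i))"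
      using q by (cases "c i") (simp_all add: emeasure_pmf_single weight_def)
  qed
  also have "\<dots> = ennreal (choice_prob s c)" unfolding choice_prob_def by (intro prod_ennreal weight_nonneg)
  finally show "measure choiceM {d\<in>space choiceM. restrict d s = c} = choice_prob s c"
    unfolding eq by (simp add: measure_def choice_prob_nonneg)
qed

text \<open>Resampling is confined to the finite set \<open>N\<close>, so the law is a finite
  mixture of \<open>mixed_law\<close>; activity is still decided by the marks on the whole
  group.\<close>

definition window_config :: "'g set \<Rightarrow> 'g set \<Rightarrow> ('g \<Rightarrow> 'a) \<times> ('g \<Rightarrow> bool) \<times> ('g \<Rightarrow> bool) \<Rightarrow> 'g \<Rightarrow> 'a" where
  "window_config N L = (\<lambda>(x, e, c). restrict (set_sites (active e \<inter> N) c x) L)"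

lemma separated_active_Int: "separated (active e \<inter> N)"
  by (rule separated_subset[OF separated_active]) blast

lemma window_config_law:
  assumes N: "finite N" "N \<subseteq> carrier G" and L: "finite L" "L \<subseteq> carrier G"
  shows "{\<omega>\<in>space jointM. window_config N L \<omega> = z} \<in> sets jointM"
    and "measure jointM {\<omega>\<in>space jointM. window_config N L \<omega> = z} = (\<Sum>s\<in>Pow N. site_law N s * mixed_law L s z)"
proof -
  interpret J: prob_space jointM by (rule prob_space_joint)
  let ?I = "SIGMA s:Pow N. s \<rightarrow>\<^sub>E (UNIV :: bool set)"
  let ?X = "\<lambda>s c. {x\<in>X. restrict (set_sites s c x) L = z}"
  let ?E = "\<lambda>s. {e\<in>space sitesM. active e \<inter> N = s}"
  let ?C = "\<lambda>s c. {d\<in>space choiceM. restrict d s = c}"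
  let ?B = "\<lambda>(s, c). ?X s c \<times> (?E s \<times> ?C s c)"
  have s_props: "finite s" "s \<subseteq> carrier G" if "s \<in> Pow N" for s using that N finite_subset by auto
  have finI: "finite ?I" using N by (intro finite_SigmaI) (auto intro!: finite_choices finite_subset[OF _ N(1)])
  have sep: "separated s" if "?E s \<noteq> {}" for s
    using that separated_active_Int[of _ N] by blast
  have B: "?B i \<in> sets jointM" "measure jointM (?B i) = site_law N (fst i) * (choice_prob (fst i) (snd i) * config_law L (fst i) (snd i) z)"
    if i: "i \<in> ?I" for i
  proof -
    obtain s c where sc: "i = (s, c)" "s \<in> Pow N" "c \<in> s \<rightarrow>\<^sub>E UNIV" using i by auto
    note C = choice_cylinder[OF s_props[OF sc(2)] sc(3)]
    have EC: "?E s \<times> ?C s c \<in> sets (sitesM \<Otimes>\<^sub>M choiceM)"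
      using sets_site_law[OF N] C(1) by (rule pair_measureI)
    have mEC: "measure (sitesM \<Otimes>\<^sub>M choiceM) (?E s \<times> ?C s c) = site_law N s * choice_prob s c"
      using prob_space.measure_pair_Times[OF prob_space_sites prob_space_choice sets_site_law[OF N] C(1)] C(2)
      by (simp add: site_law_def)
    have "?B i \<in> sets jointM \<and> measure jointM (?B i) = site_law N s * (choice_prob s c * config_law L s c z)"
    proof (cases "?E s = {}")
      \<comment> \<open>A set \<open>s\<close> that is never the active part of \<open>N\<close> may
        fail to be separated, in which case \<open>config_law_sets\<close> does not apply. The box
        is empty then and both sides are 0.\<close>
      case True
      have "site_law N s = 0" unfolding site_law_def True by simp
      then show ?thesis unfolding sc(1) by (simp add: True)
    next
      case False
      note X = config_law_sets[OF sep[OF False] L, of c z]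
      have "measure jointM (?X s c \<times> (?E s \<times> ?C s c)) = measure \<mu> (?X s c) * (site_law N s * choice_prob s c)"
        unfolding jointM_def using measure_pair_Times[OF prob_space_sites_choice X EC] mEC by simp
      moreover have "?X s c \<times> (?E s \<times> ?C s c) \<in> sets jointM"
        unfolding jointM_def by (rule pair_measureI[OF X EC])
      ultimately show ?thesis unfolding sc(1) config_law_def by simp
    qed
    then show "?B i \<in> sets jointM" "measure jointM (?B i) = site_law N (fst i) * (choice_prob (fst i) (snd i) * config_law L (fst i) (snd i) z)"
      by (simp_all add: sc(1))
  qed
  have eq: "{\<omega>\<in>space jointM. window_config N L \<omega> = z} = (\<Union>i\<in>?I. ?B i)"
  proof (intro equalityI subsetI)
    fix \<omega> assume w: "\<omega> \<in> {\<omega>\<in>space jointM. window_config N L \<omega> = z}"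
    obtain x e c where xec: "\<omega> = (x, e, c)" by (cases \<omega>) auto
    let ?s = "active e \<inter> N"
    have mem: "x \<in> X" "e \<in> space sitesM" "c \<in> space choiceM"
      using w by (auto simp: xec space_joint space_sites space_choice)
    have "set_sites ?s c x = set_sites ?s (restrict c ?s) x"
      by (rule set_sites_cong_choice[OF separated_active_Int]) simp
    then have "\<omega> \<in> ?B (?s, restrict c ?s)" using w mem by (simp add: xec window_config_def)
    then show "\<omega> \<in> (\<Union>i\<in>?I. ?B i)" by (intro UN_I[of "(?s, restrict c ?s)"]) auto
  next
    fix \<omega> assume "\<omega> \<in> (\<Union>i\<in>?I. ?B i)"
    then obtain s c' where sc: "s \<subseteq> N" "c' \<in> s \<rightarrow>\<^sub>E UNIV" "\<omega> \<in> ?B (s, c')" by auto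
    obtain x e c where xec: "\<omega> = (x, e, c)" by (cases \<omega>) auto
    have *: "x \<in> X" "restrict (set_sites s c' x) L = z" "e \<in> space sitesM" "active e \<inter> N = s" "c \<in> space choiceM" "restrict c s = c'"
      using sc(3) by (auto simp: xec)
    have "set_sites s c x = set_sites s c' x"
      unfolding *(6)[symmetric] using *(4) separated_active_Int[of e N]
      by (intro set_sites_cong_choice) auto
    then show "\<omega> \<in> {\<omega>\<in>space jointM. window_config N L \<omega> = z}"
      using * by (auto simp: xec window_config_def space_joint space_sites space_choice)
  qed
  show "{\<omega>\<in>space jointM. window_config N L \<omega> = z} \<in> sets jointM"
    unfolding eq using finI B(1) by (intro sets.finite_UN) auto
  have "measure jointM (\<Union>i\<in>?I. ?B i) = (\<Sum>i\<in>?I. measure jointM (?B i))"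
    using finI B(1) by (intro J.finite_measure_finite_Union) (auto simp: disjoint_family_on_def)
  also have "\<dots> = (\<Sum>i\<in>?I. site_law N (fst i) * (choice_prob (fst i) (snd i) * config_law L (fst i) (snd i) z))"
    by (rule sum.cong[OF refl]) (rule B(2))
  also have "\<dots> = (\<Sum>s\<in>Pow N. \<Sum>c\<in>s \<rightarrow>\<^sub>E UNIV. site_law N s * (choice_prob s c * config_law L s c z))"
    using N by (subst sum.Sigma) (auto intro!: finite_choices finite_subset[OF _ N(1)] simp: case_prod_beta')
  also have "\<dots> = (\<Sum>s\<in>Pow N. site_law N s * mixed_law L s z)"
    unfolding mixed_law_def by (simp add: sum_distrib_left)
  finally show "measure jointM {\<omega>\<in>space jointM. window_config N L \<omega> = z} = (\<Sum>s\<in>Pow N. site_law N s * mixed_law L s z)"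
    unfolding eq .
qed

lemma window_config_word:
  "finite L \<Longrightarrow> L \<subseteq> carrier G \<Longrightarrow> \<omega> \<in> space jointM \<Longrightarrow> window_config N L \<omega> \<in> L \<rightarrow>\<^sub>E A"
proof -
  assume L: "finite L" "L \<subseteq> carrier G" and "\<omega> \<in> space jointM"
  then obtain x e c where "\<omega> = (x, e, c)" "x \<in> X" by (auto simp: space_joint)
  then show ?thesis
    using restrict_word[OF set_sites_X[OF separated_active_Int[of e N]] L, of x c] by (simp only: window_config_def prod.case)
qed

lemma simple_window_config:
  assumes N: "finite N" "N \<subseteq> carrier G" and L: "finite L" "L \<subseteq> carrier G"
  shows "simple_function jointM (window_config N L)"
  unfolding simple_function_def
proof (intro conjI ballI)
  show "finite (window_config N L ` space jointM)"
    by (rule finite_subset[OF _ finite_words[OF L(1)]]) (use window_config_word[OF L] in blast)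
  fix z
  have "window_config N L -` {z} \<inter> space jointM = {\<omega>\<in>space jointM. window_config N L \<omega> = z}" by auto
  then show "window_config N L -` {z} \<inter> space jointM \<in> sets jointM" using window_config_law(1)[OF N L] by simp
qed

text \<open>For a fixed set of sites the gain is linear in its cardinality. Concavity of entropy
  passes to the mixture over random sets, where the cardinality is replaced by its
  expectation.\<close>

lemma window_config_entropy:
  assumes N: "finite N" "N \<subseteq> carrier G" and L: "finite L" "L \<subseteq> carrier G"
    and NL: "\<And>g. g \<in> N \<Longrightarrow> translate g W \<subseteq> L"
  shows "config_entropy L + real (card N) * site_prob * entropy_gain \<le> rv_entropy jointM (window_config N L)"
proof -
  interpret J: prob_space jointM by (rule prob_space_joint)
  let ?Q = "L \<rightarrow>\<^sub>E A"
  have fib: "window_config N L -` {z} \<inter> space jointM = {\<omega>\<in>space jointM. window_config N L \<omega> = z}" for z by auto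
  have "window_config N L ` space jointM \<subseteq> ?Q" using window_config_word[OF L] by blast
  then have eq: "rv_entropy jointM (window_config N L) = (\<Sum>z\<in>?Q. entropy_fun (\<Sum>s\<in>Pow N. site_law N s * mixed_law L s z))"
    using J.rv_entropy_sum_superset[OF _ finite_words[OF L(1)]]
    by (simp add: fib window_config_law(2)[OF N L] entropy_fun_def sum_negf)
  have "config_entropy L + real (card N) * site_prob * entropy_gain
     = (\<Sum>s\<in>Pow N. site_law N s * (config_entropy L + real (card s) * entropy_gain))"
  proof -
    have "(\<Sum>s\<in>Pow N. site_law N s * (config_entropy L + real (card s) * entropy_gain))
      = (\<Sum>s\<in>Pow N. site_law N s) * config_entropy L + (\<Sum>s\<in>Pow N. site_law N s * real (card s)) * entropy_gain"
      by (simp add: distrib_left sum.distrib sum_distrib_right mult.assoc)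
    then show ?thesis by (simp add: site_law_total[OF N] site_law_card[OF N])
  qed
  also have "\<dots> \<le> (\<Sum>s\<in>Pow N. site_law N s * (\<Sum>z\<in>?Q. entropy_fun (mixed_law L s z)))"
  proof (rule sum_mono)
    fix s assume s: "s \<in> Pow N"
    show "site_law N s * (config_entropy L + real (card s) * entropy_gain) \<le> site_law N s * (\<Sum>z\<in>?Q. entropy_fun (mixed_law L s z))"
    proof (cases "{e\<in>space sitesM. active e \<inter> N = s} = {}")
      case True
      have "site_law N s = 0" unfolding site_law_def True by simp
      then show ?thesis by simp
    next
      case False
      then have "separated s" using separated_active_Int[of _ N] by blast
      then have "config_entropy L + real (card s) * entropy_gain \<le> (\<Sum>z\<in>?Q. entropy_fun (mixed_law L s z))"
        using s NL finite_subset[OF _ N(1)] by (intro mixed_law_entropy[OF L]) auto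
      then show ?thesis using site_law_nonneg by (rule mult_left_mono)
    qed
  qed
  also have "\<dots> = (\<Sum>z\<in>?Q. \<Sum>s\<in>Pow N. site_law N s * entropy_fun (mixed_law L s z))"
    unfolding sum_distrib_left by (rule sum.swap)
  also have "\<dots> \<le> (\<Sum>z\<in>?Q. entropy_fun (\<Sum>s\<in>Pow N. site_law N s * mixed_law L s z))"
    using N by (intro sum_mono entropy_fun_concave site_law_nonneg mixed_law_nonneg site_law_total[OF N]) auto
  finally show ?thesis unfolding eq .
qed

lemma word_card:
  "finite S \<Longrightarrow> ln (real (card (S \<rightarrow>\<^sub>E A))) = real (card S) * ln (real (card A))"
proof -
  assume S: "finite S"
  obtain x where x: "x \<in> X" using not_empty by (auto simp: space_mu)
  then have "A \<noteq> {}" using X_in[OF x, of \<one>] by auto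
  then have "0 < card A" using finite_alphabet by (simp add: card_gt_0_iff)
  then show ?thesis using S by (simp add: card_PiE ln_realpow)
qed

text \<open>If \<open>h\<close> is inner for this set, then every site whose window contains
  \<open>h\<close> has its whole window inside \<open>L\<close>; the sites outside
  \<open>inner_points W L\<close> then cannot affect the letter at \<open>h\<close>.\<close>

definition window_span :: "'g set" where
  "window_span = (\<lambda>k. inv k) ` W \<union> (\<lambda>(k, k'). inv k \<otimes> k') ` (W \<times> W)"

lemma finite_window_span: "finite window_span" and window_span_carrier: "window_span \<subseteq> carrier G"
  unfolding window_span_def using finite_W W_in by auto

text \<open>Replacing \<open>resample\<close> by the resampling of the sites in \<open>inner_points W L\<close> alters only letters
  outside \<open>inner_points window_span L\<close>, at a cost of at most \<open>ln |A|\<close> for each of them.\<close>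

lemma resampled_entropy:
  assumes L: "finite L" "L \<subseteq> carrier G"
  shows "config_entropy L + real (card (inner_points W L)) * site_prob * entropy_gain
     - real (card (L - inner_points window_span L)) * ln (real (card A)) \<le> subshift_measure.config_entropy resampled L"
proof -
  interpret J: prob_space jointM by (rule prob_space_joint)
  interpret R: subshift_measure G A X resampled by (rule resampled_measure)
  let ?N = "inner_points W L" and ?L = "inner_points window_span L"
  let ?V = "window_config ?N L"
  have N: "finite ?N" "?N \<subseteq> carrier G" and L': "finite ?L" "?L \<subseteq> carrier G" "?L \<subseteq> L"
    using L by (auto simp: inner_points_def)
  have NL: "translate g W \<subseteq> L" if "g \<in> ?N" for g
    using that by (auto simp: inner_points_def translate_def)
  have sV: "simple_function jointM ?V" by (rule simple_window_config[OF N L])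
  have near: "sites_near h \<subseteq> ?N" if h: "h \<in> ?L" for h
  proof
    fix g assume "g \<in> sites_near h"
    then obtain k where k: "k \<in> W" "g = h \<otimes> inv k" by (auto simp: sites_near_def)
    have hc: "h \<in> carrier G" using h L' by auto
    have "g \<in> L" using h k by (auto simp: inner_points_def window_span_def)
    moreover have "g \<otimes> k' \<in> L" if k': "k' \<in> W" for k'
    proof -
      have "h \<otimes> (inv k \<otimes> k') \<in> L" using h k k' by (force simp: inner_points_def window_span_def)
      then show ?thesis using hc k k' W_in by (simp add: m_assoc)
    qed
    ultimately show "g \<in> ?N" by (auto simp: inner_points_def)
  qed
  have same: "restrict (resample \<omega>) ?L = restrict (?V \<omega>) ?L" if "\<omega> \<in> space jointM" for \<omega>
  proof (rule restrict_ext)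
    fix h assume h: "h \<in> ?L"
    obtain x e c where xec: "\<omega> = (x, e, c)" by (cases \<omega>) auto
    have "set_sites (active e) c x h = set_sites (active e \<inter> ?N) c x h"
      using near[OF h] h L' by (intro set_sites_local separated_active separated_active_Int) auto
    then show "resample \<omega> h = ?V \<omega> h" using h L' by (auto simp: xec resample_def window_config_def)
  qed
  have sub_sV: "simple_function jointM (\<lambda>\<omega>. restrict (?V \<omega>) S)" for S
    using simple_function_compose[OF sV, of "\<lambda>v. restrict v S"] by (simp add: comp_def)
  have "config_entropy L + real (card ?N) * site_prob * entropy_gain \<le> rv_entropy jointM ?V"
    by (rule window_config_entropy[OF N L NL])
  also have "\<dots> \<le> rv_entropy jointM (\<lambda>\<omega>. (restrict (?V \<omega>) ?L, restrict (?V \<omega>) (L - ?L)))"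
  proof (rule J.rv_entropy_factor_le)
    show "simple_function jointM (\<lambda>\<omega>. (restrict (?V \<omega>) ?L, restrict (?V \<omega>) (L - ?L)))"
      by (intro simple_function_Pair sub_sV)
    fix \<omega> \<omega>' assume w: "\<omega> \<in> space jointM" "\<omega>' \<in> space jointM"
      "(restrict (?V \<omega>) ?L, restrict (?V \<omega>) (L - ?L)) = (restrict (?V \<omega>') ?L, restrict (?V \<omega>') (L - ?L))"
    have "?V \<omega> h = ?V \<omega>' h" if "h \<in> L" for h
      using w(3) that unfolding prod.inject restrict_name_eq_iff by blast
    then show "?V \<omega> = ?V \<omega>'"
      using window_config_word[OF L w(1), of ?N] window_config_word[OF L w(2), of ?N]
      by (intro extensionalityI[of _ L]) (auto simp: PiE_def)
  qed
  also have "\<dots> \<le> rv_entropy jointM (\<lambda>\<omega>. restrict (?V \<omega>) ?L) + rv_entropy jointM (\<lambda>\<omega>. restrict (?V \<omega>) (L - ?L))"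
    by (rule J.rv_entropy_pair_le[OF sub_sV sub_sV])
  also have "rv_entropy jointM (\<lambda>\<omega>. restrict (?V \<omega>) ?L) = rv_entropy jointM (\<lambda>\<omega>. restrict (resample \<omega>) ?L)"
    by (rule rv_entropy_cong) (simp only: same)
  also have "\<dots> = R.config_entropy ?L"
    unfolding R.config_entropy_def unfolding resampled_def
    using J.rv_entropy_distr[OF resample_measurable simple_restrict[OF L'(1,2)]] by simp
  also have "R.config_entropy ?L \<le> R.config_entropy L"
    unfolding R.config_entropy_def
  proof (rule R.rv_entropy_factor_le[OF R.simple_restrict[OF L]])
    fix x y :: "'g \<Rightarrow> 'a" assume "restrict x L = restrict y L"
    then show "restrict x ?L = restrict y ?L" using L'(3) unfolding restrict_name_eq_iff by blast
  qed
  also have "rv_entropy jointM (\<lambda>\<omega>. restrict (?V \<omega>) (L - ?L)) \<le> ln (real (card ((L - ?L) \<rightarrow>\<^sub>E A)))"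
  proof (rule J.rv_entropy_le_ln_card[OF sub_sV])
    show "(\<lambda>\<omega>. restrict (?V \<omega>) (L - ?L)) ` space jointM \<subseteq> (L - ?L) \<rightarrow>\<^sub>E A"
      using window_config_word[OF L, of _ ?N] by (auto simp: PiE_def Pi_def)
    show "finite ((L - ?L) \<rightarrow>\<^sub>E A)" using L by (intro finite_words) auto
  qed
  also have "\<dots> = real (card (L - ?L)) * ln (real (card A))" using L by (intro word_card) auto
  finally show ?thesis by linarith
qed

text \<open>Divided by the size of a Foelner set, the inner points have density 1 and the boundary
  correction has density 0, so the gain per group element is \<open>entropy_gain\<close> times the
  density of active sites.\<close>

theorem entropy_rate_resampled:
  assumes am: "amenable G"
  shows "entropy_rate + site_prob * entropy_gain \<le> subshift_measure.entropy_rate G resampled"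
proof -
  interpret R: subshift_measure G A X resampled by (rule resampled_measure)
  obtain F where F: "folner_sequence G F" using am by (auto simp: amenable_def)
  have F': "finite (F n)" "F n \<subseteq> carrier G" "0 < real (card (F n))" for n
    using F by (auto simp: folner_sequence_def card_gt_0_iff)
  let ?f = "\<lambda>n. config_entropy (F n) / real (card (F n))
      + real (card (inner_points W (F n))) / real (card (F n)) * (site_prob * entropy_gain)
      - real (card (F n - inner_points window_span (F n))) / real (card (F n)) * ln (real (card A))"
  have "?f \<longlonglongrightarrow> entropy_rate + 1 * (site_prob * entropy_gain) - 0 * ln (real (card A))"
    by (intro tendsto_intros config_entropy_limit folner_inner_points inner_points_ratio F finite_W W_carrier finite_window_span window_span_carrier)
  moreover have "?f n \<le> R.config_entropy (F n) / real (card (F n))" for n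
    using divide_right_mono[OF resampled_entropy[OF F'(1,2)[of n]], of "real (card (F n))"] F'(3)[of n]
    by (simp add: add_divide_distrib diff_divide_distrib mult.assoc)
  ultimately show ?thesis
    using LIMSEQ_le[OF _ R.config_entropy_limit[OF F], of ?f] by auto
qed

end

section \<open>Energy of the resampled measure\<close>

text \<open>\<open>ennreal\<close> truncates negative values, so the hypothesis controls the
  positive part, which dominates the integral. It lets a bound obtained by Tonelli's theorem be used
  for a signed integrand.\<close>

lemma (in prob_space) integral_le_enn_bound:
  assumes f: "integrable M f" and c: "(\<integral>\<^sup>+x. ennreal (f x) \<partial>M) \<le> ennreal c" "0 \<le> c"
  shows "integral\<^sup>L M f \<le> c"
proof -
  have "integral\<^sup>L M f \<le> enn2real (\<integral>\<^sup>+x. ennreal (f x) \<partial>M)"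
    unfolding real_lebesgue_integral_def[OF f] by simp
  also have "\<dots> \<le> c" using enn2real_mono[OF c(1)] c(2) by simp
  finally show ?thesis .
qed

lemma nn_integral_count_space_infsum:
  fixes f :: "'b \<Rightarrow> real"
  assumes "f summable_on S" "\<And>x. x \<in> S \<Longrightarrow> 0 \<le> f x"
  shows "(\<integral>\<^sup>+x. ennreal (f x) \<partial>count_space S) = ennreal (infsum f S)"
proof -
  have "Infinite_Set_Sum.abs_summable_on f S"
    using assms(1) summable_on_iff_abs_summable_on_real[of f S] abs_summable_equivalent[of f S] by blast
  then show ?thesis
    using nn_integral_conv_infsetsum[of f S] assms(2) infsetsum_infsum[of f S] by simp
qed

context subshift_measure
begin

lemma potential_measurable:
  assumes "potential G A X \<phi>"
  shows "\<phi> \<in> borel_measurable \<mu>"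
proof (rule borel_measurableI)
  fix S :: "real set" assume S: "open S"
  have "openin XT {x \<in> topspace XT. \<phi> x \<in> S}"
    using assms S unfolding potential_def by (auto intro: openin_continuous_map_preimage)
  then have "{x \<in> topspace XT. \<phi> x \<in> S} \<in> sets (borel_of XT)"
    unfolding borel_of_def using openin_subset by (subst sets_measure_of) (auto intro!: sigma_sets.Basic)
  moreover have "{x \<in> topspace XT. \<phi> x \<in> S} = \<phi> -` S \<inter> space \<mu>" by (auto simp: topspace_XT space_mu)
  ultimately show "\<phi> -` S \<inter> space \<mu> \<in> sets \<mu>" by (simp add: sets_mu)
qed

end

context resampling_measure
begin

text \<open>Only \<open>s\<close> is resampled, and only if it is active for the full set of marks.
  Single updates and the complete resampling are thereby coupled through the same marks and
  choices.\<close>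

definition site_update :: "'g \<Rightarrow> ('g \<Rightarrow> 'a) \<times> ('g \<Rightarrow> bool) \<times> ('g \<Rightarrow> bool) \<Rightarrow> 'g \<Rightarrow> 'a" where
  "site_update s = (\<lambda>(x, e, c). set_sites (active e \<inter> {s}) c x)"

lemma site_update_measurable:
  assumes s: "s \<in> carrier G"
  shows "site_update s \<in> measurable jointM \<mu>"
proof (rule measurable_into_X[OF sets_mu])
  fix \<omega> assume "\<omega> \<in> space jointM"
  then show "site_update s \<omega> \<in> X"
    by (auto simp: space_joint site_update_def intro!: set_sites_X separated_active_Int)
next
  fix h a assume h: "h \<in> carrier G"
  have "site_update s \<omega> h = a \<longleftrightarrow> window_config {s} {h} \<omega> = (\<lambda>_\<in>{h}. a)" for \<omega>
    unfolding site_update_def window_config_def case_prod_beta' restrict_name_eq_iff by simp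
  then show "{\<omega> \<in> space jointM. site_update s \<omega> h = a} \<in> sets jointM"
    using window_config_law(1)[of "{s}" "{h}" "\<lambda>_\<in>{h}. a"] s h by simp
qed

lemma site_update_joint_shift:
  assumes h: "h \<in> carrier G" and s: "s \<in> carrier G" and \<omega>: "\<omega> \<in> space jointM"
  shows "site_update s (joint_shift h \<omega>) = shift G h (site_update (h \<otimes> s) \<omega>)"
proof -
  obtain x e c where xec: "\<omega> = (x, e, c)" and x: "x \<in> X" using \<omega> by (auto simp: space_joint)
  let ?S = "{g\<in>carrier G. h \<otimes> g \<in> active e \<inter> {h \<otimes> s}}"
  note sh = set_sites_shift[OF separated_active_Int[of e "{h \<otimes> s}"] h x]
  have eq: "?S = active (shift G h e) \<inter> {s}"
    using h s by (auto simp: active_shift)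
  have "set_sites ?S (shift G h c) (shift G h x) = set_sites ?S (\<lambda>g. c (h \<otimes> g)) (shift G h x)"
    by (rule set_sites_cong_choice[OF sh(2)]) simp
  also have "\<dots> = shift G h (set_sites (active e \<inter> {h \<otimes> s}) c x)" by (rule sh(1)[symmetric])
  finally show ?thesis unfolding xec site_update_def joint_shift_def prod.case eq .
qed

lemma joint_fst: "distr jointM \<mu> fst = \<mu>" and joint_fst_measurable: "fst \<in> measurable jointM \<mu>"
proof -
  interpret EC: prob_space "sitesM \<Otimes>\<^sub>M choiceM" by (rule prob_space_sites_choice)
  show m: "fst \<in> measurable jointM \<mu>" unfolding jointM_def by (rule measurable_fst)
  show "distr jointM \<mu> fst = \<mu>"
  proof (rule measure_eqI)
    fix B assume "B \<in> sets (distr jointM \<mu> fst)"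
    then have B: "B \<in> sets \<mu>" by simp
    have "fst -` B \<inter> space jointM = B \<times> space (sitesM \<Otimes>\<^sub>M choiceM)"
      using sets.sets_into_space[OF B] by (auto simp: jointM_def space_pair_measure)
    then show "emeasure (distr jointM \<mu> fst) B = emeasure \<mu> B"
      using B m EC.emeasure_pair_measure_Times[OF B sets.top] EC.emeasure_space_1
      by (simp add: emeasure_distr jointM_def)
  qed simp
qed

lemma measure_joint_box:
  assumes "S \<in> sets \<mu>" "E \<in> sets sitesM" "C \<in> sets choiceM"
  shows "S \<times> (E \<times> C) \<in> sets jointM" "measure jointM (S \<times> (E \<times> C)) = measure \<mu> S * (measure sitesM E * measure choiceM C)"
proof -
  have EC: "E \<times> C \<in> sets (sitesM \<Otimes>\<^sub>M choiceM)" using assms by (intro pair_measureI)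
  show "S \<times> (E \<times> C) \<in> sets jointM" unfolding jointM_def by (rule pair_measureI[OF assms(1) EC])
  show "measure jointM (S \<times> (E \<times> C)) = measure \<mu> S * (measure sitesM E * measure choiceM C)"
    unfolding jointM_def
    using measure_pair_Times[OF prob_space_sites_choice assms(1) EC]
      prob_space.measure_pair_Times[OF prob_space_sites prob_space_choice assms(2,3)] by simp
qed

definition updated :: "('g \<Rightarrow> 'a) \<times> ('g \<Rightarrow> bool) \<times> ('g \<Rightarrow> bool) \<Rightarrow> 'g set" where
  "updated = (\<lambda>(x, e, c). {g\<in>active e. hit g x})"

lemma measure_updated:
  assumes g: "g \<in> carrier G"
  shows "{\<omega>\<in>space jointM. g \<in> updated \<omega>} \<in> sets jointM"
    and "measure jointM {\<omega>\<in>space jointM. g \<in> updated \<omega>} = site_prob * (pattern_prob True + pattern_prob False)"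
proof -
  interpret C: prob_space choiceM by (rule prob_space_choice)
  have sets: "{x\<in>X. shows_pat b g x} \<in> sets \<mu>" for b
  proof -
    have "{x\<in>X. shows_pat b g x} = shift G g -` cyl W (pat b) \<inter> space \<mu>"
      using shows_pat_cyl[OF g] by (auto simp: space_mu)
    then show ?thesis using measurable_sets[OF shift_measurable[OF g] cyl_sets[OF finite_W W_carrier]] by simp
  qed
  have hit: "{x\<in>X. hit g x} = {x\<in>X. shows_pat True g x} \<union> {x\<in>X. shows_pat False g x}"
    by (auto simp: hit_iff)
  have mhit: "measure \<mu> {x\<in>X. hit g x} = pattern_prob True + pattern_prob False"
    unfolding hit using sets shows_pat_unique[of True g _ False]
    by (subst finite_measure_Union) (auto simp: measure_shows_pat[OF g])
  have shit: "{x\<in>X. hit g x} \<in> sets \<mu>" unfolding hit using sets by (intro sets.Un)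
  have box: "{\<omega>\<in>space jointM. g \<in> updated \<omega>} = {x\<in>X. hit g x} \<times> ({e\<in>space sitesM. g \<in> active e} \<times> space choiceM)"
    by (auto simp: updated_def space_joint space_sites space_choice)
  show "{\<omega>\<in>space jointM. g \<in> updated \<omega>} \<in> sets jointM"
    unfolding box by (rule measure_joint_box(1)[OF shit sets_active[OF g] sets.top])
  show "measure jointM {\<omega>\<in>space jointM. g \<in> updated \<omega>} = site_prob * (pattern_prob True + pattern_prob False)"
    unfolding box measure_joint_box(2)[OF shit sets_active[OF g] sets.top] mhit measure_active[OF g] C.prob_space
    by simp
qed

text \<open>Differences of points of \<open>B\<close> lie in \<open>D\<close>, so at most one site
  of \<open>B\<close> is active and the sum of the single effects is exactly the effect of
  resampling all of \<open>B\<close>. What is missing from the full resampling are updates outside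
  \<open>B\<close>, which the influence bound controls.\<close>

lemma resample_energy_pointwise:
  assumes \<beta>: "influence_bound \<phi> W \<beta>" and B: "finite B" "B \<subseteq> carrier G"
    and BD: "\<And>s s'. s \<in> B \<Longrightarrow> s' \<in> B \<Longrightarrow> s \<noteq> s' \<Longrightarrow> inv s \<otimes> s' \<in> D"
    and \<omega>: "\<omega> \<in> space jointM"
  shows "(\<Sum>s\<in>B. \<phi> (site_update s \<omega>) - \<phi> (fst \<omega>)) - (\<phi> (resample \<omega>) - \<phi> (fst \<omega>)) \<le> infsum \<beta> (updated \<omega> - B)"
proof -
  obtain x e c where xec: "\<omega> = (x, e, c)" and x: "x \<in> X" using \<omega> by (auto simp: space_joint)
  let ?y = "set_sites (active e \<inter> B) c x"
  have y: "?y \<in> X" by (rule set_sites_X[OF separated_active_Int x])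
  have "(\<Sum>s\<in>B. \<phi> (site_update s \<omega>) - \<phi> x) = \<phi> ?y - \<phi> x"
  proof (cases "active e \<inter> B = {}")
    case True
    then have "site_update s \<omega> = x" if "s \<in> B" for s
    proof -
      have "active e \<inter> {s} = {}" using True that by blast
      then show ?thesis by (simp add: xec site_update_def set_sites_empty)
    qed
    then show ?thesis using True by (simp add: set_sites_empty)
  next
    case False
    then obtain s0 where s0: "s0 \<in> active e" "s0 \<in> B" by blast
    have uniq: "s = s0" if "s \<in> active e" "s \<in> B" for s
      using active_separation[OF s0(1) that(1)] BD[OF s0(2) that(2)] by blast
    then have eq: "active e \<inter> B = {s0}" using s0 by blast
    have "site_update s \<omega> = (if s = s0 then ?y else x)" if "s \<in> B" for s
    proof -
      have "active e \<inter> {s} = (if s = s0 then active e \<inter> B else {})"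
      proof (cases "s = s0")
        case True
        then show ?thesis using s0 eq by simp
      next
        case False
        then have "s \<notin> active e" using uniq that by blast
        then show ?thesis using False by simp
      qed
      then show ?thesis by (simp add: xec site_update_def set_sites_empty)
    qed
    then have "(\<Sum>s\<in>B. \<phi> (site_update s \<omega>) - \<phi> x) = (\<Sum>s\<in>B. if s = s0 then \<phi> ?y - \<phi> x else 0)"
      by (intro sum.cong) auto
    then show ?thesis using s0 B by simp
  qed
  moreover have "\<bar>\<phi> ?y - \<phi> (resample \<omega>)\<bar> \<le> infsum \<beta> (updated \<omega> - B)"
  proof (rule influence_boundD[OF \<beta> _ y])
    show "updated \<omega> - B \<subseteq> carrier G" by (auto simp: updated_def xec active_def)
    show "resample \<omega> \<in> X" unfolding xec by (rule resample_X[OF x])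
    fix h assume h: "h \<in> carrier G - (\<Union>s\<in>updated \<omega> - B. translate s W)"
    show "?y h = resample \<omega> h"
    proof (cases "\<exists>g\<in>active e. h \<in> translate g W")
      case True
      then obtain g where g: "g \<in> active e" "h \<in> translate g W" by blast
      have r: "resample \<omega> h = (if hit g x then pat (c g) (inv g \<otimes> h) else x h)"
        unfolding xec resample_def prod.case by (rule set_sites_in[OF separated_active g])
      show ?thesis
      proof (cases "g \<in> B")
        case True
        then have "g \<in> active e \<inter> B" using g by blast
        then show ?thesis unfolding r using set_sites_in[OF separated_active_Int _ g(2)] by simp
      next
        case False
        then have "\<not> hit g x" using h g by (auto simp: updated_def xec)
        moreover have "?y h = x h"
        proof (rule set_sites_out)
          fix g' assume "g' \<in> active e \<inter> B"
          then show "h \<notin> translate g' W" using separatedD[OF separated_active, of g' e g h] g False by blast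
        qed
        ultimately show ?thesis unfolding r by simp
      qed
    next
      case False
      have "?y h = x h" by (rule set_sites_out) (use False in blast)
      moreover have "set_sites (active e) c x h = x h" by (rule set_sites_out) (use False in blast)
      ultimately show ?thesis unfolding xec resample_def prod.case by simp
    qed
  qed
  ultimately show ?thesis by (simp add: xec)
qed

lemma bounded_integrable:
  assumes \<phi>: "potential G A X \<phi>" and m: "f \<in> measurable jointM \<mu>"
  shows "integrable jointM (\<lambda>\<omega>. \<phi> (f \<omega>))"
proof -
  interpret J: prob_space jointM by (rule prob_space_joint)
  obtain c where c: "\<And>x. x \<in> X \<Longrightarrow> \<bar>\<phi> x\<bar> \<le> c" using potential_bounded[OF \<phi>] by auto
  show ?thesis
  proof (rule J.integrable_const_bound[of _ c])
    show "AE \<omega> in jointM. norm (\<phi> (f \<omega>)) \<le> c"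
      using measurable_space[OF m] c by (intro AE_I2) (auto simp: space_mu)
    show "(\<lambda>\<omega>. \<phi> (f \<omega>)) \<in> borel_measurable jointM"
      by (rule measurable_compose[OF m potential_measurable[OF \<phi>]])
  qed
qed

text \<open>The identity is active, shows pattern \<open>b\<close>, and draws the other pattern.
  Only on these two events does the update at the identity change anything.\<close>

definition flip_event :: "bool \<Rightarrow> (('g \<Rightarrow> 'a) \<times> ('g \<Rightarrow> bool) \<times> ('g \<Rightarrow> bool)) set" where
  "flip_event b = cyl W (pat b) \<times> ({e\<in>space sitesM. \<one> \<in> active e} \<times>
     {d\<in>space choiceM. restrict d {\<one>} = (\<lambda>_\<in>{\<one>}. \<not> b)})"

lemma flip_event_sets: "flip_event b \<in> sets jointM"
  and measure_flip_event: "measure jointM (flip_event b) = pattern_prob b * (site_prob * weight (\<not> b))"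
proof -
  have ch: "{d\<in>space choiceM. restrict d {\<one>} = (\<lambda>_\<in>{\<one>}. b)} \<in> sets choiceM"
    "measure choiceM {d\<in>space choiceM. restrict d {\<one>} = (\<lambda>_\<in>{\<one>}. b)} = weight b" for b
    using choice_cylinder[of "{\<one>}" "\<lambda>_\<in>{\<one>}. b"] by (simp_all add: choice_prob_def)
  note box = measure_joint_box[OF cyl_sets[OF finite_W W_carrier] sets_active[OF one_closed] ch(1)]
  show "flip_event b \<in> sets jointM" unfolding flip_event_def by (rule box(1))
  show "measure jointM (flip_event b) = pattern_prob b * (site_prob * weight (\<not> b))"
    unfolding flip_event_def box(2) ch(2) pattern_prob_def site_prob_def ..
qed

text \<open>Replacing \<open>w\<close> by \<open>w'\<close> contributes about \<open>t\<close>,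
  replacing \<open>w'\<close> by \<open>w\<close> about \<open>- t\<close>, and all other cases
  contribute nothing.\<close>

lemma flip_energy_pointwise:
  fixes \<phi> :: "('g \<Rightarrow> 'a) \<Rightarrow> real"
  assumes t: "\<And>x. x \<in> cyl W w \<Longrightarrow> \<bar>(\<Sum>s\<in>B. \<phi> (shift G (inv s) (patch W w' x)) - \<phi> (shift G (inv s) x)) - t\<bar> \<le> \<eta>"
    and \<omega>: "\<omega> \<in> space jointM"
  shows "indicator (flip_event True) \<omega> * (t - \<eta>) + indicator (flip_event False) \<omega> * (- t - \<eta>)
    \<le> (\<Sum>s\<in>B. \<phi> (shift G (inv s) (site_update \<one> \<omega>)) - \<phi> (shift G (inv s) (fst \<omega>)))"
proof -
  obtain x e c where xec: "\<omega> = (x, e, c)" and x: "x \<in> X" and ec: "e \<in> space sitesM" "c \<in> space choiceM"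
    using \<omega> by (auto simp: space_joint space_sites space_choice)
  have patch: "patch_site \<one> b x = patch W (pat b) x" for b
    unfolding patch_site_def patch_def translate_def using W_in by (auto simp: fun_eq_iff image_iff)
  have show_cyl: "shows_pat b \<one> x \<longleftrightarrow> x \<in> cyl W (pat b)" for b
    using shows_pat_cyl[OF one_closed x] shift_one[OF X_ext[OF x]] by simp
  have inE: "\<omega> \<in> flip_event b \<longleftrightarrow> shows_pat b \<one> x \<and> \<one> \<in> active e \<and> c \<one> = (\<not> b)" for b
    using ec by (auto simp: flip_event_def xec show_cyl restrict_name_eq_iff)
  show ?thesis
  proof (cases "\<one> \<in> active e \<and> hit \<one> x")
    case False
    then have "\<omega> \<notin> flip_event b" for b using inE by (auto simp: hit_def)
    moreover have "site_update \<one> \<omega> = x"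
    proof (cases "\<one> \<in> active e")
      case True
      then have "active e \<inter> {\<one>} = insert \<one> {}" by blast
      then show ?thesis using False True set_sites_insert[of \<one> "{}" c x] separated_active_Int[of e "{\<one>}"]
        by (simp add: xec site_update_def set_sites_empty)
    next
      case False
      then have "active e \<inter> {\<one>} = {}" by blast
      then show ?thesis by (simp add: xec site_update_def set_sites_empty)
    qed
    ultimately show ?thesis by (simp add: xec)
  next
    case True
    then obtain b where b: "shows_pat b \<one> x" by (auto simp: hit_def)
    have "active e \<inter> {\<one>} = insert \<one> {}" using True by blast
    then have up: "site_update \<one> \<omega> = patch W (pat (c \<one>)) x"
      using True set_sites_insert[of \<one> "{}" c x] separated_active_Int[of e "{\<one>}"]
      by (simp add: xec site_update_def set_sites_empty patch)
    have xc: "x \<in> cyl W (pat b)" using b show_cyl by simp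
    have same: "patch W (pat b) x = x" using patch_site_eq[OF one_closed b] patch by simp
    have other: "\<omega> \<notin> flip_event (\<not> b)" using inE[of "\<not> b"] shows_pat_unique[OF b, of "\<not> b"] by blast
    show ?thesis
    proof (cases "c \<one> = b")
      case True
      then have "\<omega> \<notin> flip_event b" using inE by simp
      then have "\<omega> \<notin> flip_event True" "\<omega> \<notin> flip_event False" using other by (cases b; simp)+
      then show ?thesis using up True same by (simp add: xec)
    next
      case False
      then have c: "c \<one> = (\<not> b)" by simp
      have inb: "\<omega> \<in> flip_event b" using inE b True c by simp
      show ?thesis
      proof (cases b)
        case True
        then have "\<omega> \<in> flip_event True" "\<omega> \<notin> flip_event False" using inb other by simp_all
        moreover have "x \<in> cyl W w" "site_update \<one> \<omega> = patch W w' x" using xc up c True by (simp_all add: pat_def)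
        ultimately show ?thesis using t[of x] by (simp add: xec)
      next
        case False
        then have "\<omega> \<notin> flip_event True" "\<omega> \<in> flip_event False" using inb other by simp_all
        moreover have xw: "x \<in> cyl W w'" and up': "site_update \<one> \<omega> = patch W w x" using xc up c False by (simp_all add: pat_def)
        let ?y = "patch W w x"
        have "?y \<in> X" using inter xw by (simp add: interchangeable_def)
        then have yc: "?y \<in> cyl W w"
          using w_PiE by (auto simp: cyl_def patch_def PiE_def restrict_eq_iff)
        have "patch W w' ?y = patch W (pat b) x" using False by (simp add: patch_def pat_def fun_eq_iff)
        \<comment> \<open>The reverse flip is undone by the forward one, so the hypothesis on
          \<open>cyl W w\<close> applies to the flipped configuration, with the opposite
          sign.\<close>
        then have restored: "patch W w' ?y = x" using same by simp
        have "\<bar>(\<Sum>s\<in>B. \<phi> (shift G (inv s) x) - \<phi> (shift G (inv s) ?y)) - t\<bar> \<le> \<eta>" using t[OF yc] restored by simp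
        moreover have "(\<Sum>s\<in>B. \<phi> (shift G (inv s) x) - \<phi> (shift G (inv s) ?y)) = - (\<Sum>s\<in>B. \<phi> (shift G (inv s) ?y) - \<phi> (shift G (inv s) x))"
          by (simp add: sum_negf[symmetric])
        ultimately show ?thesis using up' by (simp add: xec)
      qed
    qed
  qed
qed

text \<open>By invariance, the expected effect at the identity of resampling the site \<open>s\<close> equals the expected effect at
  \<open>inv s\<close> of resampling the identity; summed over \<open>s\<close> in \<open>B\<close> this is the cocycle of a single swap.\<close>

lemma resample_energy:
  assumes \<phi>: "potential G A X \<phi>" and \<beta>: "influence_bound \<phi> W \<beta>" and B: "finite B" "B \<subseteq> carrier G"
    and BD: "\<And>s s'. s \<in> B \<Longrightarrow> s' \<in> B \<Longrightarrow> s \<noteq> s' \<Longrightarrow> inv s \<otimes> s' \<in> D"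
    and tail: "infsum \<beta> (carrier G - B) \<le> \<eta>"
    and t: "\<And>x. x \<in> cyl W w \<Longrightarrow> \<bar>(\<Sum>s\<in>B. \<phi> (shift G (inv s) (patch W w' x)) - \<phi> (shift G (inv s) x)) - t\<bar> \<le> \<eta>"
  shows "site_prob * ((pattern_prob True * (1 - q) - pattern_prob False * q) * t
      - 2 * \<eta> * (pattern_prob True + pattern_prob False)) \<le> integral\<^sup>L resampled \<phi> - integral\<^sup>L \<mu> \<phi>"
proof -
  interpret J: prob_space jointM by (rule prob_space_joint)
  let ?a = "pattern_prob True" and ?b = "pattern_prob False"
  let ?ab = "?a + ?b"
  have ab: "0 \<le> ?a" "0 \<le> ?b" by (simp_all add: pattern_prob_def)
  have \<beta>0: "\<And>s. s \<in> carrier G \<Longrightarrow> 0 \<le> \<beta> s" and \<beta>s: "\<beta> summable_on carrier G"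
    using \<beta> by (auto simp: influence_bound_def)
  have "0 \<le> infsum \<beta> (carrier G - B)" using \<beta>0 by (intro infsum_nonneg) auto
  then have \<eta>: "0 \<le> \<eta>" using tail by simp
  note int = bounded_integrable[OF \<phi>]
  note int_res = int[OF resample_measurable] and int_fst = int[OF joint_fst_measurable]
  have int_site: "integrable jointM (\<lambda>\<omega>. \<phi> (site_update s \<omega>))" if "s \<in> B" for s
    using int[OF site_update_measurable, of s] that B by blast
  have e_res: "integral\<^sup>L resampled \<phi> = (\<integral>\<omega>. \<phi> (resample \<omega>) \<partial>jointM)"
    unfolding resampled_def by (rule integral_distr[OF resample_measurable potential_measurable[OF \<phi>]])
  have e_mu: "integral\<^sup>L \<mu> \<phi> = (\<integral>\<omega>. \<phi> (fst \<omega>) \<partial>jointM)"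
    using integral_distr[OF joint_fst_measurable potential_measurable[OF \<phi>]] by (simp add: joint_fst)
  let ?f = "\<lambda>\<omega>. (\<Sum>s\<in>B. \<phi> (site_update s \<omega>) - \<phi> (fst \<omega>)) - (\<phi> (resample \<omega>) - \<phi> (fst \<omega>))"
  have int_f: "integrable jointM ?f"
    by (intro Bochner_Integration.integrable_diff Bochner_Integration.integrable_sum int_site int_fst int_res)
  \<comment> \<open>The pointwise error sums \<beta> over the updated sites outside
    \<open>B\<close>. After interchanging sum and expectation, each \<open>\<beta> s\<close> is
    weighted by the probability that \<open>s\<close> is updated; this puts both the density of
    sites and the pattern probabilities into the error.\<close>
  have f_le: "integral\<^sup>L jointM ?f \<le> site_prob * ?ab * \<eta>"
  proof (rule J.integral_le_enn_bound[OF int_f])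
    have cnt: "countable (carrier G - B)" using countable_carrier by (rule countable_subset[rotated]) blast
    have "(\<integral>\<^sup>+\<omega>. ennreal (?f \<omega>) \<partial>jointM) \<le> (\<integral>\<^sup>+\<omega>. (\<integral>\<^sup>+s. ennreal (\<beta> s) * indicator {\<omega>\<in>space jointM. s \<in> updated \<omega>} \<omega> \<partial>count_space (carrier G - B)) \<partial>jointM)"
    proof (rule nn_integral_mono)
      fix \<omega> assume \<omega>: "\<omega> \<in> space jointM"
      have sub: "updated \<omega> - B \<subseteq> carrier G - B" by (auto simp: updated_def active_def split: prod.splits)
      have "ennreal (?f \<omega>) \<le> ennreal (infsum \<beta> (updated \<omega> - B))"
        using resample_energy_pointwise[OF \<beta> B BD \<omega>] by (rule ennreal_leI)
      also have "\<dots> = (\<integral>\<^sup>+s. ennreal (\<beta> s) \<partial>count_space (updated \<omega> - B))"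
        using sub \<beta>0 \<beta>s by (intro nn_integral_count_space_infsum[symmetric]) (auto intro: summable_on_subset_banach)
      also have "\<dots> = (\<integral>\<^sup>+s. ennreal (\<beta> s) * indicator (updated \<omega> - B) s \<partial>count_space (carrier G - B))"
      proof -
        have "count_space (updated \<omega> - B) = restrict_space (count_space (carrier G - B)) (updated \<omega> - B)"
          unfolding restrict_count_space Int_absorb2[OF sub] ..
        then show ?thesis using sub by (simp add: nn_integral_restrict_space)
      qed
      also have "\<dots> = (\<integral>\<^sup>+s. ennreal (\<beta> s) * indicator {\<omega>\<in>space jointM. s \<in> updated \<omega>} \<omega> \<partial>count_space (carrier G - B))"
        using \<omega> by (intro nn_integral_cong) (auto simp: indicator_def)
      finally show "ennreal (?f \<omega>) \<le> \<dots>" .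
    qed
    also have "\<dots> = (\<integral>\<^sup>+s. (\<integral>\<^sup>+\<omega>. ennreal (\<beta> s) * indicator {\<omega>\<in>space jointM. s \<in> updated \<omega>} \<omega> \<partial>jointM) \<partial>count_space (carrier G - B))"
      using measure_updated(1) by (intro nn_integral_count_space_nn_integral cnt) auto
    also have "\<dots> = (\<integral>\<^sup>+s. ennreal (\<beta> s * (site_prob * ?ab)) \<partial>count_space (carrier G - B))"
    proof (rule nn_integral_cong)
      fix s assume "s \<in> space (count_space (carrier G - B))"
      then have s: "s \<in> carrier G" by simp
      have "(\<integral>\<^sup>+\<omega>. ennreal (\<beta> s) * indicator {\<omega>\<in>space jointM. s \<in> updated \<omega>} \<omega> \<partial>jointM)
          = ennreal (\<beta> s) * emeasure jointM {\<omega>\<in>space jointM. s \<in> updated \<omega>}"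
        using measure_updated(1)[OF s] by (rule nn_integral_cmult_indicator)
      also have "\<dots> = ennreal (\<beta> s * (site_prob * ?ab))"
        using \<beta>0[OF s] by (simp add: J.emeasure_eq_measure measure_updated(2)[OF s] ennreal_mult')
      finally show "(\<integral>\<^sup>+\<omega>. ennreal (\<beta> s) * indicator {\<omega>\<in>space jointM. s \<in> updated \<omega>} \<omega> \<partial>jointM) = ennreal (\<beta> s * (site_prob * ?ab))" .
    qed
    also have "\<dots> = ennreal (infsum (\<lambda>s. \<beta> s * (site_prob * ?ab)) (carrier G - B))"
      using \<beta>0 ab site_prob_pos
      by (intro nn_integral_count_space_infsum summable_on_cmult_left summable_on_subset_banach[OF \<beta>s]) auto
    also have "infsum (\<lambda>s. \<beta> s * (site_prob * ?ab)) (carrier G - B) = infsum \<beta> (carrier G - B) * (site_prob * ?ab)"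
      by (intro infsum_cmult_left summable_on_subset_banach[OF \<beta>s]) auto
    also have "ennreal \<dots> \<le> ennreal (site_prob * ?ab * \<eta>)"
    proof (rule ennreal_leI)
      have "infsum \<beta> (carrier G - B) * (site_prob * ?ab) \<le> \<eta> * (site_prob * ?ab)"
        using tail ab site_prob_pos by (intro mult_right_mono) auto
      then show "infsum \<beta> (carrier G - B) * (site_prob * ?ab) \<le> site_prob * ?ab * \<eta>" by (simp only: mult_ac)
    qed
    finally show "(\<integral>\<^sup>+\<omega>. ennreal (?f \<omega>) \<partial>jointM) \<le> ennreal (site_prob * ?ab * \<eta>)" .
    show "0 \<le> site_prob * ?ab * \<eta>" using ab site_prob_pos \<eta> by simp
  qed
  let ?H = "\<lambda>\<omega>. \<Sum>s\<in>B. \<phi> (shift G (inv s) (site_update \<one> \<omega>)) - \<phi> (shift G (inv s) (fst \<omega>))"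
  have shm: "(\<lambda>\<omega>. shift G (inv s) (g \<omega>)) \<in> measurable jointM \<mu>" if "s \<in> B" "g \<in> measurable jointM \<mu>" for s g
    using that B by (intro measurable_compose[OF that(2) shift_measurable]) auto
  have int_H: "integrable jointM ?H"
    by (intro Bochner_Integration.integrable_sum Bochner_Integration.integrable_diff int shm
        site_update_measurable joint_fst_measurable one_closed)
  \<comment> \<open>Invariance of the joint measure under \<open>inv s\<close> moves the resampled
    site from \<open>s\<close> to the identity and the point of observation from the identity to
    \<open>inv s\<close>.\<close>
  have move: "(\<integral>\<omega>. \<phi> (site_update s \<omega>) - \<phi> (fst \<omega>) \<partial>jointM) = (\<integral>\<omega>. \<phi> (shift G (inv s) (site_update \<one> \<omega>)) - \<phi> (shift G (inv s) (fst \<omega>)) \<partial>jointM)"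
    if s: "s \<in> B" for s
  proof -
    have sc: "s \<in> carrier G" "inv s \<in> carrier G" using s B by auto
    have meas: "(\<lambda>\<omega>. \<phi> (site_update s \<omega>) - \<phi> (fst \<omega>)) \<in> borel_measurable jointM"
      using int_site[OF s] int_fst by (intro borel_measurable_diff) auto
    have "(\<integral>\<omega>. \<phi> (site_update s \<omega>) - \<phi> (fst \<omega>) \<partial>jointM) = (\<integral>\<omega>. \<phi> (site_update s \<omega>) - \<phi> (fst \<omega>) \<partial>distr jointM jointM (joint_shift (inv s)))"
      by (simp add: joint_invariant[OF sc(2)])
    also have "\<dots> = (\<integral>\<omega>. \<phi> (site_update s (joint_shift (inv s) \<omega>)) - \<phi> (fst (joint_shift (inv s) \<omega>)) \<partial>jointM)"
      by (rule integral_distr[OF joint_shift_measurable[OF sc(2)] meas])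
    also have "\<dots> = (\<integral>\<omega>. \<phi> (shift G (inv s) (site_update \<one> \<omega>)) - \<phi> (shift G (inv s) (fst \<omega>)) \<partial>jointM)"
    proof (rule Bochner_Integration.integral_cong[OF refl])
      fix \<omega> assume "\<omega> \<in> space jointM"
      then have "site_update s (joint_shift (inv s) \<omega>) = shift G (inv s) (site_update \<one> \<omega>)"
        using site_update_joint_shift[OF sc(2,1)] sc(1) by simp
      moreover have "fst (joint_shift (inv s) \<omega>) = shift G (inv s) (fst \<omega>)"
        by (simp add: joint_shift_def case_prod_beta')
      ultimately show "\<phi> (site_update s (joint_shift (inv s) \<omega>)) - \<phi> (fst (joint_shift (inv s) \<omega>))
          = \<phi> (shift G (inv s) (site_update \<one> \<omega>)) - \<phi> (shift G (inv s) (fst \<omega>))" by simp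
    qed
    finally show ?thesis .
  qed
  have "integral\<^sup>L jointM ?f = (\<Sum>s\<in>B. \<integral>\<omega>. \<phi> (site_update s \<omega>) - \<phi> (fst \<omega>) \<partial>jointM) - (integral\<^sup>L resampled \<phi> - integral\<^sup>L \<mu> \<phi>)"
  proof -
    have int_diff: "integrable jointM (\<lambda>\<omega>. \<phi> (site_update s \<omega>) - \<phi> (fst \<omega>))" if "s \<in> B" for s
      by (rule Bochner_Integration.integrable_diff[OF int_site[OF that] int_fst])
    have "integral\<^sup>L jointM ?f = (\<integral>\<omega>. (\<Sum>s\<in>B. \<phi> (site_update s \<omega>) - \<phi> (fst \<omega>)) \<partial>jointM) - (\<integral>\<omega>. \<phi> (resample \<omega>) - \<phi> (fst \<omega>) \<partial>jointM)"
      by (rule Bochner_Integration.integral_diff[OF Bochner_Integration.integrable_sum[OF int_diff]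
            Bochner_Integration.integrable_diff[OF int_res int_fst]])
    also have "(\<integral>\<omega>. (\<Sum>s\<in>B. \<phi> (site_update s \<omega>) - \<phi> (fst \<omega>)) \<partial>jointM) = (\<Sum>s\<in>B. \<integral>\<omega>. \<phi> (site_update s \<omega>) - \<phi> (fst \<omega>) \<partial>jointM)"
      by (rule Bochner_Integration.integral_sum[OF int_diff])
    also have "(\<integral>\<omega>. \<phi> (resample \<omega>) - \<phi> (fst \<omega>) \<partial>jointM) = integral\<^sup>L resampled \<phi> - integral\<^sup>L \<mu> \<phi>"
      unfolding e_res e_mu by (rule Bochner_Integration.integral_diff[OF int_res int_fst])
    finally show ?thesis .
  qed
  also have "(\<Sum>s\<in>B. \<integral>\<omega>. \<phi> (site_update s \<omega>) - \<phi> (fst \<omega>) \<partial>jointM) = integral\<^sup>L jointM ?H"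
  proof -
    have "integral\<^sup>L jointM ?H = (\<Sum>s\<in>B. \<integral>\<omega>. \<phi> (shift G (inv s) (site_update \<one> \<omega>)) - \<phi> (shift G (inv s) (fst \<omega>)) \<partial>jointM)"
      by (intro Bochner_Integration.integral_sum Bochner_Integration.integrable_diff int shm
          site_update_measurable joint_fst_measurable one_closed)
    then show ?thesis using move by simp
  qed
  finally have main: "integral\<^sup>L jointM ?H - site_prob * ?ab * \<eta> \<le> integral\<^sup>L resampled \<phi> - integral\<^sup>L \<mu> \<phi>"
    using f_le by linarith
  let ?E = flip_event
  note E = flip_event_sets measure_flip_event
  \<comment> \<open>The probability of a flip is \<open>site_prob\<close> times the pattern
    probability times the weight of the opposite pattern, which produces the coefficient of
    \<open>t\<close> in the claim.\<close>
  let ?low = "\<lambda>\<omega>. indicator (?E True) \<omega> * (t - \<eta>) + indicator (?E False) \<omega> * (- t - \<eta>)"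
  have low_le: "?low \<omega> \<le> ?H \<omega>" if "\<omega> \<in> space jointM" for \<omega>
    by (rule flip_energy_pointwise[OF t that])
  have int_ind: "integrable jointM (\<lambda>\<omega>. indicator (?E b) \<omega> * r)" for b and r :: real
    using E(1) by (intro integrable_mult_left integrable_real_indicator) (simp_all add: J.emeasure_eq_measure)
  have "integral\<^sup>L jointM ?low \<le> integral\<^sup>L jointM ?H"
    by (intro integral_mono int_H Bochner_Integration.integrable_add int_ind low_le)
  moreover have "integral\<^sup>L jointM ?low = measure jointM (?E True) * (t - \<eta>) + measure jointM (?E False) * (- t - \<eta>)"
    using E(1) sets.sets_into_space[OF E(1)]
    by (subst Bochner_Integration.integral_add[OF int_ind int_ind]) (simp add: Int_absorb2)
  ultimately have "?a * (site_prob * (1 - q)) * (t - \<eta>) + ?b * (site_prob * q) * (- t - \<eta>) \<le> integral\<^sup>L jointM ?H"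
    by (simp add: E(2) weight_def)
  moreover have "site_prob * ((?a * (1 - q) - ?b * q) * t - ?ab * \<eta>) \<le> ?a * (site_prob * (1 - q)) * (t - \<eta>) + ?b * (site_prob * q) * (- t - \<eta>)"
  proof -
    have "?a * (1 - q) * \<eta> + ?b * q * \<eta> \<le> ?a * 1 * \<eta> + ?b * 1 * \<eta>"
      using q ab \<eta> by (intro add_mono mult_right_mono mult_left_mono) auto
    then have "site_prob * (?a * (1 - q) * \<eta> + ?b * q * \<eta>) \<le> site_prob * (?ab * \<eta>)"
      using site_prob_pos by (intro mult_left_mono) (auto simp: algebra_simps)
    then show ?thesis by (simp add: algebra_simps)
  qed
  ultimately show ?thesis using main by (simp add: algebra_simps)
qed

end

section \<open>Local homeomorphisms as pattern swaps\<close>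

context subshift_system
begin

lemma patch_on: "h \<in> W \<Longrightarrow> patch W w x h = w h" and patch_off: "h \<notin> W \<Longrightarrow> patch W w x h = x h"
  by (simp_all add: patch_def)

lemma interchangeableD:
  assumes "interchangeable W w w'"
  shows "finite W" "W \<subseteq> carrier G" "w \<in> W \<rightarrow>\<^sub>E A" "w' \<in> W \<rightarrow>\<^sub>E A"
    "x \<in> cyl W w \<Longrightarrow> patch W w' x \<in> cyl W w'" "x \<in> cyl W w' \<Longrightarrow> patch W w x \<in> cyl W w"
    "x \<in> cyl W w \<Longrightarrow> patch W w (patch W w' x) = x"
proof -
  show 1: "finite W" "W \<subseteq> carrier G" "w \<in> W \<rightarrow>\<^sub>E A" "w' \<in> W \<rightarrow>\<^sub>E A"
    using assms by (auto simp: interchangeable_def)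
  then have ext: "w \<in> extensional W" "w' \<in> extensional W" by (auto simp: PiE_def)
  show "x \<in> cyl W w \<Longrightarrow> patch W w' x \<in> cyl W w'" "x \<in> cyl W w' \<Longrightarrow> patch W w x \<in> cyl W w"
    using assms ext by (auto simp: interchangeable_def cyl_def restrict_eq_iff patch_on)
  assume "x \<in> cyl W w"
  then have "\<forall>h\<in>W. x h = w h" using restrict_eq_iff[OF ext(1)] by (simp add: cyl_def)
  then show "patch W w (patch W w' x) = x" by (auto simp: patch_def)
qed

lemma patch_cyl:
  assumes I: "interchangeable W w w'" and x: "x \<in> cyl W w"
  shows "patch W w x = x"
proof -
  have "patch W w (patch W w' x) = patch W w x" by (auto simp: patch_def)
  then show ?thesis using interchangeableD(7)[OF I x] by simp
qed

lemma interchangeable_sym: "interchangeable W w w' \<Longrightarrow> interchangeable W w' w"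
  by (auto simp: interchangeable_def)

text \<open>Cylinders can be refined without changing the swap: on the larger window the two words
  still differ only inside \<open>W\<close>, so exchanging them is the same as exchanging
  \<open>w\<close> and \<open>w'\<close>.\<close>

lemma interchangeable_extend:
  assumes I: "interchangeable W w w'" and V: "finite V" "V \<subseteq> carrier G" "W \<subseteq> V" and x0: "x0 \<in> cyl W w"
  defines "v \<equiv> restrict x0 V" and "v' \<equiv> restrict (patch W w' x0) V"
  shows "interchangeable V v v'"
    and "x \<in> cyl V v \<Longrightarrow> x \<in> cyl W w \<and> patch V v' x = patch W w' x"
    and "x \<in> cyl V v' \<Longrightarrow> x \<in> cyl W w' \<and> patch V v x = patch W w x"
proof -
  note ID = interchangeableD[OF I]
  have ext: "w \<in> extensional W" "w' \<in> extensional W" using ID(3,4) by (auto simp: PiE_def)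
  have x0X: "x0 \<in> X" and x0w: "\<And>h. h \<in> W \<Longrightarrow> x0 h = w h"
    using x0 restrict_eq_iff[OF ext(1)] by (auto simp: cyl_def)
  have y0X: "patch W w' x0 \<in> X" using ID(5)[OF x0] by (simp add: cyl_def)
  show a: "x \<in> cyl W w \<and> patch V v' x = patch W w' x" if "x \<in> cyl V v" for x
  proof -
    have x: "x \<in> X" "\<And>h. h \<in> V \<Longrightarrow> x h = x0 h"
      using that unfolding cyl_def v_def restrict_name_eq_iff by auto
    then have "x \<in> cyl W w" using V x0w by (auto simp: cyl_def restrict_eq_iff[OF ext(1)])
    moreover have "patch V v' x h = patch W w' x h" for h
      using V x(2) by (cases "h \<in> V"; cases "h \<in> W") (auto simp: patch_def v'_def)
    ultimately show ?thesis by auto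
  qed
  show b: "x \<in> cyl W w' \<and> patch V v x = patch W w x" if "x \<in> cyl V v'" for x
  proof -
    have x: "x \<in> X" "\<And>h. h \<in> V \<Longrightarrow> x h = patch W w' x0 h"
      using that unfolding cyl_def v'_def restrict_name_eq_iff by auto
    then have "x \<in> cyl W w'" using V by (auto simp: cyl_def restrict_eq_iff[OF ext(2)] patch_on)
    moreover have "patch V v x h = patch W w x h" for h
      using V x(2)[of h] x0w[of h] by (cases "h \<in> V"; cases "h \<in> W") (auto simp: patch_def v_def)
    ultimately show ?thesis by auto
  qed
  have "(V, v) \<in> patterns" "(V, v') \<in> patterns"
    unfolding v_def v'_def by (rule restrict_pattern; fact)+
  then show "interchangeable V v v'"
    unfolding interchangeable_def using V a b ID(5,6) by (auto simp: patterns_def cyl_def)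
qed

lemma cocycle_self: "potential_cocycle G \<phi> x x = 0"
  by (simp add: potential_cocycle_def)

text \<open>The finite approximation with no term retained.\<close>

lemma cocycle_bound:
  assumes \<beta>: "influence_bound \<phi> W \<beta>" and I: "interchangeable W w w'" and x: "x \<in> cyl W w"
  shows "\<bar>potential_cocycle G \<phi> x (patch W w' x)\<bar> \<le> infsum \<beta> (carrier G)"
proof -
  have "patch W w' x \<in> X" "x \<in> X" using interchangeableD(5)[OF I x] x by (auto simp: cyl_def)
  then show ?thesis
    using cocycle_finite_approx[OF \<beta> interchangeableD(2)[OF I], of x "patch W w' x" "{}"] by (simp add: patch_off)
qed

text \<open>The cocycle is truncated to finitely many shifts at a uniform cost, and each retained
  term depends on a finite window up to a small error. The two truncations cost \<epsilon>/4 each,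
  the retained terms \<epsilon>/2.\<close>

lemma cocycle_uniform:
  assumes \<phi>: "potential G A X \<phi>" and \<beta>: "influence_bound \<phi> W \<beta>" and I: "interchangeable W w w'" and \<epsilon>: "\<epsilon> > 0"
  shows "\<exists>V. finite V \<and> V \<subseteq> carrier G \<and> W \<subseteq> V \<and> (\<forall>x\<in>cyl W w. \<forall>y\<in>cyl W w. restrict x V = restrict y V \<longrightarrow>
     \<bar>potential_cocycle G \<phi> x (patch W w' x) - potential_cocycle G \<phi> y (patch W w' y)\<bar> \<le> \<epsilon>)"
proof -
  note ID = interchangeableD[OF I]
  have "\<exists>B. finite B \<and> B \<subseteq> carrier G \<and> infsum \<beta> (carrier G - B) \<le> \<epsilon> / 4"
    using \<beta> \<epsilon> by (intro nonneg_infsum_tail) (auto simp: influence_bound_def)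
  then obtain B where B: "finite B" "B \<subseteq> carrier G" "infsum \<beta> (carrier G - B) \<le> \<epsilon> / 4" by blast
  \<comment> \<open>Each term compares two pairs of configurations and varies by at most
    \<open>2 * \<delta>\<close>, so the \<open>card B\<close> terms vary by at most
    \<epsilon>/2.\<close>
  define \<delta> where "\<delta> = \<epsilon> / (4 * (real (card B) + 1))"
  have "\<delta> > 0" using \<epsilon> by (simp add: \<delta>_def)
  then obtain U where U: "finite U" "U \<subseteq> carrier G"
    and U': "\<And>x y. x \<in> X \<Longrightarrow> y \<in> X \<Longrightarrow> restrict x U = restrict y U \<Longrightarrow> \<bar>\<phi> x - \<phi> y\<bar> < \<delta>"
    by (rule potential_uniform[OF \<phi>]) blast
  let ?V = "W \<union> (\<Union>s\<in>B. translate (inv s) U)"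
  have V: "finite ?V" "?V \<subseteq> carrier G" "W \<subseteq> ?V"
    using ID(1,2) B U by (auto simp: translate_def subset_iff)
  show ?thesis
  proof (intro exI[of _ ?V] conjI ballI impI V)
    fix x y assume x: "x \<in> cyl W w" and y: "y \<in> cyl W w" and eq: "restrict x ?V = restrict y ?V"
    let ?x = "patch W w' x" and ?y = "patch W w' y"
    have X: "x \<in> X" "y \<in> X" "?x \<in> X" "?y \<in> X" using x y ID(5) by (auto simp: cyl_def)
    have same: "x h = y h" if "h \<in> ?V" for h using eq that unfolding restrict_name_eq_iff by blast
    have same': "?x h = ?y h" if "h \<in> ?V" for h using same[OF that] by (simp add: patch_def)
    have close: "\<bar>\<phi> (shift G (inv s) a) - \<phi> (shift G (inv s) b)\<bar> < \<delta>"
      if s: "s \<in> B" and ab: "a \<in> X" "b \<in> X" "\<And>h. h \<in> ?V \<Longrightarrow> a h = b h" for s a b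
    proof (rule U')
      show "shift G (inv s) a \<in> X" "shift G (inv s) b \<in> X" using s B ab by (auto intro!: shift_X)
      show "restrict (shift G (inv s) a) U = restrict (shift G (inv s) b) U"
      proof (rule restrict_ext)
        fix u assume u: "u \<in> U"
        then have "inv s \<otimes> u \<in> ?V" using s by (auto simp: translate_def)
        then show "shift G (inv s) a u = shift G (inv s) b u" using ab(3) u U by (simp add: subset_iff)
      qed
    qed
    let ?d = "\<lambda>x y s. \<phi> (shift G (inv s) y) - \<phi> (shift G (inv s) x)"
    have "\<bar>(\<Sum>s\<in>B. ?d x ?x s) - (\<Sum>s\<in>B. ?d y ?y s)\<bar> = \<bar>\<Sum>s\<in>B. ?d x ?x s - ?d y ?y s\<bar>"
      by (simp add: sum_subtractf)
    also have "\<dots> \<le> (\<Sum>s\<in>B. \<bar>?d x ?x s - ?d y ?y s\<bar>)" by (rule sum_abs)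
    also have "\<dots> \<le> (\<Sum>s\<in>B. 2 * \<delta>)"
    proof (rule sum_mono)
      fix s assume s: "s \<in> B"
      show "\<bar>?d x ?x s - ?d y ?y s\<bar> \<le> 2 * \<delta>"
        using close[OF s X(1,2) same] close[OF s X(3,4) same'] by linarith
    qed
    also have "\<dots> \<le> \<epsilon> / 2" using \<epsilon> by (simp add: \<delta>_def field_simps)
    finally have "\<bar>(\<Sum>s\<in>B. ?d x ?x s) - (\<Sum>s\<in>B. ?d y ?y s)\<bar> \<le> \<epsilon> / 2" .
    moreover have "\<bar>potential_cocycle G \<phi> x ?x - (\<Sum>s\<in>B. ?d x ?x s)\<bar> \<le> infsum \<beta> (carrier G - B)"
      by (rule cocycle_finite_approx[OF \<beta> ID(2) X(1,3) _ B(1,2)]) (simp add: patch_off)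
    moreover have "\<bar>potential_cocycle G \<phi> y ?y - (\<Sum>s\<in>B. ?d y ?y s)\<bar> \<le> infsum \<beta> (carrier G - B)"
      by (rule cocycle_finite_approx[OF \<beta> ID(2) X(2,4) _ B(1,2)]) (simp add: patch_off)
    ultimately show "\<bar>potential_cocycle G \<phi> x ?x - potential_cocycle G \<phi> y ?y\<bar> \<le> \<epsilon>"
      using B(3) by linarith
  qed
qed

text \<open>Letters are discrete, so by compactness each of finitely many output letters of a
  continuous map depends on a finite input window, as in the Curtis-Hedlund-Lyndon theorem but
  without equivariance.\<close>

lemma coordinate_window:
  assumes f: "continuous_map XT XT f" and K: "finite K" "K \<subseteq> carrier G"
  shows "\<exists>V. finite V \<and> V \<subseteq> carrier G \<and> (\<forall>x\<in>X. \<forall>y\<in>X. restrict x V = restrict y V \<longrightarrow> (\<forall>h\<in>K. f x h = f y h))"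
proof -
  have im: "f x \<in> X" if "x \<in> X" for x
    using continuous_map_image_subset_topspace[OF f] that by (auto simp: topspace_XT)
  let ?P = "\<lambda>U. \<forall>x\<in>U. \<forall>y\<in>U. \<forall>h\<in>K. f x h = f y h"
  have "\<exists>U. openin XT U \<and> x \<in> U \<and> ?P U" if x: "x \<in> X" for x
  proof (intro exI conjI)
    let ?C = "cyl K (restrict (f x) K)"
    let ?U = "{y \<in> topspace XT. f y \<in> ?C}"
    show "openin XT ?U"
      using f K by (intro openin_continuous_map_preimage[OF f] open_cyl) auto
    show "x \<in> ?U" using x im by (simp add: topspace_XT cyl_def)
    show "?P ?U"
    proof (intro ballI)
      fix y z h assume yz: "y \<in> ?U" "z \<in> ?U" and h: "h \<in> K"
      have "restrict (f y) K = restrict (f z) K" using yz by (simp add: cyl_def)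
      then show "f y h = f z h" using h unfolding restrict_name_eq_iff by blast
    qed
  qed
  then have "\<exists>W. finite W \<and> W \<subseteq> carrier G \<and> (\<forall>x\<in>X. \<exists>U. ?P U \<and> cyl W (restrict x W) \<subseteq> U)"
    by (rule uniform_cylinders[of ?P]) blast+
  then obtain V where V: "finite V" "V \<subseteq> carrier G" "\<And>x. x \<in> X \<Longrightarrow> \<exists>U. ?P U \<and> cyl V (restrict x V) \<subseteq> U" by blast
  show ?thesis
  proof (intro exI[of _ V] conjI V(1,2) ballI impI)
    fix x y h assume xy: "x \<in> X" "y \<in> X" "restrict x V = restrict y V" and h: "h \<in> K"
    have "x \<in> cyl V (restrict x V)" "y \<in> cyl V (restrict x V)" using xy by (auto simp: cyl_def)
    then show "f x h = f y h" using V(3)[OF xy(1)] h by blast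
  qed
qed

text \<open>The window contains the support \<open>F\<close> of \<open>f\<close> and the windows
  that determine \<open>f\<close> and its inverse on \<open>F\<close>. On the cylinder of
  \<open>x\<close> the map is one fixed patch; on the cylinder of \<open>f x\<close> its inverse,
  which also acts only inside \<open>F\<close>, is the reverse patch. Since both maps preserve
  \<open>X\<close>, the two words are interchangeable.\<close>

lemma local_homeomorphism_patch:
  assumes f: "f \<in> local_homeomorphisms G A X" and x: "x \<in> X"
  shows "\<exists>W w w'. interchangeable W w w' \<and> x \<in> cyl W w \<and> f x = patch W w' x"
proof -
  obtain F where hom: "homeomorphic_map XT XT f" and F: "finite F" "F \<subseteq> carrier G"
    and off: "\<And>x. x \<in> X \<Longrightarrow> restrict (f x) (carrier G - F) = restrict x (carrier G - F)"
    using f unfolding local_homeomorphisms_def by blast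
  obtain g where g: "homeomorphic_maps XT XT f g" using hom homeomorphic_map_maps by blast
  have cf: "continuous_map XT XT f" and cg: "continuous_map XT XT g"
    and gf: "\<And>x. x \<in> X \<Longrightarrow> g (f x) = x" and fg: "\<And>x. x \<in> X \<Longrightarrow> f (g x) = x"
    using g by (auto simp: homeomorphic_maps_def topspace_XT)
  have fX: "f y \<in> X" and gX: "g y \<in> X" if "y \<in> X" for y
    using continuous_map_image_subset_topspace[OF cf] continuous_map_image_subset_topspace[OF cg] that
    by (auto simp: topspace_XT)
  have foff: "f y h = y h" if "y \<in> X" "h \<in> carrier G" "h \<notin> F" for y h
    using off[OF that(1)] that(2,3) unfolding restrict_name_eq_iff by blast
  have goff: "g y h = y h" if "y \<in> X" "h \<in> carrier G" "h \<notin> F" for y h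
    using foff[OF gX[OF that(1)] that(2,3)] fg[OF that(1)] by simp
  obtain V1 where V1: "finite V1" "V1 \<subseteq> carrier G"
    "\<And>x y h. x \<in> X \<Longrightarrow> y \<in> X \<Longrightarrow> restrict x V1 = restrict y V1 \<Longrightarrow> h \<in> F \<Longrightarrow> f x h = f y h"
    using coordinate_window[OF cf F] by blast
  obtain V2 where V2: "finite V2" "V2 \<subseteq> carrier G"
    "\<And>x y h. x \<in> X \<Longrightarrow> y \<in> X \<Longrightarrow> restrict x V2 = restrict y V2 \<Longrightarrow> h \<in> F \<Longrightarrow> g x h = g y h"
    using coordinate_window[OF cg F] by blast
  let ?W = "F \<union> V1 \<union> V2"
  let ?w = "restrict x ?W" and ?w' = "restrict (f x) ?W"
  have W: "finite ?W" "?W \<subseteq> carrier G" using F V1 V2 by auto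
  have transfer: "k y = patch ?W (restrict (k z) ?W) y"
    if y: "y \<in> X" and z: "z \<in> X" and eq: "restrict y ?W = restrict z ?W"
      and kX: "\<And>y. y \<in> X \<Longrightarrow> k y \<in> X"
      and koff: "\<And>y h. y \<in> X \<Longrightarrow> h \<in> carrier G \<Longrightarrow> h \<notin> F \<Longrightarrow> k y h = y h"
      and kF: "\<And>h. h \<in> F \<Longrightarrow> k y h = k z h" for k y z
  proof (rule extensionalityI[of _ "carrier G"])
    show "k y \<in> extensional (carrier G)" using kX[OF y] by (rule X_ext)
    show "patch ?W (restrict (k z) ?W) y \<in> extensional (carrier G)"
      using X_ext[OF y] W(2) by (auto simp: extensional_def patch_def)
    fix h assume h: "h \<in> carrier G"
    show "k y h = patch ?W (restrict (k z) ?W) y h"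
    proof (cases "h \<in> ?W")
      case True
      have "y h = z h" using eq True unfolding restrict_name_eq_iff by blast
      then show ?thesis using True kF[of h] koff[OF y h] koff[OF z h] by (cases "h \<in> F") (auto simp: patch_on)
    next
      case False
      then show ?thesis using koff[OF y h] by (simp add: patch_off)
    qed
  qed
  have fpatch: "f y = patch ?W ?w' y" if y: "y \<in> cyl ?W ?w" for y
  proof (rule transfer[OF _ x])
    show yX: "y \<in> X" and eq: "restrict y ?W = restrict x ?W" using y by (auto simp: cyl_def)
    fix h assume "h \<in> F"
    moreover have "restrict y V1 = restrict x V1" using eq unfolding restrict_name_eq_iff by blast
    ultimately show "f y h = f x h" using V1(3)[OF yX x] by blast
  qed (use fX foff in auto)
  have gpatch: "g y = patch ?W ?w y" if y: "y \<in> cyl ?W ?w'" for y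
  proof -
    have yX: "y \<in> X" and eq: "restrict y ?W = restrict (f x) ?W" using y by (auto simp: cyl_def)
    have "g y = patch ?W (restrict (g (f x)) ?W) y"
    proof (rule transfer[OF yX fX[OF x] eq])
      fix h assume "h \<in> F"
      moreover have "restrict y V2 = restrict (f x) V2" using eq unfolding restrict_name_eq_iff by blast
      ultimately show "g y h = g (f x) h" using V2(3)[OF yX fX[OF x]] by blast
    qed (use gX goff in auto)
    then show ?thesis using gf[OF x] by simp
  qed
  have "?w \<in> ?W \<rightarrow>\<^sub>E A" "?w' \<in> ?W \<rightarrow>\<^sub>E A"
    using restrict_pattern[OF x W] restrict_pattern[OF fX[OF x] W] unfolding patterns_def by blast+
  moreover have "patch ?W ?w' y \<in> X" if "y \<in> cyl ?W ?w" for y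
    using fX[of y] fpatch[OF that] that by (simp add: cyl_def)
  moreover have "patch ?W ?w y \<in> X" if "y \<in> cyl ?W ?w'" for y
    using gX[of y] gpatch[OF that] that by (simp add: cyl_def)
  ultimately have "interchangeable ?W ?w ?w'"
    unfolding interchangeable_def using W by blast
  moreover have "x \<in> cyl ?W ?w" using x by (simp add: cyl_def)
  ultimately show ?thesis using fpatch by blast
qed

end

lemma exp_diff_bound:
  fixes s t :: real
  assumes "\<bar>s - t\<bar> \<le> d"
  shows "\<bar>exp s - exp t\<bar> \<le> exp t * (exp d - 1)"
proof -
  have "\<bar>exp (s - t) - 1\<bar> \<le> exp d - 1"
  proof (cases "0 \<le> s - t")
    case True
    then show ?thesis using assms by simp
  next
    case False
    have "1 + (s - t) \<le> exp (s - t)" "1 + d \<le> exp d" by (rule exp_ge_add_one_self)+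
    moreover have "exp (s - t) < 1" using False by simp
    ultimately show ?thesis using assms False by linarith
  qed
  moreover have "exp s - exp t = exp t * (exp (s - t) - 1)" by (simp add: exp_diff field_simps)
  ultimately show ?thesis by (simp add: abs_mult)
qed

section \<open>Measurability of swaps and of the cocycle\<close>

context subshift_measure
begin

lemma locally_cylinder_sets:
  assumes "S \<subseteq> X" "\<And>x. x \<in> S \<Longrightarrow> \<exists>V. finite V \<and> V \<subseteq> carrier G \<and> cyl V (restrict x V) \<subseteq> S"
  shows "S \<in> sets \<mu>"
proof -
  let ?P = "{p\<in>patterns. cyl (fst p) (snd p) \<subseteq> S}"
  have "S = (\<Union>p\<in>?P. cyl (fst p) (snd p))"
  proof (intro equalityI subsetI)
    fix x assume x: "x \<in> S"
    then obtain V where V: "finite V" "V \<subseteq> carrier G" "cyl V (restrict x V) \<subseteq> S" using assms(2) by blast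
    have xX: "x \<in> X" using x assms(1) by auto
    then have "(V, restrict x V) \<in> ?P" using restrict_pattern[OF xX V(1,2)] V(3) by simp
    moreover have "x \<in> cyl V (restrict x V)" using xX by (simp add: cyl_def)
    ultimately show "x \<in> (\<Union>p\<in>?P. cyl (fst p) (snd p))" by force
  qed auto
  moreover have "(\<Union>p\<in>?P. cyl (fst p) (snd p)) \<in> sets \<mu>"
  proof (rule sets.countable_UN')
    show "countable ?P" by (rule countable_subset[OF _ countable_patterns]) auto
    show "(\<lambda>p. cyl (fst p) (snd p)) ` ?P \<subseteq> sets \<mu>"
      by (auto simp: patterns_def intro!: cyl_sets)
  qed
  ultimately show ?thesis by simp
qed

lemma window_sets:
  assumes "finite V" "V \<subseteq> carrier G"
  shows "{x\<in>X. restrict x V \<in> S} \<in> sets \<mu>"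
proof (rule locally_cylinder_sets)
  show "\<exists>U. finite U \<and> U \<subseteq> carrier G \<and> cyl U (restrict x U) \<subseteq> {x\<in>X. restrict x V \<in> S}"
    if "x \<in> {x\<in>X. restrict x V \<in> S}" for x
    using that assms by (intro exI[of _ V]) (auto simp: cyl_def)
qed auto

text \<open>Not an involution: for \<open>w \<noteq> w'\<close>, points showing \<open>w'\<close>
  stay fixed. It extends the partial swap to a total measurable map, and each direction has its own
  extension.\<close>

definition swap_map :: "'g set \<Rightarrow> ('g \<Rightarrow> 'a) \<Rightarrow> ('g \<Rightarrow> 'a) \<Rightarrow> ('g \<Rightarrow> 'a) \<Rightarrow> 'g \<Rightarrow> 'a" where
  "swap_map W w w' x = (if x \<in> cyl W w then patch W w' x else x)"

lemma swap_map_X: "interchangeable W w w' \<Longrightarrow> x \<in> X \<Longrightarrow> swap_map W w w' x \<in> X"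
  using interchangeableD(5)[of W w w' x] by (auto simp: swap_map_def cyl_def)

lemma swap_map_measurable:
  assumes I: "interchangeable W w w'"
  shows "swap_map W w w' \<in> measurable \<mu> \<mu>"
proof (rule measurable_into_X[OF sets_mu])
  note ID = interchangeableD[OF I]
  fix h a assume h: "h \<in> carrier G"
  have "{x \<in> space \<mu>. swap_map W w w' x h = a}
    = (cyl W w \<inter> {x\<in>X. (if h \<in> W then w' h else x h) = a}) \<union> ({x\<in>X. x h = a} - cyl W w)"
    by (auto simp: swap_map_def patch_def cyl_def space_mu)
  also have "\<dots> \<in> sets \<mu>"
  proof -
    have "{x\<in>X. (if h \<in> W then w' h else x h) = a} \<in> sets \<mu>"
    proof (cases "h \<in> W")
      case True
      then have "{x\<in>X. (if h \<in> W then w' h else x h) = a} = (if w' h = a then space \<mu> else {})" by (auto simp: space_mu)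
      then show ?thesis by simp
    next
      case False
      then show ?thesis using coordinate_sets[OF h] by simp
    qed
    then show ?thesis using cyl_sets[OF ID(1,2)] coordinate_sets[OF h] by auto
  qed
  finally show "{x \<in> space \<mu>. swap_map W w w' x h = a} \<in> sets \<mu>" .
qed (simp add: swap_map_X[OF I] space_mu)

text \<open>Superlevel sets are open: on a window where the cocycle varies by at most half of its
  excess over \<open>r\<close>, it stays above \<open>r\<close>.\<close>

lemma cocycle_measurable:
  assumes \<phi>: "potential G A X \<phi>" and \<beta>: "influence_bound \<phi> W \<beta>" and I: "interchangeable W w w'"
  shows "{x \<in> cyl W w. r < potential_cocycle G \<phi> x (patch W w' x)} \<in> sets \<mu>"
proof (rule locally_cylinder_sets)
  let ?\<psi> = "\<lambda>x. potential_cocycle G \<phi> x (patch W w' x)"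
  show "{x \<in> cyl W w. r < ?\<psi> x} \<subseteq> X" by (auto simp: cyl_def)
  fix x assume x: "x \<in> {x \<in> cyl W w. r < ?\<psi> x}"
  then have "0 < (?\<psi> x - r) / 2" by simp
  then obtain V where V: "finite V" "V \<subseteq> carrier G" "W \<subseteq> V"
    and V': "\<And>y z. y \<in> cyl W w \<Longrightarrow> z \<in> cyl W w \<Longrightarrow> restrict y V = restrict z V \<Longrightarrow> \<bar>?\<psi> y - ?\<psi> z\<bar> \<le> (?\<psi> x - r) / 2"
    using cocycle_uniform[OF \<phi> \<beta> I] by meson
  have "cyl V (restrict x V) \<subseteq> {x \<in> cyl W w. r < ?\<psi> x}"
  proof
    fix y assume y: "y \<in> cyl V (restrict x V)"
    then have eq: "y \<in> X" "restrict y V = restrict x V" by (auto simp: cyl_def)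
    then have "restrict y W = restrict x W" using V(3) unfolding restrict_name_eq_iff by blast
    then have yw: "y \<in> cyl W w" using x eq by (auto simp: cyl_def)
    have "\<bar>?\<psi> y - ?\<psi> x\<bar> \<le> (?\<psi> x - r) / 2" using V'[OF yw _ eq(2)] x by simp
    moreover have "r < ?\<psi> x" using x by simp
    ultimately show "y \<in> {x \<in> cyl W w. r < ?\<psi> x}" using yw by (simp add: abs_if split: if_splits)
  qed
  then show "\<exists>V. finite V \<and> V \<subseteq> carrier G \<and> cyl V (restrict x V) \<subseteq> {x \<in> cyl W w. r < ?\<psi> x}" using V by blast
qed

end

section \<open>Conformality of equilibrium states\<close>

locale equilibrium_measure = subshift_measure G A X \<mu>
  for G :: "('g, 'm) monoid_scheme" (structure) and A :: "'a set" and X :: "('g \<Rightarrow> 'a) set"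
    and \<mu> :: "('g \<Rightarrow> 'a) measure" +
  fixes \<phi> :: "('g \<Rightarrow> 'a) \<Rightarrow> real"
  assumes am: "amenable G" and sv: "summable_variation G A X \<phi>" and equilibrium: "equilibrium_state G A X \<phi> \<mu>"
begin

lemma pot: "potential G A X \<phi>"
  using sv by (simp add: summable_variation_def)

lemma X_nonempty: "X \<noteq> {}"
  using not_empty by (simp add: space_mu)

abbreviation "\<psi> \<equiv> potential_cocycle G \<phi>"

lemma invariant_measureI:
  assumes "subshift_measure G A X \<nu>"
  shows "\<nu> \<in> invariant_measures G A X"
proof -
  interpret N: subshift_measure G A X \<nu> by fact
  show ?thesis
    unfolding invariant_measures_def borel_prob_measures_def
    using N.prob_space_axioms N.space_mu N.sets_mu N.shift_measurable N.invariant by simp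
qed

text \<open>Resampling cannot increase entropy plus energy, so the free energy gained per site is at most the
  interaction error.\<close>

lemma pattern_deviation:
  assumes I: "interchangeable W w w'" and ne: "w \<noteq> w'" and \<eta>: "0 < \<eta>"
    and t: "\<And>x. x \<in> cyl W w \<Longrightarrow> \<bar>\<psi> x (patch W w' x) - t\<bar> \<le> \<eta>"
  shows "\<bar>measure \<mu> (cyl W w') - exp t * measure \<mu> (cyl W w)\<bar>
    \<le> (1 + exp t) * (2 * sqrt (4 * \<eta>)) * (measure \<mu> (cyl W w) + measure \<mu> (cyl W w'))"
proof -
  note ID = interchangeableD[OF I]
  have Wne: "W \<noteq> {}"
  proof
    assume "W = {}"
    then show False using ne ID(3,4) by simp
  qed
  obtain \<beta> where \<beta>: "influence_bound \<phi> W \<beta>"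
    by (rule influence_bound_exists[OF sv ID(1,2) Wne X_nonempty])
  have "\<exists>B. finite B \<and> B \<subseteq> carrier G \<and> infsum \<beta> (carrier G - B) \<le> \<eta>"
    using \<beta> \<eta> by (intro nonneg_infsum_tail) (auto simp: influence_bound_def)
  then obtain B where B: "finite B" "B \<subseteq> carrier G" "infsum \<beta> (carrier G - B) \<le> \<eta>" by blast
  \<comment> \<open>The differences of \<open>B\<close> allow at most one active site in
    \<open>B\<close>, which \<open>resample_energy\<close> needs; those of \<open>W\<close> keep the
    windows of active sites disjoint.\<close>
  define D where "D = ((\<lambda>(s, s'). inv s \<otimes> s') ` (B \<times> B) \<union> (\<lambda>(k, k'). k \<otimes> inv k') ` (W \<times> W)) - {\<one>}"
  define q where "q = 1 / (1 + exp t)"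
  have e: "0 < 1 + exp t" using exp_gt_zero[of t] by linarith
  have WB: "k \<in> carrier G" if "k \<in> W \<or> k \<in> B" for k using that ID(2) B(2) by auto
  interpret R: resampling_measure G A X \<mu> W w w' D q
  proof unfold_locales
    show "interchangeable W w w'" "w \<noteq> w'" by fact+
    show "finite D" using ID(1) B(1) by (simp add: D_def)
    show "D \<subseteq> carrier G" using WB by (auto simp: D_def)
    show "\<one> \<notin> D" by (simp add: D_def)
    show "k \<otimes> inv k' \<in> D" if k: "k \<in> W" "k' \<in> W" "k \<noteq> k'" for k k'
    proof -
      have "k \<otimes> inv k' \<noteq> \<one>" using k WB inv_equality[of k "inv k'"] by auto
      then show ?thesis using k by (auto simp: D_def)
    qed
    show "0 \<le> q" "q \<le> 1" using e by (auto simp: q_def field_simps)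
  qed
  have BD: "inv s \<otimes> s' \<in> D" if s: "s \<in> B" "s' \<in> B" "s \<noteq> s'" for s s'
  proof -
    have "inv s \<otimes> s' \<noteq> \<one>"
    proof
      assume eq: "inv s \<otimes> s' = \<one>"
      have "s' = s \<otimes> (inv s \<otimes> s')" using s WB by (simp add: m_assoc[symmetric])
      then show False using eq s WB by simp
    qed
    then show ?thesis using s by (auto simp: D_def)
  qed
  \<comment> \<open>One \<eta> comes from the oscillation of the cocycle around \<open>t\<close>,
    the other from its truncation to \<open>B\<close>.\<close>
  have t': "\<bar>(\<Sum>s\<in>B. \<phi> (shift G (inv s) (patch W w' x)) - \<phi> (shift G (inv s) x)) - t\<bar> \<le> 2 * \<eta>"
    if x: "x \<in> cyl W w" for x
  proof -
    have xy: "x \<in> X" "patch W w' x \<in> X" using x ID(5)[OF x] by (auto simp: cyl_def)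
    have "\<bar>\<psi> x (patch W w' x) - (\<Sum>s\<in>B. \<phi> (shift G (inv s) (patch W w' x)) - \<phi> (shift G (inv s) x))\<bar> \<le> infsum \<beta> (carrier G - B)"
      by (rule cocycle_finite_approx[OF \<beta> ID(2) xy _ B(1,2)]) (simp add: patch_off)
    then show ?thesis using t[OF x] B(3) by linarith
  qed
  let ?a = "measure \<mu> (cyl W w)" and ?b = "measure \<mu> (cyl W w')"
  have pp: "R.pattern_prob True = ?a" "R.pattern_prob False = ?b"
    by (simp_all add: R.pattern_prob_def R.pat_def)
  have energy: "R.site_prob * ((?a * (1 - q) - ?b * q) * t - 2 * (2 * \<eta>) * (?a + ?b)) \<le> integral\<^sup>L R.resampled \<phi> - integral\<^sup>L \<mu> \<phi>"
    using R.resample_energy[OF pot \<beta> B(1,2) BD _ t'] B(3) \<eta> unfolding pp by simp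
  interpret N: subshift_measure G A X R.resampled by (rule R.resampled_measure)
  have "ks_entropy G R.resampled + ereal (integral\<^sup>L R.resampled \<phi>) \<le> ks_entropy G \<mu> + ereal (integral\<^sup>L \<mu> \<phi>)"
    using equilibrium invariant_measureI[OF R.resampled_measure] by (simp add: equilibrium_state_def)
  then have "N.entropy_rate + integral\<^sup>L R.resampled \<phi> \<le> entropy_rate + integral\<^sup>L \<mu> \<phi>"
    by (simp add: ks_entropy_eq[OF am] N.ks_entropy_eq[OF am])
  moreover have "entropy_rate + R.site_prob * R.entropy_gain \<le> N.entropy_rate"
    by (rule R.entropy_rate_resampled[OF am])
  ultimately have "R.site_prob * (R.entropy_gain + ((?a * (1 - q) - ?b * q) * t - 2 * (2 * \<eta>) * (?a + ?b))) \<le> 0"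
    using energy by (simp add: distrib_left)
  \<comment> \<open>The density of resampled sites, which depends on \<eta> through
    \<open>D\<close>, cancels here. Entropy gain, energy and error all carry it as a factor.\<close>
  then have "R.entropy_gain + ((?a * (1 - q) - ?b * q) * t - 2 * (2 * \<eta>) * (?a + ?b)) \<le> 0"
    using R.site_prob_pos by (simp add: mult_le_0_iff)
  \<comment> \<open>The constant 4 arises because \<open>resample_energy\<close> loses its tolerance
    twice, once for the distant sites and once for the flip, and that tolerance is
    \<open>2 * \<eta>\<close>.\<close>
  then have "(?a + ?b) * mixing_entropy q (1 - q) - mixing_entropy ?a ?b + (?a * (1 - q) - ?b * q) * t \<le> (?a + ?b) * (4 * \<eta>)"
    unfolding R.entropy_gain_def pp by (simp add: algebra_simps)
  then show ?thesis
    using \<eta> unfolding q_def by (intro gibbs_deviation) auto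
qed

lemma cocycle_superlevel_sets:
  assumes I: "interchangeable W w w'"
  shows "{x \<in> cyl W w. r < \<psi> x (patch W w' x)} \<in> sets \<mu>"
proof (cases "w = w'")
  \<comment> \<open>Equal patterns, which include the case of an empty window without an influence
    bound: the swap is the identity and the cocycle vanishes.\<close>
  case True
  note ID = interchangeableD[OF I]
  have "patch W w' x = x" if "x \<in> cyl W w" for x
    using patch_cyl[OF I that] True by simp
  then have "{x \<in> cyl W w. r < \<psi> x (patch W w' x)} = (if r < 0 then cyl W w else {})"
    by (auto simp: cocycle_self)
  then show ?thesis using cyl_sets[OF ID(1,2)] by simp
next
  case False
  note ID = interchangeableD[OF I]
  have "W \<noteq> {}"
  proof
    assume "W = {}"
    then show False using False ID(3,4) by simp
  qed
  then obtain \<beta> where "influence_bound \<phi> W \<beta>"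
    by (rule influence_bound_exists[OF sv ID(1,2) _ X_nonempty])
  then show ?thesis by (rule cocycle_measurable[OF pot _ I])
qed

lemma cocycle_function_measurable:
  assumes I: "interchangeable W w w'"
  shows "(\<lambda>x. if x \<in> cyl W w then \<psi> x (patch W w' x) else 0) \<in> borel_measurable \<mu>"
  unfolding borel_measurable_iff_greater
proof
  fix r :: real
  have "{x \<in> space \<mu>. r < (if x \<in> cyl W w then \<psi> x (patch W w' x) else 0)}
    = {x \<in> cyl W w. r < \<psi> x (patch W w' x)} \<union> (if r < 0 then space \<mu> - cyl W w else {})"
    by (auto simp: cyl_def space_mu)
  then show "{x \<in> space \<mu>. r < (if x \<in> cyl W w then \<psi> x (patch W w' x) else 0)} \<in> sets \<mu>"
    using cocycle_superlevel_sets[OF I] cyl_sets[OF interchangeableD(1,2)[OF I]] by auto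
qed

text \<open>One representative for each word that occurs in \<open>C\<close>; a sum over cylinders
  becomes a sum over points, at which the cocycle can be evaluated.\<close>

lemma window_partition:
  assumes V: "finite V" "V \<subseteq> carrier G" and C: "C \<subseteq> X" "\<And>x y. x \<in> C \<Longrightarrow> y \<in> X \<Longrightarrow> restrict x V = restrict y V \<Longrightarrow> y \<in> C"
  obtains Y where "finite Y" "Y \<subseteq> C" "C = (\<Union>y\<in>Y. cyl V (restrict y V))" "inj_on (\<lambda>y. restrict y V) Y"
proof -
  let ?r = "\<lambda>y. restrict y V"
  have fin: "finite (?r ` C)"
  proof (rule finite_subset)
    show "?r ` C \<subseteq> V \<rightarrow>\<^sub>E A" using restrict_pattern[OF _ V] C(1) unfolding patterns_def by blast
    show "finite (V \<rightarrow>\<^sub>E A)" using V finite_alphabet by (intro finite_PiE) auto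
  qed
  obtain Y where Y: "Y \<subseteq> C" "?r ` Y = ?r ` C" "inj_on ?r Y"
    using subset_image_inj[of "?r ` C" ?r C] by auto
  have "finite Y" using finite_imageD[of ?r Y] Y fin by simp
  moreover have "C = (\<Union>y\<in>Y. cyl V (?r y))"
  proof (intro equalityI subsetI)
    fix x assume x: "x \<in> C"
    then have "?r x \<in> ?r ` Y" using Y(2) by blast
    then obtain y where "y \<in> Y" "?r x = ?r y" by blast
    then show "x \<in> (\<Union>y\<in>Y. cyl V (?r y))" using x C(1) by (auto simp: cyl_def)
  next
    fix x assume "x \<in> (\<Union>y\<in>Y. cyl V (?r y))"
    then obtain y where "y \<in> Y" "x \<in> X" "?r y = ?r x" by (auto simp: cyl_def)
    then show "x \<in> C" using C(2)[of y x] Y(1) by blast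
  qed
  ultimately show thesis using that Y(1,3) by blast
qed

text \<open>The set \<open>C\<close> is cut into cylinders on which the cocycle is constant up to \<open>\<eta>\<close>; \<open>pattern_deviation\<close> applies
  to each of them, and the errors are proportional to the measures of the cylinders.\<close>

lemma swap_window:
  assumes I: "interchangeable W w w'" and ne: "w \<noteq> w'" and V: "finite V" "V \<subseteq> carrier G"
    and C: "C = {x\<in>X. restrict x V \<in> S}"
  shows "ennreal (measure \<mu> {y\<in>cyl W w'. patch W w y \<in> C}) = (\<integral>\<^sup>+x. ennreal (exp (\<psi> x (patch W w' x))) * indicator (C \<inter> cyl W w) x \<partial>\<mu>)"
proof -
  note ID = interchangeableD[OF I]
  let ?\<psi> = "\<lambda>x. \<psi> x (patch W w' x)"
  have Wne: "W \<noteq> {}"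
  proof
    assume "W = {}"
    then show False using ne ID(3,4) by simp
  qed
  obtain \<beta> where \<beta>: "influence_bound \<phi> W \<beta>"
    by (rule influence_bound_exists[OF sv ID(1,2) Wne X_nonempty])
  define T where "T = infsum \<beta> (carrier G)"
  have \<psi>T: "\<bar>?\<psi> x\<bar> \<le> T" if "x \<in> cyl W w" for x unfolding T_def by (rule cocycle_bound[OF \<beta> I that])
  have T0: "0 \<le> T" unfolding T_def using \<beta> by (intro infsum_nonneg) (auto simp: influence_bound_def)
  define g where "g x = (if x \<in> cyl W w then exp (?\<psi> x) else 0)" for x
  have g_meas: "g \<in> borel_measurable \<mu>"
  proof -
    have "(\<lambda>x. exp (if x \<in> cyl W w then ?\<psi> x else 0) * indicator (cyl W w) x) \<in> borel_measurable \<mu>"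
      using cocycle_function_measurable[OF I] cyl_sets[OF ID(1,2)] by measurable
    also have "(\<lambda>x. exp (if x \<in> cyl W w then ?\<psi> x else 0) * indicator (cyl W w) x) = g"
      by (auto simp: g_def fun_eq_iff)
    finally show ?thesis .
  qed
  have g0: "0 \<le> g x" and gT: "g x \<le> exp T" for x
    using \<psi>T[of x] by (auto simp: g_def)
  have g_int: "integrable \<mu> (\<lambda>x. g x * indicator S x)" if "S \<in> sets \<mu>" for S
    using g_meas that g0 gT
    by (intro integrable_const_bound[of _ "exp T"] AE_I2) (auto simp: indicator_def)
  let ?L = "measure \<mu> {y\<in>cyl W w'. patch W w y \<in> C}" and ?R = "\<integral>x. g x * indicator C x \<partial>\<mu>"
  have Csets: "C \<in> sets \<mu>" unfolding C by (rule window_sets[OF V])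
  \<comment> \<open>The two sides do not depend on \<eta>, while the bound tends to 0 with it;
    equality follows in the limit. The first part of the bound is the error of
    \<open>pattern_deviation\<close>, the second the oscillation of the density on one
    cylinder.\<close>
  have main: "\<bar>?L - ?R\<bar> \<le> ((1 + exp T) * (2 * sqrt (4 * \<eta>)) + exp T * (exp \<eta> - 1)) * 2" if \<eta>: "0 < \<eta>" for \<eta>
  proof -
    obtain U where U: "finite U" "U \<subseteq> carrier G" "W \<subseteq> U"
      and var: "\<And>x y. x \<in> cyl W w \<Longrightarrow> y \<in> cyl W w \<Longrightarrow> restrict x U = restrict y U \<Longrightarrow> \<bar>?\<psi> x - ?\<psi> y\<bar> \<le> \<eta>"
      using cocycle_uniform[OF pot \<beta> I \<eta>] by meson
    let ?V = "U \<union> V"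
    have V': "finite ?V" "?V \<subseteq> carrier G" "W \<subseteq> ?V" using U V by auto
    have "C \<inter> cyl W w \<subseteq> X" by (auto simp: cyl_def)
    moreover have "y \<in> C \<inter> cyl W w" if x: "x \<in> C \<inter> cyl W w" and y: "y \<in> X" "restrict x ?V = restrict y ?V" for x y
    proof -
      have "restrict x W = restrict y W" "restrict x V = restrict y V"
        using y(2) V'(3) unfolding restrict_name_eq_iff by blast+
      then show ?thesis using x y(1) by (auto simp: cyl_def C)
    qed
    ultimately obtain Y where Y: "finite Y" "Y \<subseteq> C \<inter> cyl W w" "C \<inter> cyl W w = (\<Union>y\<in>Y. cyl ?V (restrict y ?V))"
      "inj_on (\<lambda>y. restrict y ?V) Y"
      by (rule window_partition[OF V'(1,2)]) blast+
    let ?c = "\<lambda>y. cyl ?V (restrict y ?V)" and ?c' = "\<lambda>y. cyl ?V (restrict (patch W w' y) ?V)"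
    have Yw: "y \<in> cyl W w" if "y \<in> Y" for y using Y(2) that by blast
    note ext = interchangeable_extend[OF I V' Yw]
    have disj: "?c y \<inter> ?c z = {}" if "y \<in> Y" "z \<in> Y" "y \<noteq> z" for y z
      using inj_onD[OF Y(4) _ that(1,2)] that(3) by (auto simp: cyl_def)
    \<comment> \<open>\<open>?c' y\<close> is the image of \<open>?c y\<close> under the swap, so
      disjointness and the covering of \<open>C \<inter> cyl W w\<close> carry over to the
      images.\<close>
    have c'_iff: "x \<in> ?c' y \<longleftrightarrow> x \<in> cyl W w' \<and> patch W w x \<in> ?c y" if y: "y \<in> Y" for x y
    proof
      assume x: "x \<in> ?c' y"
      then have "x \<in> cyl W w'" "patch ?V (restrict y ?V) x = patch W w x" using ext(3)[OF y] by blast+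
      moreover have "patch ?V (restrict y ?V) x \<in> ?c y"
        by (rule interchangeableD(6)[OF ext(1)[OF y] x])
      ultimately show "x \<in> cyl W w' \<and> patch W w x \<in> ?c y" by simp
    next
      assume x: "x \<in> cyl W w' \<and> patch W w x \<in> ?c y"
      then have "patch ?V (restrict (patch W w' y) ?V) (patch W w x) \<in> ?c' y"
        using interchangeableD(5)[OF ext(1)[OF y]] by blast
      moreover have "patch ?V (restrict (patch W w' y) ?V) (patch W w x) = patch W w' (patch W w x)"
        using ext(2)[OF y] x by blast
      moreover have "patch W w' (patch W w x) = x"
        using interchangeableD(7)[OF interchangeable_sym[OF I]] x by blast
      ultimately show "x \<in> ?c' y" by simp
    qed
    have c_sets: "?c y \<in> sets \<mu>" "?c' y \<in> sets \<mu>" for y by (rule cyl_sets[OF V'(1,2)])+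
    have disj': "?c' y \<inter> ?c' z = {}" if "y \<in> Y" "z \<in> Y" "y \<noteq> z" for y z
      using disj[OF that] c'_iff[OF that(1)] c'_iff[OF that(2)] by blast
    have "{y\<in>cyl W w'. patch W w y \<in> C} = (\<Union>y\<in>Y. ?c' y)"
    proof (intro equalityI subsetI)
      fix x assume x: "x \<in> {y\<in>cyl W w'. patch W w y \<in> C}"
      then have "patch W w x \<in> C \<inter> cyl W w" using ID(6) by blast
      then obtain y where "y \<in> Y" "patch W w x \<in> ?c y" using Y(3) by blast
      then show "x \<in> (\<Union>y\<in>Y. ?c' y)" using c'_iff x by blast
    next
      fix x assume "x \<in> (\<Union>y\<in>Y. ?c' y)"
      then obtain y where y: "y \<in> Y" "x \<in> ?c' y" by blast
      then have "x \<in> cyl W w'" "patch W w x \<in> ?c y" using c'_iff by blast+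
      then show "x \<in> {y\<in>cyl W w'. patch W w y \<in> C}" using Y(3) y(1) by blast
    qed
    then have L: "?L = (\<Sum>y\<in>Y. measure \<mu> (?c' y))"
      using finite_measure_finite_Union[of Y ?c'] Y(1) c_sets(2) disj'
      by (simp add: disjoint_family_on_def image_subset_iff)
    have R: "?R = (\<Sum>y\<in>Y. \<integral>x. g x * indicator (?c y) x \<partial>\<mu>)"
    proof -
      have "g x * indicator C x = (\<Sum>y\<in>Y. g x * indicator (?c y) x)" for x
      proof -
        have "(\<Sum>y\<in>Y. indicator (?c y) x) = (indicator (\<Union>y\<in>Y. ?c y) x :: real)"
          using disj Y(1) by (intro indicator_UN_disjoint[symmetric]) (auto simp: disjoint_family_on_def)
        also have "\<dots> = indicator (C \<inter> cyl W w) x" by (simp only: Y(3))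
        finally have "(\<Sum>y\<in>Y. g x * indicator (?c y) x) = g x * indicator (C \<inter> cyl W w) x"
          by (simp add: sum_distrib_left[symmetric])
        then show ?thesis by (auto simp: g_def indicator_def)
      qed
      then have "?R = (\<integral>x. (\<Sum>y\<in>Y. g x * indicator (?c y) x) \<partial>\<mu>)" by simp
      also have "\<dots> = (\<Sum>y\<in>Y. \<integral>x. g x * indicator (?c y) x \<partial>\<mu>)"
        by (rule Bochner_Integration.integral_sum) (rule g_int[OF c_sets(1)])
      finally show ?thesis .
    qed
    let ?K = "(1 + exp T) * (2 * sqrt (4 * \<eta>)) + exp T * (exp \<eta> - 1)"
    have K1: "0 \<le> exp T * (exp \<eta> - 1)" using \<eta> by simp
    have each: "\<bar>measure \<mu> (?c' y) - (\<integral>x. g x * indicator (?c y) x \<partial>\<mu>)\<bar> \<le> ?K * (measure \<mu> (?c y) + measure \<mu> (?c' y))"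
      if y: "y \<in> Y" for y
    proof -
      let ?t = "?\<psi> y"
      have cw: "x \<in> cyl W w" "patch ?V (restrict (patch W w' y) ?V) x = patch W w' x" if "x \<in> ?c y" for x
        using ext(2)[OF y that] by blast+
      have dev: "\<bar>?\<psi> x - ?t\<bar> \<le> \<eta>" if x: "x \<in> ?c y" for x
      proof (rule var[OF cw(1)[OF x] Yw[OF y]])
        have "restrict x ?V = restrict y ?V" using x by (simp add: cyl_def)
        then show "restrict x U = restrict y U" unfolding restrict_name_eq_iff by blast
      qed
      have tT: "exp ?t \<le> exp T" using \<psi>T[OF Yw[OF y]] by simp
      have ne': "restrict y ?V \<noteq> restrict (patch W w' y) ?V"
      proof
        assume eq: "restrict y ?V = restrict (patch W w' y) ?V"
        have "restrict y W = restrict (patch W w' y) W" using eq V'(3) unfolding restrict_name_eq_iff by blast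
        moreover have "restrict y W = w" "restrict (patch W w' y) W = w'"
          using Yw[OF y] ID(5)[OF Yw[OF y]] by (auto simp: cyl_def)
        ultimately show False using ne by simp
      qed
      \<comment> \<open>The deviation estimate is applied to the refined patterns, with the value of
        the cocycle at the representative \<open>y\<close> as \<open>t\<close>.\<close>
      have "\<bar>measure \<mu> (?c' y) - exp ?t * measure \<mu> (?c y)\<bar> \<le> (1 + exp ?t) * (2 * sqrt (4 * \<eta>)) * (measure \<mu> (?c y) + measure \<mu> (?c' y))"
        by (rule pattern_deviation[OF ext(1)[OF y] ne' \<eta>]) (use cw(2) dev in simp)
      also have "\<dots> \<le> (1 + exp T) * (2 * sqrt (4 * \<eta>)) * (measure \<mu> (?c y) + measure \<mu> (?c' y))"
        using tT \<eta> by (intro mult_right_mono) auto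
      finally have 1: "\<bar>measure \<mu> (?c' y) - exp ?t * measure \<mu> (?c y)\<bar> \<le> (1 + exp T) * (2 * sqrt (4 * \<eta>)) * (measure \<mu> (?c y) + measure \<mu> (?c' y))" .
      have ind_int: "integrable \<mu> (\<lambda>x. r * indicator (?c y) x)" for r :: real
        using c_sets(1) by (intro integrable_mult_right integrable_real_indicator) (simp_all add: emeasure_eq_measure)
      have "\<bar>(\<integral>x. g x * indicator (?c y) x \<partial>\<mu>) - exp ?t * measure \<mu> (?c y)\<bar> = \<bar>\<integral>x. g x * indicator (?c y) x - exp ?t * indicator (?c y) x \<partial>\<mu>\<bar>"
        using g_int[OF c_sets(1)] ind_int sets.sets_into_space[OF c_sets(1)]
        by (subst Bochner_Integration.integral_diff) (auto simp: Int_absorb2)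
      also have "\<dots> \<le> (\<integral>x. \<bar>g x * indicator (?c y) x - exp ?t * indicator (?c y) x\<bar> \<partial>\<mu>)"
        by (rule integral_abs_bound)
      also have "\<dots> \<le> (\<integral>x. (exp T * (exp \<eta> - 1)) * indicator (?c y) x \<partial>\<mu>)"
      proof (rule integral_mono)
        show "integrable \<mu> (\<lambda>x. \<bar>g x * indicator (?c y) x - exp ?t * indicator (?c y) x\<bar>)"
          by (intro integrable_abs Bochner_Integration.integrable_diff g_int c_sets ind_int)
        show "integrable \<mu> (\<lambda>x. (exp T * (exp \<eta> - 1)) * indicator (?c y) x)" by (rule ind_int)
        fix x
        show "\<bar>g x * indicator (?c y) x - exp ?t * indicator (?c y) x\<bar> \<le> (exp T * (exp \<eta> - 1)) * indicator (?c y) x"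
        proof (cases "x \<in> ?c y")
          case True
          have "\<bar>exp (?\<psi> x) - exp ?t\<bar> \<le> exp ?t * (exp \<eta> - 1)" by (rule exp_diff_bound[OF dev[OF True]])
          also have "\<dots> \<le> exp T * (exp \<eta> - 1)" using tT \<eta> by (intro mult_right_mono) auto
          finally show ?thesis using True cw(1)[OF True] by (simp add: g_def)
        qed simp
      qed
      also have "\<dots> = exp T * (exp \<eta> - 1) * measure \<mu> (?c y)"
        using sets.sets_into_space[OF c_sets(1)] by (simp add: Int_absorb2)
      also have "\<dots> \<le> exp T * (exp \<eta> - 1) * (measure \<mu> (?c y) + measure \<mu> (?c' y))"
        using K1 by (intro mult_left_mono) auto
      finally have 2: "\<bar>(\<integral>x. g x * indicator (?c y) x \<partial>\<mu>) - exp ?t * measure \<mu> (?c y)\<bar> \<le> exp T * (exp \<eta> - 1) * (measure \<mu> (?c y) + measure \<mu> (?c' y))" .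
      show ?thesis using 1 2 unfolding distrib_right by linarith
    qed
    have "\<bar>?L - ?R\<bar> = \<bar>\<Sum>y\<in>Y. measure \<mu> (?c' y) - (\<integral>x. g x * indicator (?c y) x \<partial>\<mu>)\<bar>"
      unfolding L R by (simp add: sum_subtractf)
    also have "\<dots> \<le> (\<Sum>y\<in>Y. ?K * (measure \<mu> (?c y) + measure \<mu> (?c' y)))"
      by (rule order_trans[OF sum_abs]) (intro sum_mono each)
    also have "\<dots> = ?K * ((\<Sum>y\<in>Y. measure \<mu> (?c y)) + (\<Sum>y\<in>Y. measure \<mu> (?c' y)))"
      by (subst sum_distrib_left[symmetric]) (simp only: sum.distrib)
    \<comment> \<open>Each of the two families of cylinders is disjoint, so each has total measure
      at most 1, however fine the partition.\<close>
    also have "\<dots> \<le> ?K * 2"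
    proof (rule mult_left_mono)
      have "(\<Sum>y\<in>Y. measure \<mu> (?c y)) = measure \<mu> (\<Union>y\<in>Y. ?c y)" "(\<Sum>y\<in>Y. measure \<mu> (?c' y)) = measure \<mu> (\<Union>y\<in>Y. ?c' y)"
        using Y(1) c_sets disj disj'
        by (intro finite_measure_finite_Union[symmetric]; auto simp: disjoint_family_on_def)+
      then show "(\<Sum>y\<in>Y. measure \<mu> (?c y)) + (\<Sum>y\<in>Y. measure \<mu> (?c' y)) \<le> 2"
        using prob_le_1[of "\<Union>y\<in>Y. ?c y"] prob_le_1[of "\<Union>y\<in>Y. ?c' y"] by linarith
      show "0 \<le> ?K" using K1 \<eta> by (intro add_nonneg_nonneg mult_nonneg_nonneg) auto
    qed
    finally show ?thesis .
  qed
  have "?L = ?R"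
  proof (rule ccontr)
    assume "?L \<noteq> ?R"
    then have pos: "0 < \<bar>?L - ?R\<bar>" by simp
    have "((\<lambda>\<eta>::real. ((1 + exp T) * (2 * sqrt (4 * \<eta>)) + exp T * (exp \<eta> - 1)) * 2) \<longlongrightarrow>
        ((1 + exp T) * (2 * sqrt (4 * 0)) + exp T * (exp 0 - 1)) * 2) (at_right 0)"
      by (intro tendsto_intros)
    then have "\<forall>\<^sub>F \<eta>::real in at_right 0. ((1 + exp T) * (2 * sqrt (4 * \<eta>)) + exp T * (exp \<eta> - 1)) * 2 < \<bar>?L - ?R\<bar>"
      using pos by (intro order_tendstoD(2)) auto
    moreover have "\<forall>\<^sub>F \<eta>::real in at_right 0. 0 < \<eta>" by (rule eventually_at_right_less)
    ultimately have "\<forall>\<^sub>F \<eta>::real in at_right 0. False"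
    proof eventually_elim
      case (elim \<eta>)
      then show ?case using main[of \<eta>] by linarith
    qed
    then show False by simp
  qed
  moreover have "ennreal ?R = (\<integral>\<^sup>+x. ennreal (g x * indicator C x) \<partial>\<mu>)"
    using g_int[OF Csets] g0 by (intro nn_integral_eq_integral[symmetric]) auto
  moreover have "ennreal (g x * indicator C x) = ennreal (exp (?\<psi> x)) * indicator (C \<inter> cyl W w) x" for x
    by (simp add: g_def indicator_def)
  ultimately show ?thesis by simp
qed

lemma swap_image:
  assumes I: "interchangeable W w w'" and S: "S \<subseteq> cyl W w"
  shows "patch W w' ` S = {y\<in>cyl W w'. patch W w y \<in> S}"
proof (intro equalityI subsetI)
  note ID = interchangeableD[OF I]
  fix y assume "y \<in> patch W w' ` S"
  then obtain x where x: "x \<in> S" "y = patch W w' x" by blast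
  have "x \<in> cyl W w" using x(1) S by blast
  then show "y \<in> {y\<in>cyl W w'. patch W w y \<in> S}" using ID(5,7)[of x] x by simp
next
  fix y assume y: "y \<in> {y\<in>cyl W w'. patch W w y \<in> S}"
  then have "patch W w' (patch W w y) = y" using interchangeableD(7)[OF interchangeable_sym[OF I], of y] by simp
  then show "y \<in> patch W w' ` S" using y by (metis (mono_tags, lifting) image_eqI mem_Collect_eq)
qed

lemma swap_preimage_sets:
  assumes I: "interchangeable W w w'" and S: "S \<in> sets \<mu>"
  shows "{y\<in>cyl W w'. patch W w y \<in> S} \<in> sets \<mu>"
proof -
  note I' = interchangeable_sym[OF I]
  have "{y\<in>cyl W w'. patch W w y \<in> S} = cyl W w' \<inter> (swap_map W w' w -` S \<inter> space \<mu>)"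
    by (auto simp: swap_map_def cyl_def space_mu)
  also have "\<dots> \<in> sets \<mu>"
    using cyl_sets[OF interchangeableD(1,2)[OF I]] measurable_sets[OF swap_map_measurable[OF I'] S] by auto
  finally show ?thesis .
qed

lemma swap_image_sets:
  "interchangeable W w w' \<Longrightarrow> S \<in> sets \<mu> \<Longrightarrow> S \<subseteq> cyl W w \<Longrightarrow> patch W w' ` S \<in> sets \<mu>"
  using swap_image swap_preimage_sets by simp

lemma window_generators:
  defines "E \<equiv> {{x\<in>X. restrict x V \<in> S} | V S. finite V \<and> V \<subseteq> carrier G}"
  shows "Int_stable E" "sets \<mu> = sigma_sets X E"
proof -
  show "Int_stable E"
  proof (rule Int_stableI)
    fix a b assume "a \<in> E" "b \<in> E"
    then obtain V S U T where *: "a = {x\<in>X. restrict x V \<in> S}" "finite V" "V \<subseteq> carrier G"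
      "b = {x\<in>X. restrict x U \<in> T}" "finite U" "U \<subseteq> carrier G"
      unfolding E_def by blast
    let ?Q = "{v. restrict v V \<in> S \<and> restrict v U \<in> T}"
    have "restrict (restrict x (V \<union> U)) V = restrict x V" "restrict (restrict x (V \<union> U)) U = restrict x U" for x :: "'g \<Rightarrow> 'a"
      by (auto simp: restrict_name_eq_iff)
    then have "a \<inter> b = {x\<in>X. restrict x (V \<union> U) \<in> ?Q}" unfolding * by auto
    moreover have "finite (V \<union> U)" "V \<union> U \<subseteq> carrier G" using * by auto
    ultimately show "a \<inter> b \<in> E" unfolding E_def by blast
  qed
  have "sigma_sets X ((\<lambda>(W, w). cyl W w) ` patterns) = sigma_sets X E"
  proof (rule sigma_sets_eqI)
    fix C assume "C \<in> (\<lambda>(W, w). cyl W w) ` patterns"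
    then obtain W w where C: "C = cyl W w" "finite W" "W \<subseteq> carrier G" by (auto simp: patterns_def)
    have "C = {x\<in>X. restrict x W \<in> {w}}" by (simp add: C cyl_def)
    then have "C \<in> E" using C unfolding E_def by blast
    then show "C \<in> sigma_sets X E" by (rule sigma_sets.Basic)
  next
    fix C assume "C \<in> E"
    then show "C \<in> sigma_sets X ((\<lambda>(W, w). cyl W w) ` patterns)"
      using window_sets unfolding E_def sets_mu sets_borel_XT by blast
  qed
  then show "sets \<mu> = sigma_sets X E" by (simp add: sets_mu sets_borel_XT)
qed

text \<open>\<open>swap_window\<close> settles the window events, which are stable under
  intersection and generate the Borel sets. Two finite measures that agree on them are
  equal.\<close>

lemma swap_change_of_variables:
  assumes I: "interchangeable W w w'" and S: "S \<in> sets \<mu>" "S \<subseteq> cyl W w"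
  shows "emeasure \<mu> (patch W w' ` S) = (\<integral>\<^sup>+x. ennreal (exp (\<psi> x (patch W w' x))) * indicator S x \<partial>\<mu>)"
proof (cases "w = w'")
  case True
  have "patch W w' x = x" if "x \<in> S" for x
    using patch_cyl[OF I, of x] that S(2) True by auto
  then have "patch W w' ` S = S"
    and "ennreal (exp (\<psi> x (patch W w' x))) * indicator S x = indicator S x" for x
    by (auto simp: cocycle_self indicator_def)
  then show ?thesis using S(1) by simp
next
  case ne: False
  note ID = interchangeableD[OF I] and I' = interchangeable_sym[OF I]
  let ?F = "\<lambda>x. ennreal (exp (\<psi> x (patch W w' x))) * indicator (cyl W w) x"
  \<comment> \<open>\<open>?M1\<close> is the part of \<mu> on the cylinder of \<open>w'\<close>,
    carried back to the cylinder of \<open>w\<close> by the reverse swap; \<open>?M2\<close> has the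
    claimed density.\<close>
  let ?M1 = "distr (density \<mu> (indicator (cyl W w'))) \<mu> (swap_map W w' w)" and ?M2 = "density \<mu> ?F"
  have c: "cyl W w \<in> sets \<mu>" "cyl W w' \<in> sets \<mu>" by (rule cyl_sets[OF ID(1,2)])+
  have F: "?F \<in> borel_measurable \<mu>"
  proof -
    have "(\<lambda>x. ennreal (exp (if x \<in> cyl W w then \<psi> x (patch W w' x) else 0)) * indicator (cyl W w) x) \<in> borel_measurable \<mu>"
      using cocycle_function_measurable[OF I] c(1) by measurable
    also have "(\<lambda>x. ennreal (exp (if x \<in> cyl W w then \<psi> x (patch W w' x) else 0)) * indicator (cyl W w) x) = ?F"
      by (auto simp: fun_eq_iff)
    finally show ?thesis .
  qed
  have m: "swap_map W w' w \<in> measurable (density \<mu> (indicator (cyl W w'))) \<mu>"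
    using swap_map_measurable[OF I'] by simp
  have M1: "emeasure ?M1 C = emeasure \<mu> {y\<in>cyl W w'. patch W w y \<in> C}" if C: "C \<in> sets \<mu>" for C
  proof -
    have pre: "swap_map W w' w -` C \<inter> space \<mu> \<in> sets \<mu>" using measurable_sets[OF swap_map_measurable[OF I'] C] .
    have "emeasure ?M1 C = emeasure (density \<mu> (indicator (cyl W w'))) (swap_map W w' w -` C \<inter> space \<mu>)"
      using emeasure_distr[OF m C] by simp
    also have "\<dots> = (\<integral>\<^sup>+x. indicator (cyl W w') x * indicator (swap_map W w' w -` C \<inter> space \<mu>) x \<partial>\<mu>)"
      using c pre by (intro emeasure_density) auto
    also have "\<dots> = (\<integral>\<^sup>+x. indicator {y\<in>cyl W w'. patch W w y \<in> C} x \<partial>\<mu>)"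
      by (intro nn_integral_cong) (auto simp: indicator_def swap_map_def)
    also have "\<dots> = emeasure \<mu> {y\<in>cyl W w'. patch W w y \<in> C}"
      using swap_preimage_sets[OF I C] by simp
    finally show ?thesis .
  qed
  have M2: "emeasure ?M2 C = (\<integral>\<^sup>+x. ennreal (exp (\<psi> x (patch W w' x))) * indicator (C \<inter> cyl W w) x \<partial>\<mu>)" if C: "C \<in> sets \<mu>" for C
    unfolding emeasure_density[OF F C] by (intro nn_integral_cong) (auto simp: indicator_def)
  let ?E = "{{x\<in>X. restrict x V \<in> S} | V S. finite V \<and> V \<subseteq> carrier G}"
  have "?M1 = ?M2"
  proof (rule measure_eqI_generator_eq[where E = ?E and \<Omega> = X and A = "\<lambda>_. X"])
    show "Int_stable ?E" "sets ?M1 = sigma_sets X ?E" "sets ?M2 = sigma_sets X ?E"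
      using window_generators by simp_all
    show "?E \<subseteq> Pow X" by auto
    fix C assume "C \<in> ?E"
    then obtain V T where C: "C = {x\<in>X. restrict x V \<in> T}" "finite V" "V \<subseteq> carrier G" by blast
    have Cs: "C \<in> sets \<mu>" unfolding C(1) by (rule window_sets[OF C(2,3)])
    show "emeasure ?M1 C = emeasure ?M2 C"
      unfolding M1[OF Cs] M2[OF Cs] emeasure_eq_measure by (rule swap_window[OF I ne C(2,3,1)])
  next
    have "X = {x\<in>X. restrict x {} \<in> UNIV}" by simp
    then show "range (\<lambda>_. X) \<subseteq> ?E" by blast
    show "emeasure ?M1 X \<noteq> \<infinity>" using M1[of X] emeasure_finite sets.top[of \<mu>] by (simp add: space_mu)
  qed simp
  then have "emeasure ?M1 S = emeasure ?M2 S" by simp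
  moreover have "S \<inter> cyl W w = S" using S(2) by blast
  ultimately show ?thesis using M1[OF S(1)] M2[OF S(1)] swap_image[OF I S(2)] by simp
qed

section \<open>From single swaps to the homoclinic relation\<close>

definition swaps :: "('g set \<times> ('g \<Rightarrow> 'a) \<times> ('g \<Rightarrow> 'a)) set" where
  "swaps = {(W, w, w'). interchangeable W w w'}"

lemma countable_swaps: "countable swaps"
proof (rule countable_subset)
  show "swaps \<subseteq> (\<lambda>((W, w), (V, w')). (W, w, w')) ` (patterns \<times> patterns)"
  proof clarify
    fix W w w' assume "(W, w, w') \<in> swaps"
    then have "(W, w) \<in> patterns" "(W, w') \<in> patterns"
      using interchangeableD(1-4)[of W w w'] by (auto simp: swaps_def patterns_def)
    then show "(W, w, w') \<in> (\<lambda>((W, w), (V, w')). (W, w, w')) ` (patterns \<times> patterns)"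
      by (intro image_eqI[of _ _ "((W, w), (W, w'))"]) auto
  qed
  show "countable ((\<lambda>((W, w), (V, w')). (W, w, w')) ` (patterns \<times> patterns))"
    using countable_patterns by (intro countable_image countable_SIGMA)
qed

text \<open>The relation is covered by the graphs of countably many partial swaps, so that null sets
  and Borel partitions can be handled one swap at a time.\<close>

lemma homoclinic_swap:
  assumes "(x, y) \<in> homoclinic_relation0 G A X"
  shows "\<exists>(W, w, w')\<in>swaps. x \<in> cyl W w \<and> y = patch W w' x"
  using assms local_homeomorphism_patch unfolding homoclinic_relation0_def swaps_def by fast

text \<open>The saturation of a null set lies in the union of its images under the countably many
  partial swaps. Each image is null, because its measure is the integral of a density over a null
  set.\<close>

lemma nonsingular_homoclinic: "nonsingular \<mu> (homoclinic_relation0 G A X)"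
  unfolding nonsingular_def
proof
  fix N assume "N \<in> null_sets (completion \<mu>)"
  then obtain N' where N': "N' \<in> null_sets \<mu>" "N \<subseteq> N'" by (auto simp: null_sets_completion_iff2)
  let ?J = "\<lambda>(W, w, w'). patch W w' ` (N' \<inter> cyl W w)"
  have "?J k \<in> null_sets \<mu>" if kS: "k \<in> swaps" for k
  proof -
    obtain W w w' where k: "k = (W, w, w')" "interchangeable W w w'" using kS by (auto simp: swaps_def)
    have S: "N' \<inter> cyl W w \<in> sets \<mu>" "N' \<inter> cyl W w \<subseteq> cyl W w"
      using N' cyl_sets[OF interchangeableD(1,2)[OF k(2)]] by auto
    have "AE x in \<mu>. x \<notin> N'" using N'(1) by (rule AE_not_in)
    then have "(\<integral>\<^sup>+x. ennreal (exp (\<psi> x (patch W w' x))) * indicator (N' \<inter> cyl W w) x \<partial>\<mu>) = (\<integral>\<^sup>+x. 0 \<partial>\<mu>)"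
      by (intro nn_integral_cong_AE) (auto elim!: eventually_mono)
    then show ?thesis
      using swap_change_of_variables[OF k(2) S] swap_image_sets[OF k(2) S] by (simp add: k(1) null_sets_def)
  qed
  then have "(\<Union>k\<in>swaps. ?J k) \<in> null_sets \<mu>" using countable_swaps by (intro null_sets_UN')
  moreover have "{y \<in> space \<mu>. \<exists>x\<in>N. (x, y) \<in> homoclinic_relation0 G A X} \<subseteq> (\<Union>k\<in>swaps. ?J k)"
  proof clarify
    fix x y assume xy: "x \<in> N" "(x, y) \<in> homoclinic_relation0 G A X"
    then obtain W w w' where k: "(W, w, w') \<in> swaps" "x \<in> cyl W w" "y = patch W w' x"
      using homoclinic_swap by blast
    then have "y \<in> ?J (W, w, w')" using xy N' by auto
    then show "y \<in> (\<Union>k\<in>swaps. ?J k)" using k(1) by blast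
  qed
  ultimately show "{y \<in> space \<mu>. \<exists>x\<in>N. (x, y) \<in> homoclinic_relation0 G A X} \<in> null_sets (completion \<mu>)"
    by (auto simp: null_sets_completion_iff2)
qed

text \<open>The isomorphism \<open>f\<close> need not be continuous, but at each point it agrees
  with one of countably many swaps. The set where it agrees with a given swap is measurable; the
  change of variables holds there, and injectivity of \<open>f\<close> lets the images of disjoint
  pieces be added.\<close>

lemma radon_nikodym_homoclinic:
  assumes f: "measurable_isomorphism \<mu> f" and R: "\<And>x. x \<in> space \<mu> \<Longrightarrow> (x, f x) \<in> homoclinic_relation0 G A X"
  shows "AE x in \<mu>. RN_deriv \<mu> (image_measure \<mu> f) x = ennreal (exp (\<psi> x (f x)))"
proof -
  have fm: "f \<in> measurable \<mu> \<mu>" and inj: "inj_on f X"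
    using f by (auto simp: measurable_isomorphism_def bij_betw_def space_mu)
  let ?piece = "\<lambda>(W, w, w'). {x\<in>cyl W w. f x = patch W w' x}"
  have cover: "\<exists>k\<in>swaps. x \<in> ?piece k" if "x \<in> X" for x
    using homoclinic_swap[OF R[of x]] that by (fastforce simp: space_mu)
  then have ne: "swaps \<noteq> {}" using X_nonempty by blast
  define K where "K = from_nat_into swaps"
  have K: "range K = swaps" unfolding K_def by (rule range_from_nat_into[OF ne countable_swaps])
  have piece_sets: "?piece k \<in> sets \<mu>" if kS: "k \<in> swaps" for k
  proof -
    obtain W w w' where k: "k = (W, w, w')" "interchangeable W w w'" using kS by (auto simp: swaps_def)
    note ID = interchangeableD[OF k(2)]
    \<comment> \<open>Both maps take values in \<open>X\<close>, so they coincide at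
      \<open>x\<close> iff they coincide in the countably many coordinates, each with values in the
      finite alphabet.\<close>
    have "?piece k = cyl W w \<inter> {x\<in>space \<mu>. f x = swap_map W w w' x}"
      by (auto simp: k(1) swap_map_def cyl_def space_mu)
    also have "{x\<in>space \<mu>. f x = swap_map W w w' x} = {x\<in>space \<mu>. \<forall>h\<in>carrier G. f x h = swap_map W w w' x h}"
      using measurable_space[OF fm] swap_map_X[OF k(2)] by (auto simp: space_mu intro: X_eqI)
    also have "cyl W w \<inter> \<dots> \<in> sets \<mu>"
    proof (intro sets.Int cyl_sets[OF ID(1,2)])
      have coord: "(\<lambda>x. x h) \<in> measurable \<mu> (count_space UNIV)" if "h \<in> carrier G" for h
        using simple_coordinate[OF that] by (rule measurable_simple_function)
      have fin: "{x\<in>space \<mu>. f x h = swap_map W w w' x h} \<in> sets \<mu>" if h: "h \<in> carrier G" for h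
      proof -
        have "f x h \<in> A" if "x \<in> space \<mu>" for x
          using X_in[OF _ h, of "f x"] measurable_space[OF fm that] by (simp add: space_mu)
        then have "{x\<in>space \<mu>. f x h = swap_map W w w' x h} = {x\<in>space \<mu>. f x h = swap_map W w w' x h \<and> f x h \<in> A}"
          by blast
        also have "\<dots>
          = (\<Union>a\<in>A. ((\<lambda>x. f x h) -` {a} \<inter> space \<mu>) \<inter> ((\<lambda>x. swap_map W w w' x h) -` {a} \<inter> space \<mu>))"
          by auto
        also have "\<dots> \<in> sets \<mu>"
          using finite_alphabet measurable_compose[OF fm coord[OF h]] measurable_compose[OF swap_map_measurable[OF k(2)] coord[OF h]]
          by (intro sets.finite_UN sets.Int measurable_sets) auto
        finally show ?thesis .
      qed
      show "{x\<in>space \<mu>. \<forall>h\<in>carrier G. f x h = swap_map W w w' x h} \<in> sets \<mu>"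
        using countable_carrier by (intro sets.sets_Collect_countable_All' fin)
    qed
    finally show ?thesis .
  qed
  have KS: "K n \<in> swaps" for n using K by (metis rangeI)
  define P where "P n = ?piece (K n)" for n
  have P: "P n \<in> sets \<mu>" for n unfolding P_def by (rule piece_sets[OF KS])
  have PX: "(\<Union>n. P n) = X"
  proof (intro equalityI subsetI)
    fix x assume "x \<in> X"
    then obtain k where k: "k \<in> swaps" "x \<in> ?piece k" using cover by blast
    then obtain n where "k = K n" using K by (metis rangeE)
    then have "x \<in> P n" using k(2) unfolding P_def by (rule subst)
    then show "x \<in> (\<Union>n. P n)" by blast
  qed (use sets.sets_into_space[OF P] in \<open>auto simp: space_mu\<close>)
  let ?D = "disjointed P"
  have D: "?D n \<in> sets \<mu>" for n using sets.range_disjointed_sets[of P \<mu>] P by blast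
  have DP: "?D n \<subseteq> P n" for n by (rule disjointed_subset)
  have DX: "(\<Union>n. ?D n) = X" by (simp add: UN_disjointed_eq PX)
  \<comment> \<open>On a piece the cocycle of \<open>f\<close> is that of a fixed swap, whose
    superlevel sets are measurable.\<close>
  have Fm: "(\<lambda>x. \<psi> x (f x)) \<in> borel_measurable \<mu>"
    unfolding borel_measurable_iff_greater
  proof
    fix r
    define Q where "Q n = (case K n of (W, w, w') \<Rightarrow> {x\<in>cyl W w. r < \<psi> x (patch W w' x)})" for n
    have Q: "Q n \<in> sets \<mu>" for n
      using cocycle_superlevel_sets KS[of n] by (auto simp: Q_def swaps_def)
    have iff: "x \<in> Q n \<longleftrightarrow> r < \<psi> x (f x)" if "x \<in> P n" for x n
      using that by (auto simp: P_def Q_def split: prod.splits)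
    have "{x\<in>space \<mu>. r < \<psi> x (f x)} = (\<Union>n. P n \<inter> Q n)"
    proof (intro equalityI subsetI)
      fix x assume x: "x \<in> {x\<in>space \<mu>. r < \<psi> x (f x)}"
      then have "x \<in> (\<Union>n. P n)" unfolding PX by (simp add: space_mu)
      then obtain n where "x \<in> P n" by (rule UN_E)
      then show "x \<in> (\<Union>n. P n \<inter> Q n)" using iff x by blast
    next
      fix x assume "x \<in> (\<Union>n. P n \<inter> Q n)"
      then obtain n where n: "x \<in> P n" "x \<in> Q n" by blast
      then show "x \<in> {x\<in>space \<mu>. r < \<psi> x (f x)}"
        using iff sets.sets_into_space[OF P[of n]] by blast
    qed
    also have "\<dots> \<in> sets \<mu>" using P Q by (intro sets.countable_UN) auto
    finally show "{x\<in>space \<mu>. r < \<psi> x (f x)} \<in> sets \<mu>" .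
  qed
  let ?e = "\<lambda>x. ennreal (exp (\<psi> x (f x)))"
  have em: "?e \<in> borel_measurable \<mu>" using Fm by measurable
  have on_piece: "f ` T \<in> sets \<mu> \<and> emeasure \<mu> (f ` T) = emeasure (density \<mu> ?e) T"
    if T: "T \<in> sets \<mu>" "T \<subseteq> P n" for T n
  proof -
    obtain W w w' where k: "K n = (W, w, w')" "interchangeable W w w'" using KS[of n] by (auto simp: swaps_def)
    have Tw: "x \<in> cyl W w" "f x = patch W w' x" if "x \<in> T" for x using that T(2) by (auto simp: P_def k(1))
    have im: "f ` T = patch W w' ` T" using Tw(2) by (intro image_cong) auto
    have sub: "T \<subseteq> cyl W w" using Tw(1) by blast
    have "emeasure \<mu> (f ` T) = (\<integral>\<^sup>+x. ?e x * indicator T x \<partial>\<mu>)"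
      unfolding im swap_change_of_variables[OF k(2) T(1) sub]
      by (intro nn_integral_cong) (simp add: Tw(2) indicator_def)
    then show ?thesis using swap_image_sets[OF k(2) T(1) sub] im emeasure_density[OF em T(1)] by simp
  qed
  have total: "emeasure \<mu> (f ` S) = emeasure (density \<mu> ?e) S" if S: "S \<in> sets \<mu>" for S
  proof -
    have SX: "S \<subseteq> X" using sets.sets_into_space[OF S] by (simp add: space_mu)
    have SD: "S \<inter> ?D n \<in> sets \<mu>" "S \<inter> ?D n \<subseteq> P n" for n using S D DP by auto
    have S_eq: "S = (\<Union>n. S \<inter> ?D n)" using SX DX by blast
    have disj: "disjoint_family (\<lambda>n. S \<inter> ?D n)"
      using disjoint_family_disjointed[of P] by (auto simp: disjoint_family_on_def)
    have "disjoint_family (\<lambda>n. f ` (S \<inter> ?D n))"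
      unfolding disjoint_family_on_def
    proof (intro ballI impI)
      fix m n :: nat assume "m \<noteq> n"
      then have "(S \<inter> ?D m) \<inter> (S \<inter> ?D n) = {}" using disj by (auto simp: disjoint_family_on_def)
      moreover have "f ` (S \<inter> ?D m) \<inter> f ` (S \<inter> ?D n) = f ` ((S \<inter> ?D m) \<inter> (S \<inter> ?D n))"
        using SX by (intro inj_on_image_Int[OF inj, symmetric]) auto
      ultimately show "f ` (S \<inter> ?D m) \<inter> f ` (S \<inter> ?D n) = {}" by simp
    qed
    then have "(\<Sum>n. emeasure \<mu> (f ` (S \<inter> ?D n))) = emeasure \<mu> (\<Union>n. f ` (S \<inter> ?D n))"
      using on_piece[OF SD] by (intro suminf_emeasure) auto
    moreover have "(\<Union>n. f ` (S \<inter> ?D n)) = f ` S" using S_eq by blast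
    moreover have "(\<Sum>n. emeasure (density \<mu> ?e) (S \<inter> ?D n)) = emeasure (density \<mu> ?e) (\<Union>n. S \<inter> ?D n)"
      using SD(1) disj by (intro suminf_emeasure) auto
    ultimately show ?thesis using on_piece[OF SD] S_eq by simp
  qed
  \<comment> \<open>By \<open>total\<close>, the set function in \<open>image_measure\<close> is
    that of a density and therefore countably additive; for a set function that is not a measure,
    \<open>measure_of\<close> would fall back to the value 0.\<close>
  have "density \<mu> ?e = image_measure \<mu> f"
    unfolding density_def image_measure_def
  proof (rule measure_of_eq)
    show "sets \<mu> \<subseteq> Pow (space \<mu>)" by (rule sets.space_closed)
    fix S assume "S \<in> sigma_sets (space \<mu>) (sets \<mu>)"
    then have S: "S \<in> sets \<mu>" by (simp add: sets.sigma_sets_eq)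
    show "(\<integral>\<^sup>+x. ?e x * indicator S x \<partial>\<mu>) = emeasure \<mu> (f ` S)"
      using total[OF S] emeasure_density[OF em S] by simp
  qed
  from RN_deriv_unique[OF em this] show ?thesis by (auto elim: eventually_mono)
qed

theorem conformal_homoclinic: "conformal \<mu> (homoclinic_relation0 G A X) (potential_cocycle G \<phi>)"
  unfolding conformal_def using nonsingular_homoclinic radon_nikodym_homoclinic by blast

end

theorem corollary4:
  fixes G :: "('g, 'm) monoid_scheme"
    and A :: "'a set"
    and X :: "('g \<Rightarrow> 'a) set"
    and \<phi> :: "('g \<Rightarrow> 'a) \<Rightarrow> real"
    and \<mu> :: "('g \<Rightarrow> 'a) measure"
  assumes "group G"
    and "countable (carrier G)"
    and "amenable G"
    and "finite A"
    and "subshift G A X"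
    and "summable_variation G A X \<phi>"
    and "equilibrium_state G A X \<phi> \<mu>"
  shows "conformal \<mu> (homoclinic_relation0 G A X) (potential_cocycle G \<phi>)"
proof -
  have \<mu>: "prob_space \<mu>" "sets \<mu> = sets (borel_of (subshift_topology G A X))"
    "\<And>g. g \<in> carrier G \<Longrightarrow> distr \<mu> \<mu> (shift G g) = \<mu>"
    using assms(7) by (auto simp: equilibrium_state_def invariant_measures_def borel_prob_measures_def)
  interpret equilibrium_measure G A X \<mu> \<phi>
    by (intro equilibrium_measure.intro subshift_measure.intro subshift_system.intro
        subshift_system_axioms.intro subshift_measure_axioms.intro equilibrium_measure_axioms.intro assms \<mu>)
  show ?thesis by (rule conformal_homoclinic)
qed

end
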